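(* Let $\ell<0\le r$ be integers, $n_\ell,\ldots,n_r$ positive integers, $V=\bigcup_{i=\ell}^rV_i$ with $V_i=\{i^1,\ldots,i^{n_i}\}$, and $\mathcal{S}\subset\mathbb{Z}$ with $\min\mathcal{S}=-1$ and $\max\mathcal{S}=1$. There exists a bijection $\Phi$ between $\mathcal{S}$-functions $f:V\setminus\{0^1\}\to V$ satisfying (F): $f(i^1)=(i+1)^1$ for $\ell\le i\le -2$, $f((-1)^1)\in V_0$, and $f(i^1)=(i-1)^1$ for $1\le i\le r$, and marked $\mathcal{S}$-trees on the vertex set $V$ satisfying $(\mathrm{T}_1)$ and $(\mathrm{T}_2)$. Moreover this bijection (a) preserves, for all $j$ and $s$, the number of vertices of out-type $(j;s)$, and (b) preserves, for all $i$ and $\mathbf{c}$, the number of vertices of in-type $(i;\mathbf{c})$.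
   Context: A vertex $i^k$ has abscissa $i$; $V$ is totally ordered by $i^k\le j^p$ iff $i<j$, or $i=j$ and $k\le p$. A partial function $f$ on $V$ is an $\mathcal{S}$-function if $f(v)\in\bigcup_{s\in\mathcal{S}}V_{a(v)-s}$ whenever defined. The out-type of $v$ is $(a(v);s)$ where $a(f(v))=a(v)-s$; its in-type is $(a(v);c^{-1},c^0,c^1)$ where $c^k$ is the number of preimages of $v$ at abscissa $a(v)+k$. An $\mathcal{S}$-tree is a rooted tree on $V$ in which the parent of each non-root vertex of $V_i$ lies in $\bigcup_{s\in\mathcal{S}}V_{i-s}$; its parent map (edges oriented to the root) defines in/out-types. A marked $\mathcal{S}$-tree is a pair $(T,r^q)$ where $T$ is an $\mathcal{S}$-tree on $V$ rooted at a vertex of $V_0$ and $r^q\in V_r$. Let $\ell^1\wedge r^q$ denote the common ancestor of $\ell^1$ and $r^q$ farthest from the root. "Preceded/followed by" below refers to the immediate predecessor/successor along the path. $(\mathrm{T}_1)$: on the path from $r^q$ to the root, for every $i\in\{1,\ldots,r\}$, the first vertex belonging to $V_{i-1}$ is preceded by $i^1$. $(\mathrm{T}_2')$: on the path from $r^q$ to the root, $1^1$ appears strictly before $\ell^1\wedge r^q$; and on the path from $\ell^1$ to the root, for every $i\in\{\ell+1,\ldots,0\}$, the last vertex belonging to $V_{i-1}$ is followed by $i^1$. $(\mathrm{T}_2'')$: on the path from $r^q$ to the root, $1^1$ appears weakly after $\ell^1\wedge r^q$; $\ell^1\wedge r^q$ has positive abscissa; on the path from $\ell^1$ to $\ell^1\wedge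 r^q$, for every $i\in\{\ell+1,\ldots,-1\}$, the last vertex of $V_{i-1}$ is followed by $i^1$; and on the path from $r^q$ to the root, $0^1$ precedes the first vertex of $V_{-1}$ if such a vertex exists, while otherwise $0^1$ is the root. $(\mathrm{T}_2)$: $(\mathrm{T}_2')$ or $(\mathrm{T}_2'')$ holds.
   Formalization: For r = 0 the vertex 1^1 does not exist and (T_2) read literally could never hold, making the claim false; the requirement in (T_2') that 1^1 appear strictly before the meet of ℓ^1 and r^q is therefore imposed only when r ≥ 1. *)

theory Defs
  imports Complex_Main "Graph_Theory.Graph_Theory"
begin

text \<open>The pair \<open>(i, k)\<close> is the vertex \<open>i^k\<close>, and its abscissa is \<open>i\<close>.\<close>

type_synonym vertex = "int \<times> nat"

abbreviation abscissa :: "vertex \<Rightarrow> int" where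
  "abscissa \<equiv> fst"

definition vertex_set :: "int \<Rightarrow> int \<Rightarrow> (int \<Rightarrow> nat) \<Rightarrow> vertex set" where
  "vertex_set l r n = (SIGMA i : {l..r}. {1..n i})"

definition level :: "vertex set \<Rightarrow> int \<Rightarrow> vertex set" where
  "level V i = {v \<in> V. abscissa v = i}"


definition S_function :: "int set \<Rightarrow> vertex set \<Rightarrow> (vertex \<rightharpoonup> vertex) \<Rightarrow> bool" where
  "S_function S V f \<longleftrightarrow> dom f \<subseteq> V \<and>
     (\<forall>v w. f v = Some w \<longrightarrow> w \<in> (\<Union>s\<in>S. level V (abscissa v - s)))"

definition condition_F :: "int \<Rightarrow> int \<Rightarrow> vertex set \<Rightarrow> (vertex \<rightharpoonup> vertex) \<Rightarrow> bool" where
  "condition_F l r V f \<longleftrightarrow>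
     (\<forall>i\<in>{l..-2}. f (i, 1) = Some (i + 1, 1)) \<and>
     (\<exists>w\<in>level V 0. f (-1, 1) = Some w) \<and>
     (\<forall>i\<in>{1..r}. f (i, 1) = Some (i - 1, 1))"

definition out_type :: "(vertex \<rightharpoonup> vertex) \<Rightarrow> vertex \<Rightarrow> (int \<times> int) option" where
  "out_type f v = map_option (\<lambda>w. (abscissa v, abscissa v - abscissa w)) (f v)"

definition preimages_at :: "(vertex \<rightharpoonup> vertex) \<Rightarrow> vertex \<Rightarrow> int \<Rightarrow> nat" where
  "preimages_at f v k = card {u. f u = Some v \<and> abscissa u = abscissa v + k}"

definition in_type :: "(vertex \<rightharpoonup> vertex) \<Rightarrow> vertex \<Rightarrow> int \<times> nat \<times> nat \<times> nat" where
  "in_type f v = (abscissa v, preimages_at f v (-1), preimages_at f v 0, preimages_at f v 1)"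


text \<open>A simple graph is a finite symmetric loop-free digraph (\<open>pair_graph\<close>). The predicate
  \<open>forest\<close> of the library is not suitable for these, because it counts the closed walk
  going back and forth along one edge as a cycle; hence the bound on the length below.\<close>

definition tree_graph :: "'a pair_pre_digraph \<Rightarrow> bool" where
  "tree_graph G \<longleftrightarrow> pair_graph G \<and> connected (with_proj G) \<and>
     \<not> (\<exists>c. pre_digraph.cycle (with_proj G) c \<and> length c \<ge> 3)"

text \<open>The unique path from \<open>u\<close> to \<open>v\<close> in a tree, as the list of its vertices.\<close>

definition tree_path :: "'a pair_pre_digraph \<Rightarrow> 'a \<Rightarrow> 'a \<Rightarrow> 'a list" where
  "tree_path G u v = (THE p. vpath p (with_proj G) \<and> hd p = u \<and> last p = v)"

type_synonym 'a rooted = "'a pair_pre_digraph \<times> 'a"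

definition rooted_tree :: "'a set \<Rightarrow> 'a rooted \<Rightarrow> bool" where
  "rooted_tree V T \<longleftrightarrow> tree_graph (fst T) \<and> pverts (fst T) = V \<and> snd T \<in> V"

definition root_path :: "'a rooted \<Rightarrow> 'a \<Rightarrow> 'a list" where
  "root_path T v = tree_path (fst T) v (snd T)"

definition parent :: "'a rooted \<Rightarrow> 'a \<rightharpoonup> 'a" where
  "parent T v =
     (if v \<in> pverts (fst T) \<and> v \<noteq> snd T then Some (root_path T v ! 1) else None)"

text \<open>Every vertex is an ancestor of itself.\<close>

definition meet :: "'a rooted \<Rightarrow> 'a \<Rightarrow> 'a \<Rightarrow> 'a" where
  "meet T u v =
     (ARG_MAX (\<lambda>x. length (root_path T x)) x. x \<in> set (root_path T u) \<inter> set (root_path T v))"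

definition S_tree :: "int set \<Rightarrow> vertex set \<Rightarrow> vertex rooted \<Rightarrow> bool" where
  "S_tree S V T \<longleftrightarrow> rooted_tree V T \<and>
     (\<forall>v\<in>V - {snd T}. the (parent T v) \<in> (\<Union>s\<in>S. level V (abscissa v - s)))"

definition marked_S_tree ::
  "int set \<Rightarrow> vertex set \<Rightarrow> int \<Rightarrow> vertex rooted \<times> vertex \<Rightarrow> bool" where
  "marked_S_tree S V r = (\<lambda>(T, m). S_tree S V T \<and> snd T \<in> level V 0 \<and> m \<in> level V r)"


definition strictly_before :: "'a list \<Rightarrow> 'a \<Rightarrow> 'a \<Rightarrow> bool" where
  "strictly_before p u v \<longleftrightarrow> (\<exists>xs ys zs. p = xs @ u # ys @ v # zs)"

definition weakly_after :: "'a list \<Rightarrow> 'a \<Rightarrow> 'a \<Rightarrow> bool" where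
  "weakly_after p u v \<longleftrightarrow> u \<in> set p \<and> (u = v \<or> strictly_before p v u)"

text \<open>The path \<open>p\<close> visits abscissa \<open>a\<close>, and the immediate predecessor on \<open>p\<close> of its first
  vertex at abscissa \<open>a\<close> is \<open>v\<close>.\<close>

definition first_preceded_by :: "vertex list \<Rightarrow> int \<Rightarrow> vertex \<Rightarrow> bool" where
  "first_preceded_by p a v \<longleftrightarrow>
     (\<exists>xs w ys. p = xs @ v # w # ys \<and> abscissa w = a \<and>
        (\<forall>u\<in>set (xs @ [v]). abscissa u \<noteq> a))"

text \<open>The path \<open>p\<close> visits abscissa \<open>a\<close>, and the immediate successor on \<open>p\<close> of its last
  vertex at abscissa \<open>a\<close> is \<open>v\<close>.\<close>

definition last_followed_by :: "vertex list \<Rightarrow> int \<Rightarrow> vertex \<Rightarrow> bool" where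
  "last_followed_by p a v \<longleftrightarrow>
     (\<exists>xs w ys. p = xs @ w # v # ys \<and> abscissa w = a \<and>
        (\<forall>u\<in>set (v # ys). abscissa u \<noteq> a))"

definition T1 :: "int \<Rightarrow> vertex rooted \<times> vertex \<Rightarrow> bool" where
  "T1 r = (\<lambda>(T, m). \<forall>i\<in>{1..r}. first_preceded_by (root_path T m) (i - 1) (i, 1))"

text \<open>For \<open>r = 0\<close> there is no vertex \<open>1^1\<close>, and the requirement on its position in the first
  alternative is void. This is consistent with the case \<open>r > 0\<close>, where \<open>T1\<close> makes \<open>1^1\<close> the
  immediate predecessor of the first vertex at abscissa \<open>0\<close>: the requirement then says that
  this first vertex occurs weakly before the meet, which for \<open>r = 0\<close> holds trivially, the
  vertex in question being the start of the path.\<close>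

definition T2' :: "int \<Rightarrow> int \<Rightarrow> vertex rooted \<times> vertex \<Rightarrow> bool" where
  "T2' l r = (\<lambda>(T, m).
     (r \<ge> 1 \<longrightarrow> strictly_before (root_path T m) (1, 1) (meet T (l, 1) m)) \<and>
     (\<forall>i\<in>{l+1..0}. last_followed_by (root_path T (l, 1)) (i - 1) (i, 1)))"

definition T2'' :: "int \<Rightarrow> vertex rooted \<times> vertex \<Rightarrow> bool" where
  "T2'' l = (\<lambda>(T, m).
     weakly_after (root_path T m) (1, 1) (meet T (l, 1) m) \<and>
     abscissa (meet T (l, 1) m) > 0 \<and>
     (\<forall>i\<in>{l+1..-1}.
        last_followed_by (tree_path (fst T) (l, 1) (meet T (l, 1) m)) (i - 1) (i, 1)) \<and>
     (if \<exists>v\<in>set (root_path T m). abscissa v = -1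
      then first_preceded_by (root_path T m) (-1) (0, 1)
      else snd T = (0, 1)))"

definition T2 :: "int \<Rightarrow> int \<Rightarrow> vertex rooted \<times> vertex \<Rightarrow> bool" where
  "T2 l r M \<longleftrightarrow> T2' l r M \<or> T2'' l M"

end

theory Submission
  imports Defs "HOL-Combinatorics.Transposition"
begin

text \<open>
  Replacing \<open>f\<close> by \<open>\<sigma> \<circ> f \<circ> \<pi>\<close>, where \<open>\<sigma>\<close> and \<open>\<pi>\<close> permute the vertices inside each abscissa,
  changes neither the number of vertices of a given out-type nor of a given in-type. Hence it
  suffices to turn functions into trees bijectively by such rearrangements. The marked vertex is
  treated as the parent of an extra vertex \<open>(r + 1, 1)\<close>, which a function sends to \<open>(r, 1)\<close>.

  If a path ends at a point where \<open>f\<close> is undefined, \<open>e\<close> is a vertex of it and \<open>v\<close> lies on a cycle at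
  the same abscissa, then \<open>f\<close> composed with the transposition of \<open>e\<close> and \<open>v\<close> has the cycle inserted
  into the path behind \<open>e\<close>. As in Foata's correspondence, inserting the cycles in the order of
  their minimal vertices, each one behind the latest insertion at its abscissa, is reversible.

  First the cycles of positive abscissa are inserted into the path \<open>(r + 1, 1), \<dots>, (1, 1), (0, 1)\<close>;
  interchanging the ends of the resulting segments gives \<open>T1\<close>. Let \<open>w\<close> be the image of \<open>(-1, 1)\<close>.
  If \<open>w\<close> does not lead to \<open>(1, 1)\<close>, then exchanging the vertices \<open>(0, 1)\<close> and \<open>w\<close> as images makes
  \<open>(l, 1), \<dots>, (0, 1)\<close> a complete path, and inserting the remaining cycles yields \<open>T2'\<close>. If it does,
  the path from \<open>w\<close> to \<open>(1, 1)\<close> is cut at its first and last visits to abscissa \<open>-1\<close>, the pieces are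
  reordered, and inserting the remaining cycles yields \<open>T2''\<close>.
\<close>

section \<open>Paths and cycles of partial functions\<close>

text \<open>The extra vertex is alone at abscissa \<open>r + 1\<close>, so every rearrangement fixes
  it; its edge carries the mark along without disturbing the counts on \<open>V\<close>. For
  \<open>r = 0\<close> it is \<open>(1, 1)\<close> itself: it is nobody's image, so every function
  belongs to the case without a path to \<open>(1, 1)\<close>, and \<open>r = 0\<close> needs no
  separate argument. The target dictates the operations. \<open>T1\<close> and \<open>T2\<close> cut
  paths at first or last visits to an abscissa. As a step changes the abscissa by at most one, the
  pieces are segments that begin and end at abscissa \<open>i\<close> and stay at or above it, which
  is what inserting cycles through lowest vertices produces. Insertion keeps the beginning of a
  segment, whereas conditions on first visits prescribe its end; hence the interchange of ends. The
  obstacle is that the image of \<open>(-1, 1)\<close> is an arbitrary vertex of abscissa 0, so the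
  path from \<open>(l, 1)\<close> may run into the one from the mark before \<open>(1, 1)\<close>.
  Whether \<open>(1, 1)\<close> lies on the final path from \<open>(l, 1)\<close> records the case,
  so the two images are disjoint. After the positive cycles are inserted, only vertices of abscissa
  at most 0 are moved, so \<open>T1\<close> survives.\<close>

definition fpath :: "('a \<rightharpoonup> 'a) \<Rightarrow> 'a list \<Rightarrow> bool" where
  "fpath g xs \<longleftrightarrow> successively (\<lambda>x y. g x = Some y) xs"

definition full_path :: "('a \<rightharpoonup> 'a) \<Rightarrow> 'a list \<Rightarrow> bool" where
  "full_path g xs \<longleftrightarrow> xs \<noteq> [] \<and> fpath g xs \<and> g (last xs) = None"

definition fcycle :: "('a \<rightharpoonup> 'a) \<Rightarrow> 'a list \<Rightarrow> bool" where
  "fcycle g c \<longleftrightarrow> c \<noteq> [] \<and> distinct c \<and> fpath g c \<and> g (last c) = Some (hd c)"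

definition cyclic_points :: "('a \<rightharpoonup> 'a) \<Rightarrow> 'a set" where
  "cyclic_points g = {x. \<exists>c. fcycle g c \<and> x \<in> set c}"

lemma fpath_Nil [simp]: "fpath g []" and fpath_single [simp]: "fpath g [x]"
  by (simp_all add: fpath_def)

lemma fpath_Cons: "fpath g (x # xs) \<longleftrightarrow> xs = [] \<or> g x = Some (hd xs) \<and> fpath g xs"
  by (cases xs) (auto simp: fpath_def)

lemma fpath_append:
  "fpath g (xs @ ys) \<longleftrightarrow>
     fpath g xs \<and> fpath g ys \<and> (xs = [] \<or> ys = [] \<or> g (last xs) = Some (hd ys))"
  by (auto simp: fpath_def successively_append_iff)

lemma fpath_cong:
  assumes "\<And>x. x \<in> set (butlast xs) \<Longrightarrow> g x = g' x"
  shows "fpath g xs \<longleftrightarrow> fpath g' xs"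
  using assms by (induction xs) (auto simp: fpath_Cons)

lemma fpath_closed:
  assumes "fpath g xs" "hd xs \<in> C" "\<And>x y. x \<in> C \<Longrightarrow> g x = Some y \<Longrightarrow> y \<in> C"
  shows "set xs \<subseteq> C"
  using assms(1,2)
proof (induction xs)
  case (Cons x xs)
  then show ?case using assms(3) by (cases xs) (auto simp: fpath_Cons)
qed simp

lemma fpath_comparable:
  assumes "fpath g xs" "fpath g ys" "xs \<noteq> []" "ys \<noteq> []" "hd xs = hd ys"
  shows "(\<exists>zs. ys = xs @ zs) \<or> (\<exists>zs. xs = ys @ zs)"
  using assms
proof (induction xs arbitrary: ys)
  case (Cons x xs)
  then obtain ys' where ys: "ys = x # ys'" by (cases ys) auto
  show ?case
  proof (cases "xs = [] \<or> ys' = []")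
    case False
    then have "hd xs = hd ys'" "fpath g xs" "fpath g ys'"
      using Cons.prems ys by (auto simp: fpath_Cons)
    then show ?thesis using Cons.IH[of ys'] False ys by auto
  qed (use ys in auto)
qed simp

lemma fpath_eqI_last:
  assumes "fpath g xs" "fpath g ys" "distinct xs" "distinct ys" "xs \<noteq> []" "ys \<noteq> []"
    "hd xs = hd ys" "last xs = last ys"
  shows "xs = ys"
proof -
  have "us @ zs = us" if "distinct (us @ zs)" "last us = last (us @ zs)" "us \<noteq> []"
    for us zs :: "'a list"
    using that by (cases "zs = []") (auto dest!: last_in_set)
  then show ?thesis using fpath_comparable[OF assms(1,2,5,6,7)] assms by metis
qed

lemma full_path_unique:
  assumes "full_path g xs" "full_path g ys" "hd xs = hd ys"
  shows "xs = ys"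
proof -
  have "zs = []" if "full_path g us" "full_path g (us @ zs)" for us zs
    using that by (auto simp: full_path_def fpath_append)
  then show ?thesis using fpath_comparable[of g xs ys] assms by (metis append_Nil2 full_path_def)
qed

lemma full_path_suffix: "full_path g (xs @ ys) \<Longrightarrow> ys \<noteq> [] \<Longrightarrow> full_path g ys"
  by (auto simp: full_path_def fpath_append)

text \<open>A repeated vertex would begin two complete paths of different lengths, although a
  complete path is determined by its first vertex.\<close>

lemma full_path_distinct:
  assumes "full_path g xs" shows "distinct xs"
proof (rule ccontr)
  assume "\<not> distinct xs"
  then obtain A x B C where xs: "xs = A @ [x] @ B @ [x] @ C"
    using not_distinct_decomp by blast
  have "full_path g (x # B @ x # C)" using full_path_suffix[of g A] assms xs by simp
  moreover have "full_path g (x # C)" using full_path_suffix[of g "A @ x # B"] assms xs by simp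
  ultimately have "x # B @ x # C = x # C" using full_path_unique by fastforce
  then have "length (x # B @ x # C) = length (x # C)" by (rule arg_cong)
  then show False by simp
qed

lemma fcycle_closed:
  assumes "fcycle g c" "x \<in> set c" "g x = Some y"
  shows "y \<in> set c"
proof -
  obtain A B where c: "c = A @ x # B" using assms(2) split_list by fast
  show ?thesis using assms by (cases B) (auto simp: c fcycle_def fpath_append fpath_Cons hd_append split: if_splits)
qed

lemma fcycle_defined: "fcycle g c \<Longrightarrow> x \<in> set c \<Longrightarrow> g x \<noteq> None"
  by (induction c rule: rev_induct)
    (auto simp: fcycle_def fpath_append fpath_Cons dest!: split_list split: if_splits)

text \<open>A cycle is closed under \<open>g\<close>, and \<open>g\<close> is defined on all of it,
  so a path that meets a cycle never gets to a point where \<open>g\<close> is undefined.\<close>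

lemma full_path_no_cycle:
  assumes "full_path g xs" "fcycle g c"
  shows "set xs \<inter> set c = {}"
proof (rule ccontr)
  assume "\<not> ?thesis"
  then obtain x where x: "x \<in> set xs" "x \<in> set c" by auto
  then obtain A B where xs: "xs = A @ x # B" by (meson split_list)
  have fp: "full_path g (x # B)" using full_path_suffix[of g A] assms xs by simp
  have "set (x # B) \<subseteq> set c"
    using fp x fcycle_closed[OF assms(2)] by (intro fpath_closed[of g]) (auto simp: full_path_def)
  then have "last (x # B) \<in> set c" using last_in_set[of "x # B"] by blast
  then show False using fp fcycle_defined[OF assms(2)] unfolding full_path_def by blast
qed

text \<open>As a list, a cycle has a distinguished end; an insertion wants a prescribed vertex
  there.\<close>

lemma fcycle_rotate:
  assumes "fcycle g c" "x \<in> set c"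
  obtains d where "fcycle g d" "set d = set c" "last d = x"
proof -
  obtain A B where c: "c = A @ x # B" using assms(2) split_list by fast
  have "fcycle g (B @ A @ [x])"
    using assms(1) unfolding c fcycle_def
    by (cases "A = []"; cases "B = []") (auto simp: fpath_append fpath_Cons hd_append)
  then show thesis using that[of "B @ A @ [x]"] by (auto simp: c)
qed

lemma fcycle_rotate_hd:
  assumes "fcycle g c" "x \<in> set c"
  obtains d where "fcycle g d" "set d = set c" "hd d = x"
proof -
  obtain A B where c: "c = A @ x # B" using assms(2) split_list by fast
  have "fcycle g (x # B @ A)"
    using assms(1) unfolding c fcycle_def
    by (cases "A = []"; cases "B = []") (auto simp: fpath_append fpath_Cons hd_append)
  then show thesis using that[of "x # B @ A"] by (auto simp: c)
qed

lemma fcycle_set_eq: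
  assumes "fcycle g c" "fcycle g d" "set c \<inter> set d \<noteq> {}"
  shows "set c = set d"
proof -
  have "set d \<subseteq> set c" if cd: "fcycle g c" "fcycle g d" "x \<in> set c" "x \<in> set d" for c d x
  proof -
    obtain d' where "fcycle g d'" "set d' = set d" "hd d' = x"
      using fcycle_rotate_hd cd by metis
    then show ?thesis using fpath_closed[of g d' "set c"] fcycle_closed[OF cd(1)] cd(3)
      by (auto simp: fcycle_def)
  qed
  then show ?thesis using assms by blast
qed

lemma fcycle_unique:
  assumes "fcycle g c" "fcycle g d" "last c = last d"
  shows "c = d"
  using assms by (intro fpath_eqI_last[of g]) (auto simp: fcycle_def)

lemma fcycle_cong:
  assumes "\<And>x. x \<in> set c \<Longrightarrow> g x = g' x"
  shows "fcycle g c \<longleftrightarrow> fcycle g' c"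
  unfolding fcycle_def using fpath_cong[of c g g'] assms by (auto dest: in_set_butlastD)

text \<open>The stretch between two occurrences of a vertex closes up; if it contains a further
  repetition, it is shortened by induction.\<close>

lemma repetition_imp_fcycle:
  assumes "fpath g xs" "\<not> distinct xs"
  shows "\<exists>c. fcycle g c \<and> set c \<subseteq> set xs"
  using assms
proof (induction "length xs" arbitrary: xs rule: less_induct)
  case less
  obtain A x B C where xs: "xs = A @ [x] @ B @ [x] @ C"
    using not_distinct_decomp less.prems(2) by blast
  have fp: "fpath g (x # B)" "g (last (x # B)) = Some x"
    using less.prems(1) by (auto simp: xs fpath_append fpath_Cons hd_append)
  show ?case
  proof (cases "distinct (x # B)")
    case True
    then have "fcycle g (x # B)" using fp by (auto simp: fcycle_def)
    then show ?thesis using xs by (intro exI[of _ "x # B"]) auto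
  next
    case False
    then show ?thesis using less.hyps[of "x # B"] fp xs by fastforce
  qed
qed

text \<open>A path that can always be prolonged outgrows \<open>W\<close>, repeats a vertex and thus
  contains a cycle.\<close>

lemma full_path_exists:
  assumes "finite W" "x \<in> W" "\<And>y z. g y = Some z \<Longrightarrow> z \<in> W" "cyclic_points g = {}"
  shows "\<exists>xs. full_path g xs \<and> hd xs = x \<and> set xs \<subseteq> W"
proof (rule ccontr)
  assume neg: "\<not> ?thesis"
  have "\<exists>xs. fpath g xs \<and> hd xs = x \<and> set xs \<subseteq> W \<and> length xs = Suc k" for k
  proof (induction k)
    case 0
    show ?case using assms(2) by (intro exI[of _ "[x]"]) auto
  next
    case (Suc k)
    then obtain xs where xs: "fpath g xs" "hd xs = x" "set xs \<subseteq> W" "length xs = Suc k" by blast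
    then have "xs \<noteq> []" by auto
    then obtain y where "g (last xs) = Some y" using neg xs unfolding full_path_def by auto
    then show ?case using xs assms(3) \<open>xs \<noteq> []\<close>
      by (intro exI[of _ "xs @ [y]"]) (auto simp: fpath_append)
  qed
  then obtain xs where xs: "fpath g xs" "set xs \<subseteq> W" "length xs = Suc (card W)" by blast
  have "\<not> distinct xs"
    using xs card_mono[OF assms(1) xs(2)] distinct_card[of xs] by auto
  then obtain c where "fcycle g c" using repetition_imp_fcycle xs(1) by blast
  then have "hd c \<in> cyclic_points g" unfolding cyclic_points_def fcycle_def by auto
  then show False using assms(4) by auto
qed

section \<open>Insertion and extraction of a single cycle\<close>

lemma comp_transpose: "g \<circ> transpose e v = g(e := g v, v := g e)"
  by (auto simp: transpose_def fun_eq_iff)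

lemma last_notin_butlast: "distinct xs \<Longrightarrow> xs \<noteq> [] \<Longrightarrow> last xs \<notin> set (butlast xs)"
  by (induction xs rule: rev_induct) auto

text \<open>After the exchange of images, \<open>e\<close> leads to the head of \<open>c\<close> and
  the end of \<open>c\<close> to the former successor of \<open>e\<close>. If \<open>e\<close> was
  the end of the path, its undefined value moves to the end of \<open>c\<close> in the same
  way.\<close>

lemma fcycle_insert:
  assumes "full_path g (A @ e # B)" "fcycle g c" "g' = g \<circ> transpose e (last c)"
  shows "full_path g' (A @ e # c @ B)" and "cyclic_points g' = cyclic_points g - set c"
    and "set c \<inter> set (A @ e # B) = {}"
proof -
  define v where "v = last c"
  have g': "g' = g(e := g v, v := g e)" by (simp add: assms(3) comp_transpose v_def)
  show disj: "set c \<inter> set (A @ e # B) = {}" using full_path_no_cycle[OF assms(1,2)] by blast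
  have c: "c \<noteq> []" "distinct c" "fpath g c" "g v = Some (hd c)"
    using assms(2) by (auto simp: fcycle_def v_def)
  have vc: "v \<in> set c" "v \<notin> set (butlast c)"
    using c last_notin_butlast by (auto simp: v_def)
  have ds: "distinct (A @ e # B)" by (rule full_path_distinct[OF assms(1)])
  have v: "v \<noteq> e" "v \<notin> set A" "v \<notin> set B" using vc disj by auto
  have "e \<notin> set c" using disj by auto
  have eq: "g' x = g x" if "x \<noteq> e" "x \<noteq> v" for x using that by (simp add: g')
  have "fpath g' A" "fpath g' B" "fpath g' c"
  proof -
    have "fpath g A" "fpath g B" using assms(1) by (auto simp: full_path_def fpath_append fpath_Cons)
    moreover have "fpath g A = fpath g' A"
      using ds v by (intro fpath_cong) (auto simp: g' dest: in_set_butlastD)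
    moreover have "fpath g B = fpath g' B"
      using ds v by (intro fpath_cong) (auto simp: g' dest: in_set_butlastD)
    moreover have "fpath g c = fpath g' c"
      using \<open>e \<notin> set c\<close> vc(2) by (intro fpath_cong) (auto simp: g' dest: in_set_butlastD)
    ultimately show "fpath g' A" "fpath g' B" "fpath g' c" using c by auto
  qed
  moreover have "A = [] \<or> g' (last A) = Some e"
    using assms(1) ds v by (cases "A = []") (auto simp: full_path_def fpath_append g')
  moreover have "g' v = g e" "g' e = Some (hd c)" using v c by (auto simp: g')
  moreover have "B = [] \<or> g e = Some (hd B)" "B = [] \<longrightarrow> g e = None" "B \<noteq> [] \<longrightarrow> g (last B) = None"
    using assms(1) by (auto simp: full_path_def fpath_append fpath_Cons)
  moreover have "B \<noteq> [] \<Longrightarrow> g' (last B) = g (last B)"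
    using ds v by (auto simp: g')
  ultimately show fp: "full_path g' (A @ e # c @ B)"
    using c(1) v_def by (auto simp: full_path_def fpath_append fpath_Cons)
  show "cyclic_points g' = cyclic_points g - set c"
  proof (rule set_eqI)
    fix x
    show "x \<in> cyclic_points g' \<longleftrightarrow> x \<in> cyclic_points g - set c"
    proof
      assume "x \<in> cyclic_points g'"
      then obtain d where d: "fcycle g' d" "x \<in> set d" unfolding cyclic_points_def by auto
      \<comment> \<open>A cycle of \<open>g'\<close> avoids the new complete path, hence also
        \<open>e\<close> and \<open>last c\<close>, the only points where \<open>g\<close> and
        \<open>g'\<close> differ.\<close>
      have dd: "set (A @ e # c @ B) \<inter> set d = {}" by (rule full_path_no_cycle[OF fp d(1)])
      then have "fcycle g d" using d(1) fcycle_cong[of d g g'] eq vc by fastforce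
      then show "x \<in> cyclic_points g - set c" using d dd unfolding cyclic_points_def by auto
    next
      assume x: "x \<in> cyclic_points g - set c"
      then obtain d where d: "fcycle g d" "x \<in> set d" unfolding cyclic_points_def by auto
      have "set d \<inter> set c = {}" using fcycle_set_eq[OF d(1) assms(2)] x d by blast
      moreover have "e \<notin> set d" using full_path_no_cycle[OF assms(1) d(1)] by auto
      ultimately have "fcycle g' d" using d(1) fcycle_cong[of d g g'] eq vc by fastforce
      then show "x \<in> cyclic_points g'" using d unfolding cyclic_points_def by auto
    qed
  qed
qed

text \<open>The same transposition undoes the insertion: any nonempty stretch directly behind
  \<open>e\<close> is closed to a cycle.\<close>

lemma fcycle_extract:
  assumes "full_path g' (A @ e # c @ B)" "c \<noteq> []" "g = g' \<circ> transpose e (last c)"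
  shows "full_path g (A @ e # B)" and "fcycle g c"
proof -
  define v where "v = last c"
  have g: "g = g'(e := g' v, v := g' e)" by (simp add: assms(3) comp_transpose v_def)
  have ds: "distinct (A @ e # c @ B)" by (rule full_path_distinct[OF assms(1)])
  have vc: "v \<in> set c" "v \<notin> set (butlast c)"
    using assms(2) ds last_notin_butlast by (auto simp: v_def)
  have *: "fpath g' A" "fpath g' B" "fpath g' c" "A = [] \<or> g' (last A) = Some e"
    "g' e = Some (hd c)" "B = [] \<longrightarrow> g' v = None" "B \<noteq> [] \<longrightarrow> g' v = Some (hd B) \<and> g' (last B) = None"
    using assms(1,2) v_def by (auto simp: full_path_def fpath_append fpath_Cons)
  have "fpath g' A = fpath g A" "fpath g' B = fpath g B"
    using ds vc by (auto intro!: fpath_cong simp: g dest!: in_set_butlastD)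
  moreover have "fpath g' c = fpath g c"
    using ds vc by (intro fpath_cong) (auto simp: g dest: in_set_butlastD)
  ultimately have fps: "fpath g A" "fpath g B" "fpath g c" using * by auto
  have "A = [] \<or> g (last A) = Some e" using * ds vc by (cases "A = []") (auto simp: g)
  moreover have "v \<noteq> e" using ds vc by auto
  moreover have "g e = g' v" "g v = g' e" using \<open>v \<noteq> e\<close> by (auto simp: g)
  moreover have "B \<noteq> [] \<Longrightarrow> g (last B) = g' (last B)"
    using ds vc by (auto simp: g)
  ultimately show "full_path g (A @ e # B)" "fcycle g c"
    using * fps ds assms(2) v_def by (auto simp: full_path_def fcycle_def fpath_append fpath_Cons)
qed

section \<open>Level-preserving rearrangements and the cycle insertion\<close>

declare split_paired_All [simp del] split_paired_Ex [simp del]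

definition level_perm :: "vertex set \<Rightarrow> (vertex \<Rightarrow> vertex) \<Rightarrow> bool" where
  "level_perm W \<pi> \<longleftrightarrow> bij \<pi> \<and> (\<forall>x. fst (\<pi> x) = fst x) \<and> (\<forall>x. x \<notin> W \<longrightarrow> \<pi> x = x)"

text \<open>\<open>\<pi>\<close> moves vertices as sources and \<open>\<sigma>\<close> moves them as
  targets. The two may be independent because out-types and in-types are counted separately.\<close>

definition similar :: "vertex set \<Rightarrow> (vertex \<rightharpoonup> vertex) \<Rightarrow> (vertex \<rightharpoonup> vertex) \<Rightarrow> bool" where
  "similar W f p \<longleftrightarrow>
     (\<exists>\<sigma> \<pi>. level_perm W \<sigma> \<and> level_perm W \<pi> \<and> p = (\<lambda>x. map_option \<sigma> (f (\<pi> x))))"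

lemma level_perm_id [simp]: "level_perm W id" "level_perm W (\<lambda>x. x)"
  by (auto simp: level_perm_def id_def[symmetric])

lemma level_perm_comp: "level_perm W \<pi> \<Longrightarrow> level_perm W \<rho> \<Longrightarrow> level_perm W (\<pi> \<circ> \<rho>)"
  unfolding level_perm_def by (metis bij_comp comp_apply)

lemma level_perm_in: assumes "level_perm W \<pi>" shows "\<pi> x \<in> W \<longleftrightarrow> x \<in> W"
  using assms unfolding level_perm_def by (metis bij_pointE)

lemma level_perm_image:
  assumes "level_perm W \<pi>" shows "\<pi> ` {v \<in> W. Q (\<pi> v)} = {v \<in> W. Q v}"
proof
  show "\<pi> ` {v \<in> W. Q (\<pi> v)} \<subseteq> {v \<in> W. Q v}" using level_perm_in[OF assms] by auto
  show "{v \<in> W. Q v} \<subseteq> \<pi> ` {v \<in> W. Q (\<pi> v)}"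
  proof
    fix v assume v: "v \<in> {v \<in> W. Q v}"
    obtain u where "v = \<pi> u" using assms unfolding level_perm_def by (metis bij_pointE)
    then show "v \<in> \<pi> ` {v \<in> W. Q (\<pi> v)}" using v level_perm_in[OF assms, of u] by auto
  qed
qed

lemma level_perm_card:
  assumes "level_perm W \<pi>" shows "card {v \<in> W. Q (\<pi> v)} = card {v \<in> W. Q v}"
proof -
  have "inj \<pi>" using assms by (simp add: level_perm_def bij_is_inj)
  then show ?thesis using card_image[of \<pi> "{v \<in> W. Q (\<pi> v)}"] level_perm_image[OF assms]
    by (metis (no_types, lifting) inj_on_subset subset_UNIV)
qed

lemma level_perm_transpose:
  "a \<in> W \<Longrightarrow> b \<in> W \<Longrightarrow> fst a = fst b \<Longrightarrow> level_perm W (transpose a b)"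
  by (auto simp: level_perm_def transpose_def)

lemma similarI:
  "level_perm W \<sigma> \<Longrightarrow> level_perm W \<pi> \<Longrightarrow> similar W f (\<lambda>x. map_option \<sigma> (f (\<pi> x)))"
  unfolding similar_def by blast

lemma similar_refl [simp]: "similar W f f"
  unfolding similar_def by (rule exI[of _ id], rule exI[of _ id]) (simp add: option.map_id)

lemma similar_trans:
  assumes "similar W f g" "similar W g h" shows "similar W f h"
proof -
  obtain \<sigma> \<pi> \<sigma>' \<pi>' where *: "level_perm W \<sigma>" "level_perm W \<pi>" "level_perm W \<sigma>'" "level_perm W \<pi>'"
    "g = (\<lambda>x. map_option \<sigma> (f (\<pi> x)))" "h = (\<lambda>x. map_option \<sigma>' (g (\<pi>' x)))"
    using assms unfolding similar_def by blast
  have "h = (\<lambda>x. map_option (\<sigma>' \<circ> \<sigma>) (f ((\<pi> \<circ> \<pi>') x)))"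
    using * by (simp add: option.map_comp comp_def)
  then show ?thesis using similarI[of W "\<sigma>' \<circ> \<sigma>" "\<pi> \<circ> \<pi>'" f] * level_perm_comp by metis
qed

lemma similar_comp: "level_perm W \<pi> \<Longrightarrow> similar W f (f \<circ> \<pi>)"
  using similarI[of W id \<pi> f] by (simp add: option.map_id comp_def)

lemma similar_map: "level_perm W \<sigma> \<Longrightarrow> similar W f (map_option \<sigma> \<circ> f)"
  using similarI[of W \<sigma> id f] by (simp add: comp_def)

lemma similar_out_type:
  assumes "similar V f p"
  shows "card {v \<in> V. out_type p v = Some t} = card {v \<in> V. out_type f v = Some t}"
proof -
  obtain \<sigma> \<pi> where *: "level_perm V \<sigma>" "level_perm V \<pi>" "p = (\<lambda>x. map_option \<sigma> (f (\<pi> x)))"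
    using assms unfolding similar_def by blast
  have o: "out_type p v = out_type f (\<pi> v)" for v
    using * by (simp add: out_type_def level_perm_def option.map_comp comp_def)
  then show ?thesis using level_perm_card[OF *(2), of "\<lambda>v. out_type f v = Some t"] by simp
qed

text \<open>\<open>\<pi>\<close> carries the preimages of \<open>\<sigma> v\<close> under
  \<open>p\<close> onto those of \<open>v\<close> under \<open>f\<close>, so in-types are
  transported along \<open>\<sigma>\<close>.\<close>

lemma similar_in_type:
  assumes "similar V f p"
  shows "card {v \<in> V. in_type p v = t} = card {v \<in> V. in_type f v = t}"
proof -
  obtain \<sigma> \<pi> where *: "level_perm V \<sigma>" "level_perm V \<pi>" "p = (\<lambda>x. map_option \<sigma> (f (\<pi> x)))"
    using assms unfolding similar_def by blast
  have bij: "bij \<sigma>" "bij \<pi>" and lev: "\<And>x. fst (\<pi> x) = fst x" "\<And>x. fst (\<sigma> x) = fst x"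
    using * by (auto simp: level_perm_def)
  have "preimages_at p (\<sigma> v) k = preimages_at f v k" for v k
  proof -
    have "\<pi> ` {u. p u = Some (\<sigma> v) \<and> fst u = fst (\<sigma> v) + k} = {u. f u = Some v \<and> fst u = fst v + k}"
      (is "\<pi> ` ?A = ?B")
    proof
      show "\<pi> ` ?A \<subseteq> ?B" using bij(1) lev by (auto simp: *(3) bij_def inj_eq)
      show "?B \<subseteq> \<pi> ` ?A"
      proof
        fix u assume u: "u \<in> ?B"
        obtain w where w: "u = \<pi> w" using bij(2) by (metis bij_pointE)
        then have "w \<in> ?A" using u lev(1)[of w] lev(2)[of v] by (simp add: *(3))
        then show "u \<in> \<pi> ` ?A" using w by blast
      qed
    qed
    then show ?thesis unfolding preimages_at_def
      using bij(2) by (metis (no_types, lifting) bij_is_inj card_image inj_on_subset subset_UNIV)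
  qed
  then have o: "in_type p (\<sigma> v) = in_type f v" for v
    by (simp add: in_type_def lev)
  then show ?thesis using level_perm_card[OF *(1), of "\<lambda>v. in_type p v = t"] by simp
qed

text \<open>\<open>a\<close> and \<open>b\<close> extract the function from an object. In this way a
  stage may carry the segments of a path as additional data, or nothing, with
  \<open>id\<close>.\<close>

definition matched ::
  "vertex set \<Rightarrow> 'a set \<Rightarrow> ('a \<Rightarrow> vertex \<rightharpoonup> vertex) \<Rightarrow> 'b set \<Rightarrow> ('b \<Rightarrow> vertex \<rightharpoonup> vertex) \<Rightarrow> bool"
  where "matched W P a Q b \<longleftrightarrow>
    (\<exists>\<Phi>. bij_betw \<Phi> P Q \<and> (\<forall>x\<in>P. similar W (a x) (b (\<Phi> x))))"

lemma matched_trans: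
  assumes "matched W P a Q b" "matched W Q b T c" shows "matched W P a T c"
proof -
  obtain \<Phi> \<Psi> where *: "bij_betw \<Phi> P Q" "\<forall>x\<in>P. similar W (a x) (b (\<Phi> x))"
    "bij_betw \<Psi> Q T" "\<forall>x\<in>Q. similar W (b x) (c (\<Psi> x))"
    using assms unfolding matched_def by blast
  have "bij_betw (\<Psi> \<circ> \<Phi>) P T" using * by (metis bij_betw_trans)
  moreover have "\<forall>x\<in>P. similar W (a x) (c ((\<Psi> \<circ> \<Phi>) x))"
    using * similar_trans bij_betwE by (metis comp_apply)
  ultimately show ?thesis unfolding matched_def by blast
qed

lemma matched_Un:
  assumes "matched W P a Q b" "matched W P' a Q' b" "P \<inter> P' = {}" "Q \<inter> Q' = {}"
  shows "matched W (P \<union> P') a (Q \<union> Q') b"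
proof -
  obtain \<Phi> \<Psi> where *: "bij_betw \<Phi> P Q" "\<forall>x\<in>P. similar W (a x) (b (\<Phi> x))"
    "bij_betw \<Psi> P' Q'" "\<forall>x\<in>P'. similar W (a x) (b (\<Psi> x))"
    using assms unfolding matched_def by blast
  let ?h = "\<lambda>x. if x \<in> P then \<Phi> x else \<Psi> x"
  have "bij_betw ?h P Q"
    by (subst bij_betw_cong[of P ?h \<Phi>]) (use * in auto)
  moreover have "bij_betw ?h P' Q'"
    by (subst bij_betw_cong[of P' ?h \<Psi>]) (use * assms(3) in auto)
  ultimately have "bij_betw ?h (P \<union> P') (Q \<union> Q')" using bij_betw_combine assms(4) by blast
  moreover have "\<forall>x\<in>P \<union> P'. similar W (a x) (b (?h x))" using * by auto
  ultimately show ?thesis unfolding matched_def by blast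
qed

text \<open>Meant for stages where the image is not given by a convenient formula, but existence and
  uniqueness can be shown in both directions.\<close>

lemma matched_relI:
  assumes total: "\<And>x. x \<in> P \<Longrightarrow> \<exists>y\<in>Q. R x y"
    and surj: "\<And>y. y \<in> Q \<Longrightarrow> \<exists>x\<in>P. R x y"
    and func: "\<And>x y y'. x \<in> P \<Longrightarrow> y \<in> Q \<Longrightarrow> y' \<in> Q \<Longrightarrow> R x y \<Longrightarrow> R x y' \<Longrightarrow> y = y'"
    and inj: "\<And>x x' y. x \<in> P \<Longrightarrow> x' \<in> P \<Longrightarrow> y \<in> Q \<Longrightarrow> R x y \<Longrightarrow> R x' y \<Longrightarrow> x = x'"
    and sim: "\<And>x y. x \<in> P \<Longrightarrow> y \<in> Q \<Longrightarrow> R x y \<Longrightarrow> similar W (a x) (b y)"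
  shows "matched W P a Q b"
proof -
  obtain \<Phi> where \<Phi>: "\<And>x. x \<in> P \<Longrightarrow> \<Phi> x \<in> Q \<and> R x (\<Phi> x)" using total by metis
  have "bij_betw \<Phi> P Q"
  proof (rule bij_betwI')
    show "(\<Phi> x = \<Phi> y) = (x = y)" if "x \<in> P" "y \<in> P" for x y using that \<Phi> inj by metis
    show "\<Phi> x \<in> Q" if "x \<in> P" for x using that \<Phi> by blast
    show "\<exists>x\<in>P. y = \<Phi> x" if "y \<in> Q" for y using surj[OF that] \<Phi> func that by metis
  qed
  then show ?thesis unfolding matched_def using \<Phi> sim by blast
qed

lemma matchedI:
  assumes "\<And>x. x \<in> P \<Longrightarrow> F x \<in> Q" "\<And>y. y \<in> Q \<Longrightarrow> G y \<in> P"
    "\<And>x. x \<in> P \<Longrightarrow> G (F x) = x" "\<And>y. y \<in> Q \<Longrightarrow> F (G y) = y"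
    "\<And>x. x \<in> P \<Longrightarrow> similar W (a x) (b (F x))"
  shows "matched W P a Q b"
proof -
  have "bij_betw F P Q" by (rule bij_betw_byWitness[of _ G]) (use assms in auto)
  then show ?thesis unfolding matched_def using assms(5) by blast
qed

text \<open>Serves to forget additional data once it is determined by the function.\<close>

lemma matched_image: "inj_on a P \<Longrightarrow> matched W P a (a ` P) id"
  unfolding matched_def by (intro exI[of _ a]) (auto simp: bij_betw_def)

text \<open>Keeps the edges with both ends in \<open>D\<close>. A path that leaves \<open>D\<close>
  becomes complete at its last vertex before leaving, so the insertion can work on the part at
  positive abscissas alone.\<close>

definition restr :: "'a set \<Rightarrow> ('a \<rightharpoonup> 'a) \<Rightarrow> 'a \<rightharpoonup> 'a" where
  "restr D f x = (if x \<in> D \<and> f x \<in> Some ` D then f x else None)"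

lemma restr_Some: "restr D f x = Some y \<longleftrightarrow> x \<in> D \<and> y \<in> D \<and> f x = Some y"
  by (auto simp: restr_def)

lemma restr_transpose:
  "a \<in> D \<Longrightarrow> b \<in> D \<Longrightarrow> restr D (f \<circ> transpose a b) = restr D f \<circ> transpose a b"
  by (auto simp: restr_def transpose_def fun_eq_iff)

lemma fcycle_restr: "fcycle (restr D f) c \<Longrightarrow> set c \<subseteq> D"
  using fcycle_defined[of "restr D f" c] by (metis restr_def subsetI)

text \<open>The list \<open>ls\<close> gives the order in which a path meets the abscissas. The segment \<open>s i\<close> starts at
  \<open>(i, 1)\<close> and grows by the insertion of cycles; the connecting pieces \<open>q i\<close> stay fixed. In \<open>state\<close>,
  the set \<open>K\<close> consists of the vertices that have been processed.\<close>

definition spine :: "int list \<Rightarrow> (int \<Rightarrow> vertex list) \<Rightarrow> (int \<Rightarrow> vertex list) \<Rightarrow> vertex list" where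
  "spine ls s q = concat (map (\<lambda>i. s i @ q i) ls)"

definition state :: "vertex set \<Rightarrow> int list \<Rightarrow> vertex set \<Rightarrow> (vertex \<rightharpoonup> vertex) \<Rightarrow>
    (int \<Rightarrow> vertex list) \<Rightarrow> (int \<Rightarrow> vertex list) \<Rightarrow> bool" where
  "state D ls K f s q \<longleftrightarrow>
     full_path (restr D f) (spine ls s q) \<and> set (spine ls s q) \<subseteq> D \<and>
     (\<forall>i\<in>set ls. s i \<noteq> [] \<and> hd (s i) = (i, 1) \<and> (\<forall>x\<in>set (s i). i \<le> fst x) \<and>
        fst (last (s i)) = i \<and> last (s i) \<in> insert (i, 1) K) \<and>
     (\<forall>i. i \<notin> set ls \<longrightarrow> s i = []) \<and> K \<inter> cyclic_points (restr D f) = {}"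

text \<open>An insertion moves the vertices of a cycle onto the spine, so this union stays the same.
  It allows an invariant to promise that a vertex never gets onto the path.\<close>

definition core :: "vertex set \<Rightarrow> int list \<Rightarrow> (vertex \<rightharpoonup> vertex) \<Rightarrow>
    (int \<Rightarrow> vertex list) \<Rightarrow> (int \<Rightarrow> vertex list) \<Rightarrow> vertex set" where
  "core D ls f s q = cyclic_points (restr D f) \<union> set (spine ls s q)"

section \<open>Spines and a single insertion into them\<close>

lemma spine_append: "spine (ls @ ls') s q = spine ls s q @ spine ls' s q"
  by (simp add: spine_def)

lemma spine_Cons: "spine (i # ls) s q = s i @ q i @ spine ls s q"
  by (simp add: spine_def)

lemma spine_upd: "i \<notin> set ls \<Longrightarrow> spine ls (s(i := x)) q = spine ls s q"
  unfolding spine_def by (rule arg_cong[of _ _ concat]) auto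

lemma spine_split:
  assumes "i \<in> set ls" "distinct ls"
  obtains A B where "\<And>x. spine ls (s(i := x)) q = A @ x @ B" "spine ls s q = A @ s i @ B"
proof -
  obtain ls1 ls2 where ls: "ls = ls1 @ i # ls2" using assms(1) split_list by fast
  then have "i \<notin> set ls1" "i \<notin> set ls2" using assms(2) by auto
  then have "spine ls (s(i := x)) q = spine ls1 s q @ x @ q i @ spine ls2 s q" for x
    by (simp add: ls spine_append spine_Cons spine_upd)
  moreover have "spine ls s q = spine ls1 s q @ s i @ q i @ spine ls2 s q"
    by (simp add: ls spine_append spine_Cons)
  ultimately show thesis by (rule that)
qed

text \<open>The cut is recovered as the position behind the last entry satisfying
  \<open>P\<close>.\<close>

lemma append_split_unique:
  assumes "xs @ ys = xs' @ ys'" "xs \<noteq> []" "xs' \<noteq> []" "P (last xs)" "P (last xs')"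
    "\<And>y. y \<in> set ys \<Longrightarrow> \<not> P y" "\<And>y. y \<in> set ys' \<Longrightarrow> \<not> P y"
  shows "xs = xs' \<and> ys = ys'"
proof -
  consider us where "xs = xs' @ us" "us @ ys = ys'" | us where "xs @ us = xs'" "ys = us @ ys'"
    using assms(1) by (auto simp: append_eq_append_conv2)
  then show ?thesis
  proof cases
    case 1
    then have "us = []" using assms(4,7) last_in_set[of us] by (cases "us = []") auto
    then show ?thesis using 1 by simp
  next
    case 2
    then have "us = []" using assms(5,6) last_in_set[of us] by (cases "us = []") auto
    then show ?thesis using 2 by simp
  qed
qed

text \<open>By \<open>low\<close>, every vertex of \<open>D\<close> below \<open>i\<close> has been
  processed or is a base vertex on the spine, so it lies on no cycle. Hence \<open>v\<close> has the
  least abscissa on \<open>c\<close>, and the enlarged segment stays at or above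
  \<open>i\<close>.\<close>

lemma state_insert:
  assumes st: "state D ls K f s q" and ls: "distinct ls"
    and v: "i \<in> set ls" "fst v = i"
    and low: "\<And>x. x \<in> D \<Longrightarrow> fst x < i \<Longrightarrow> x \<in> K \<or> x = (fst x, 1) \<and> fst x \<in> set ls"
    and c: "fcycle (restr D f) c" "last c = v"
    and f': "f' = f \<circ> transpose (last (s i)) v" and s': "s' = s(i := s i @ c)"
  shows "state D ls (insert v K) f' s' q" "core D ls f' s' q = core D ls f s q"
    "set c \<inter> insert (i, 1) K = {}" "v \<in> D" "last (s i) \<in> D"
proof -
  define g where "g = restr D f"
  define e where "e = last (s i)"
  obtain A B where AB: "\<And>x. spine ls (s(i := x)) q = A @ x @ B" "spine ls s q = A @ s i @ B"
    using spine_split[OF v(1) ls] by metis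
  have si: "s i \<noteq> []" "hd (s i) = (i, 1)" "\<forall>x\<in>set (s i). i \<le> fst x" "fst e = i"
    using st v(1) unfolding state_def e_def by auto
  have sie: "s i = butlast (s i) @ [e]" using si(1) e_def by simp
  have sp: "spine ls s q = (A @ butlast (s i)) @ e # B" using AB(2) sie by (metis append.assoc append_Cons append_Nil)
  have sp': "spine ls s' q = (A @ butlast (s i)) @ e # c @ B"
    using AB(1)[of "s i @ c"] sie s' by (metis append.assoc append_Cons append_Nil)
  have fp: "full_path g ((A @ butlast (s i)) @ e # B)" using st sp unfolding state_def g_def by simp
  have c': "fcycle g c" using c g_def by simp
  have cD: "set c \<subseteq> D" using fcycle_restr c(1) by blast
  have c0: "c \<noteq> []" using c by (auto simp: fcycle_def)
  show vD: "v \<in> D" using cD c0 c(2) by auto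
  show eD: "last (s i) \<in> D" using st sp e_def unfolding state_def by auto
  have g': "restr D f' = g \<circ> transpose e (last c)"
    using restr_transpose[OF eD vD] by (simp add: f' g_def e_def c(2))
  note ins = fcycle_insert[OF fp c' g']
  have spD: "set (spine ls s q) \<subseteq> D" using st by (simp add: state_def)
  have cyc: "set c \<subseteq> cyclic_points g" using c' by (auto simp: cyclic_points_def)
  have base: "(j, 1) \<in> set (spine ls s q)" if "j \<in> set ls" for j
  proof -
    have "s j \<noteq> []" "hd (s j) = (j, 1)" using st that unfolding state_def by auto
    then have "(j, 1) \<in> set (s j)" by (metis hd_in_set)
    then show ?thesis using that by (auto simp: spine_def)
  qed
  have cdisj: "set c \<inter> set (spine ls s q) = {}" using ins(3) sp by simp
  have K: "K \<inter> cyclic_points g = {}" using st by (simp add: state_def g_def)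
  \<comment> \<open>The base vertex lies on the complete path, and processed vertices lie on no
    cycle.\<close>
  show cK: "set c \<inter> insert (i, 1) K = {}" using base[OF v(1)] cdisj K cyc by auto
  have clev: "i \<le> fst x" if "x \<in> set c" for x
    using low[of x] base[of "fst x"] that cD cdisj K cyc by fastforce
  have lastc: "last (s' i) = v" using c0 c(2) s' by simp
  show "state D ls (insert v K) f' s' q"
    unfolding state_def
  proof (intro conjI ballI allI impI)
    show "full_path (restr D f') (spine ls s' q)" using ins(1) sp' by simp
    show "set (spine ls s' q) \<subseteq> D" using spD cD by (auto simp: sp sp')
    fix j assume j: "j \<in> set ls"
    show "s' j \<noteq> []" using st j s' unfolding state_def by auto
    show "hd (s' j) = (j, 1)" using st j s' si unfolding state_def by auto
    show "fst (last (s' j)) = j" using st j s' v(2) lastc unfolding state_def by auto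
    show "last (s' j) \<in> insert (j, 1) (insert v K)" using st j s' lastc unfolding state_def by auto
    show "j \<le> fst x" if "x \<in> set (s' j)" for x
      using that st j s' si(3) clev[of x] unfolding state_def by (auto split: if_splits)
  next
    show "s' j = []" if "j \<notin> set ls" for j using that st s' v(1) unfolding state_def by auto
    show "insert v K \<inter> cyclic_points (restr D f') = {}"
      using ins(2) K c0 c(2) by auto
  qed
  show "core D ls f' s' q = core D ls f s q"
    using ins(2) cyc unfolding core_def by (auto simp: sp sp' g_def)
qed

lemma state_extract:
  assumes st: "state D ls (insert v K) f' s' q" and ls: "distinct ls"
    and v: "i \<in> set ls" "fst v = i" "v \<notin> K" "v \<noteq> (i, 1)" "last (s' i) = v"
    and high: "\<And>x. x \<in> K \<Longrightarrow> fst x \<le> i"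
  obtains f s c where "state D ls K f s q" "fcycle (restr D f) c" "last c = v"
    "f' = f \<circ> transpose (last (s i)) v" "s' = s(i := s i @ c)"
proof -
  define g' where "g' = restr D f'"
  define P where "P x \<longleftrightarrow> x \<in> insert (i, 1) K" for x
  have si: "s' i \<noteq> []" "hd (s' i) = (i, 1)" "\<forall>x\<in>set (s' i). i \<le> fst x"
    using st v(1) unfolding state_def by auto
  have "(i, 1) \<in> set (s' i)" using si by (metis hd_in_set)
  \<comment> \<open>The former end of the segment is its base vertex or was processed earlier, while
    an inserted cycle contains no such vertex; so the last such entry marks the cut.\<close>
  then obtain \<alpha> e c where \<alpha>: "s' i = \<alpha> @ e # c" "P e" "\<forall>x\<in>set c. \<not> P x"
    using split_list_last_prop[of "s' i" P] P_def by blast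
  have "\<not> P v" using v by (simp add: P_def)
  then have c0: "c \<noteq> []" using \<alpha> v(5) by auto
  have lc: "last c = v" using \<alpha> v(5) c0 by simp
  define s where "s = s'(i := \<alpha> @ [e])"
  define f where "f = f' \<circ> transpose e v"
  obtain A B where AB: "\<And>x. spine ls (s'(i := x)) q = A @ x @ B" "spine ls s' q = A @ s' i @ B"
    using spine_split[OF v(1) ls] by metis
  have sp': "spine ls s' q = (A @ \<alpha>) @ e # c @ B" using AB(2) \<alpha>(1) by simp
  have sp: "spine ls s q = (A @ \<alpha>) @ e # B" using AB(1) s_def by simp
  have fp: "full_path g' ((A @ \<alpha>) @ e # c @ B)" using st sp' unfolding state_def g'_def by simp
  have spD: "set (spine ls s' q) \<subseteq> D" using st by (simp add: state_def)
  have "v \<in> set c" using lc c0 by auto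
  then have eD: "e \<in> D" "v \<in> D" using spD sp' by auto
  have g: "restr D f = g' \<circ> transpose e (last c)"
    using restr_transpose[OF eD] by (simp add: f_def g'_def lc)
  note ext = fcycle_extract[OF fp c0 g]
  have "g' = restr D f \<circ> transpose e (last c)" by (simp add: g comp_assoc)
  note ins = fcycle_insert[OF ext this]
  have els: "e \<in> set (s' i)" using \<alpha>(1) by simp
  \<comment> \<open>The segment stays at or above \<open>i\<close>, and \<open>K\<close> does not
    reach above \<open>i\<close>. So \<open>e\<close> is exactly at \<open>i\<close>, and the
    transposition with \<open>v\<close> preserves levels.\<close>
  have elev: "fst e = i" using \<alpha>(2) high si(3) els unfolding P_def by fastforce
  have "state D ls K f s q"
    unfolding state_def
  proof (intro conjI ballI allI impI)
    show "full_path (restr D f) (spine ls s q)" using ext(1) sp by simp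
    show "set (spine ls s q) \<subseteq> D" using spD by (auto simp: sp sp')
    fix j assume j: "j \<in> set ls"
    show "s j \<noteq> []" using st j s_def unfolding state_def by auto
    show "hd (s j) = (j, 1)" using st j s_def si(2) \<alpha>(1) unfolding state_def by (auto simp: hd_append)
    show "fst (last (s j)) = j" using st j s_def elev unfolding state_def by auto
    show "last (s j) \<in> insert (j, 1) K"
    proof (cases "j = i")
      case True
      then show ?thesis using \<alpha>(2) by (simp add: s_def P_def)
    next
      case False
      then have "last (s' j) \<noteq> v" using st j v(2) unfolding state_def by auto
      then show ?thesis using st j False unfolding state_def s_def by auto
    qed
    show "j \<le> fst x" if "x \<in> set (s j)" for x
      using that st j s_def si(3) \<alpha>(1) unfolding state_def by (auto split: if_splits)
  next
    show "s j = []" if "j \<notin> set ls" for j using that st s_def v(1) unfolding state_def by auto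
    have "K \<inter> cyclic_points g' = {}" using st by (simp add: state_def g'_def)
    then show "K \<inter> cyclic_points (restr D f) = {}" using ins(2) \<alpha>(3) unfolding P_def by auto
  qed
  moreover have "f' = f \<circ> transpose (last (s i)) v" by (simp add: f_def s_def comp_assoc)
  moreover have "s' = s(i := s i @ c)" using \<alpha>(1) by (auto simp: s_def)
  ultimately show thesis using that ext(2) lc by blast
qed

text \<open>Isolates what a side condition must satisfy to survive one insertion, looking only at
  the transposition and the \<open>core\<close>; one insertion theorem then serves three different
  side conditions.\<close>

definition foata_invariant :: "vertex set \<Rightarrow> int list \<Rightarrow>
    ((vertex \<rightharpoonup> vertex) \<Rightarrow> (int \<Rightarrow> vertex list) \<Rightarrow> (int \<Rightarrow> vertex list) \<Rightarrow> bool) \<Rightarrow> bool" where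
  "foata_invariant D ls P \<longleftrightarrow> (\<forall>f s q f' s' i c e v.
     i \<in> set ls \<longrightarrow> s i \<noteq> [] \<longrightarrow> c \<noteq> [] \<longrightarrow> e = last (s i) \<longrightarrow> v = last c \<longrightarrow> fst e = i \<longrightarrow> fst v = i \<longrightarrow>
     e \<in> D \<longrightarrow> v \<in> D \<longrightarrow> f' = f \<circ> transpose e v \<longrightarrow> s' = s(i := s i @ c) \<longrightarrow>
     core D ls f' s' q = core D ls f s q \<longrightarrow> P f s q = P f' s' q)"

definition states :: "vertex set \<Rightarrow> int list \<Rightarrow>
    ((vertex \<rightharpoonup> vertex) \<Rightarrow> (int \<Rightarrow> vertex list) \<Rightarrow> (int \<Rightarrow> vertex list) \<Rightarrow> bool) \<Rightarrow> vertex set \<Rightarrow>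
    ((vertex \<rightharpoonup> vertex) \<times> (int \<Rightarrow> vertex list) \<times> (int \<Rightarrow> vertex list)) set" where
  "states D ls P K = {(f, s, q). state D ls K f s q \<and> P f s q}"

text \<open>A cycle was inserted at \<open>v\<close> if and only if the segment at the abscissa of \<open>v\<close> ends in \<open>v\<close>, and then
  the inserted cycle starts behind the last earlier processed vertex of that segment.\<close>

lemma foata_step:
  assumes ls: "distinct ls" and inv: "foata_invariant D ls P" and DW: "D \<subseteq> W"
    and v: "v \<in> D" "fst v \<in> set ls" "v \<notin> K" "v \<noteq> (fst v, 1)"
    and low: "\<And>x. x \<in> D \<Longrightarrow> fst x < fst v \<Longrightarrow> x \<in> K \<or> x = (fst x, 1) \<and> fst x \<in> set ls"
    and high: "\<And>x. x \<in> K \<Longrightarrow> fst x \<le> fst v"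
  shows "matched W (states D ls P K) fst (states D ls P (insert v K)) fst"
proof -
  define i where "i = fst v"
  define M where "M f s f' s' c \<longleftrightarrow> fcycle (restr D f) c \<and> last c = v \<and>
    f' = f \<circ> transpose (last (s i)) v \<and> s' = s(i := s i @ c)" for f and s :: "int \<Rightarrow> vertex list" and f' s' c
  define R where "R = (\<lambda>(f, s, q :: int \<Rightarrow> vertex list) (f', s', q'). q = q' \<and>
     (v \<notin> cyclic_points (restr D f) \<and> f' = f \<and> s' = s \<or> (\<exists>c. M f s f' s' c)))"
  have iv: "i \<in> set ls" "fst v = i" "v \<noteq> (i, 1)" using v i_def by auto
  have low': "\<And>x. x \<in> D \<Longrightarrow> fst x < i \<Longrightarrow> x \<in> K \<or> x = (fst x, 1) \<and> fst x \<in> set ls"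
    using low i_def by auto
  have high': "\<And>x. x \<in> K \<Longrightarrow> fst x \<le> i" using high i_def by auto
  have merged: "state D ls (insert v K) f' s' q" "P f' s' q = P f s q" "last (s' i) = v"
     "set c \<inter> insert (i, 1) K = {}" "similar W f f'" "v \<in> cyclic_points (restr D f)"
    if st: "state D ls K f s q" and M: "M f s f' s' c" for f s q f' s' c
  proof -
    note ins = state_insert[OF st ls iv(1,2) low', of c f' s']
    have M': "fcycle (restr D f) c" "last c = v" "f' = f \<circ> transpose (last (s i)) v"
      "s' = s(i := s i @ c)" using M by (auto simp: M_def)
    show "state D ls (insert v K) f' s' q" "set c \<inter> insert (i, 1) K = {}"
      using ins M' by auto
    have c0: "c \<noteq> []" using M' by (auto simp: fcycle_def)
    then show "last (s' i) = v" using M' by simp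
    show "v \<in> cyclic_points (restr D f)" using M' c0 by (auto simp: cyclic_points_def)
    have si: "s i \<noteq> []" "fst (last (s i)) = i" using st iv(1) unfolding state_def by auto
    have mem: "v \<in> D" "last (s i) \<in> D" using ins M' by auto
    show "similar W f f'"
      unfolding M'(3) using mem DW si iv by (intro similar_comp level_perm_transpose) auto
    have "core D ls f' s' q = core D ls f s q" using ins M' by auto
    then have "P f s q = P f' s' q"
      using inv[unfolded foata_invariant_def, rule_format, of i s c "last (s i)" v f' f s' q] iv si c0 M' mem
      by simp
    then show "P f' s' q = P f s q" by simp
  qed
  \<comment> \<open>Before the step the segment at \<open>i\<close> does not end in
    \<open>v\<close>, and after it \<open>v\<close> lies on no cycle. The end of that segment
    therefore tells whether an insertion took place.\<close>
  have last_ne: "last (s i) \<noteq> v" if "state D ls K f s q" for f s q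
    using that iv(1,3) v(3) unfolding state_def by auto
  have cyc_ne: "v \<notin> cyclic_points (restr D f)" if "state D ls (insert v K) f s q" for f s q
    using that unfolding state_def by auto
  have mono: "state D ls (insert v K) f s q" if "state D ls K f s q" "v \<notin> cyclic_points (restr D f)"
    for f s q
    using that unfolding state_def by auto
  have antimono: "state D ls K f s q" if "state D ls (insert v K) f s q" "last (s i) \<noteq> v" for f s q
  proof -
    have "last (s j) \<noteq> v" if "j \<in> set ls" for j
      using \<open>state D ls (insert v K) f s q\<close> that \<open>last (s i) \<noteq> v\<close> iv(2) unfolding state_def
      by (cases "j = i") auto
    then show ?thesis using that unfolding state_def by (auto simp del: One_nat_def)
  qed
  show ?thesis
  proof (rule matched_relI[where R = R])
    fix x assume "x \<in> states D ls P K"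
    then obtain f s q where x: "x = (f, s, q)" "state D ls K f s q" "P f s q"
      by (auto simp: states_def)
    show "\<exists>y\<in>states D ls P (insert v K). R x y"
    proof (cases "v \<in> cyclic_points (restr D f)")
      case False
      show ?thesis using x False mono[OF x(2) False]
        by (intro bexI[of _ x]) (simp_all add: states_def R_def)
    next
      case True
      then obtain d where d: "fcycle (restr D f) d" "v \<in> set d" by (auto simp: cyclic_points_def)
      obtain c where c: "fcycle (restr D f) c" "last c = v" using fcycle_rotate[OF d] by metis
      define f' s' where "f' = f \<circ> transpose (last (s i)) v" and "s' = s(i := s i @ c)"
      have M: "M f s f' s' c" using c by (simp add: M_def f'_def s'_def)
      show ?thesis using merged[OF x(2) M] x M
        by (intro bexI[of _ "(f', s', q)"]) (auto simp: states_def R_def)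
    qed
  next
    fix y assume "y \<in> states D ls P (insert v K)"
    then obtain f s q where y: "y = (f, s, q)" "state D ls (insert v K) f s q" "P f s q"
      by (auto simp: states_def)
    show "\<exists>x\<in>states D ls P K. R x y"
    proof (cases "last (s i) = v")
      case False
      show ?thesis using y antimono[OF y(2) False] cyc_ne[OF y(2)]
        by (intro bexI[of _ y]) (simp_all add: states_def R_def)
    next
      case True
      obtain f0 s0 c where 0: "state D ls K f0 s0 q" "M f0 s0 f s c"
        using state_extract[OF y(2) ls iv(1,2) v(3) iv(3) True high'] M_def by metis
      then show ?thesis using merged[OF 0] y
        by (intro bexI[of _ "(f0, s0, q)"]) (auto simp: states_def R_def)
    qed
  next
    fix x y y' assume A: "x \<in> states D ls P K" "R x y" "R x y'"
    obtain f s q where x: "x = (f, s, q)" "state D ls K f s q" using A by (auto simp: states_def)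
    obtain f1 s1 q1 f2 s2 q2 where y: "y = (f1, s1, q1)" "y' = (f2, s2, q2)" by (metis prod_cases3)
    have q: "q1 = q" "q2 = q" using A by (auto simp: x y R_def)
    show "y = y'"
    proof (cases "v \<in> cyclic_points (restr D f)")
      case True
      then obtain c d where cd: "M f s f1 s1 c" "M f s f2 s2 d"
        using A unfolding x y R_def by auto
      then have "c = d" using fcycle_unique unfolding M_def by metis
      then show ?thesis using cd q unfolding y M_def by simp
    next
      case False
      then have "\<not> M f s f1 s1 c" "\<not> M f s f2 s2 c" for c using merged(6)[OF x(2)] by blast+
      then show ?thesis using A q unfolding x y R_def by auto
    qed
  next
    fix x x' y assume A: "x \<in> states D ls P K" "x' \<in> states D ls P K" "R x y" "R x' y"
    obtain f1 s1 q1 f2 s2 q2 where x: "x = (f1, s1, q1)" "x' = (f2, s2, q2)"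
       "state D ls K f1 s1 q1" "state D ls K f2 s2 q2" using A by (auto simp: states_def)
    obtain f s q where y: "y = (f, s, q)" by (metis prod_cases3)
    have q: "q1 = q" "q2 = q" using A by (auto simp: x y R_def)
    show "x = x'"
    proof (cases "last (s i) = v")
      case True
      then obtain c d where cd: "M f1 s1 f s c" "M f2 s2 f s d"
        using A last_ne x unfolding x y R_def by blast
      have ne: "s1 i \<noteq> []" "s2 i \<noteq> []" "last (s1 i) \<in> insert (i, 1) K" "last (s2 i) \<in> insert (i, 1) K"
        using x(3,4) iv(1) unfolding state_def by auto
      have "s i = s1 i @ c" using cd(1) unfolding M_def by simp
      moreover have "s i = s2 i @ d" using cd(2) unfolding M_def by simp
      ultimately have eq: "s1 i = s2 i" "c = d"
        using append_split_unique[of "s1 i" c "s2 i" d "\<lambda>x. x \<in> insert (i, 1) K"] ne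
          merged(4)[OF x(3) cd(1)] merged(4)[OF x(4) cd(2)] by auto
      have "s1 = s(i := s1 i)" using cd(1) unfolding M_def by simp
      moreover have "s2 = s(i := s2 i)" using cd(2) unfolding M_def by simp
      moreover have "f1 = f \<circ> transpose (last (s1 i)) v"
        using cd(1) unfolding M_def by (simp add: comp_assoc)
      moreover have "f2 = f \<circ> transpose (last (s2 i)) v"
        using cd(2) unfolding M_def by (simp add: comp_assoc)
      ultimately show ?thesis using eq q x(1,2) by metis
    next
      case False
      then have "\<not> M f1 s1 f s c" "\<not> M f2 s2 f s c" for c using merged(3) x by blast+
      then show ?thesis using A q unfolding x y R_def by auto
    qed
  next
    fix x y assume A: "x \<in> states D ls P K" "R x y"
    obtain f s q where x: "x = (f, s, q)" "state D ls K f s q" using A by (auto simp: states_def)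
    then show "similar W (fst x) (fst y)" using A merged(5)[OF x(2)] unfolding R_def by (cases y) auto
  qed
qed

text \<open>The vertices other than base vertices are processed by increasing abscissa.
  \<open>low\<close> makes the abscissas in \<open>ls\<close> downward closed within
  \<open>D\<close>, so that everything below the current vertex has already been dealt with.\<close>

lemma foata:
  assumes ls: "distinct ls" and inv: "foata_invariant D ls P" and DW: "D \<subseteq> W" and fin: "finite D"
    and low: "\<And>x i. x \<in> D \<Longrightarrow> i \<in> set ls \<Longrightarrow> fst x < i \<Longrightarrow> fst x \<in> set ls"
  shows "matched W (states D ls P {}) fst
    (states D ls P {x \<in> D. fst x \<in> set ls \<and> x \<noteq> (fst x, 1)}) fst"
proof -
  define U where "U = {x \<in> D. fst x \<in> set ls \<and> x \<noteq> (fst x, 1)}"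
  have "finite U" using fin U_def by auto
  then obtain us where us: "set us = U" "distinct us" using finite_distinct_list by blast
  \<comment> \<open>Vertices of equal abscissa may come in any order, as long as it is fixed once
    for all functions.\<close>
  define ks where "ks = sort_key fst us"
  have ks: "set ks = U" "distinct ks" "sorted (map fst ks)" using us by (auto simp: ks_def)
  have "matched W (states D ls P {}) fst (states D ls P (set (take n ks))) fst" if "n \<le> length ks" for n
    using that
  proof (induction n)
    case 0
    then show ?case unfolding matched_def by (intro exI[of _ id]) auto
  next
    case (Suc n)
    define v where "v = ks ! n"
    have n: "n < length ks" using Suc by simp
    have tk: "set (take (Suc n) ks) = insert v (set (take n ks))"
      using n by (simp add: take_Suc_conv_app_nth v_def)
    have dec: "ks = take n ks @ v # drop (Suc n) ks" using n id_take_nth_drop v_def by blast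
    have vU: "v \<in> U" using ks(1) n v_def nth_mem by blast
    have "distinct (take n ks @ v # drop (Suc n) ks)" using ks(2) dec by simp
    then have vn: "v \<notin> set (take n ks)" by auto
    have "sorted (map fst (take n ks @ v # drop (Suc n) ks))" using ks(3) dec by simp
    then have so: "\<And>x. x \<in> set (take n ks) \<Longrightarrow> fst x \<le> fst v"
       "\<And>x. x \<in> set (drop (Suc n) ks) \<Longrightarrow> fst v \<le> fst x" by (auto simp: sorted_append)
    have "x \<in> set (take n ks) \<or> x = (fst x, 1) \<and> fst x \<in> set ls" if x: "x \<in> D" "fst x < fst v" for x
    proof -
      have xl: "fst x \<in> set ls" using low[of x "fst v"] x vU U_def by auto
      show ?thesis
      proof (cases "x = (fst x, 1)")
        case False
        then have "x \<in> set ks" using ks(1) xl x U_def by auto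
        then have "x \<in> set (take n ks) \<union> {v} \<union> set (drop (Suc n) ks)" using dec
          by (metis Un_insert_right insert_is_Un list.simps(15) set_append sup_assoc sup_bot_right)
        then show ?thesis using x(2) so(2)[of x] by auto
      qed (use xl in auto)
    qed
    then have "matched W (states D ls P (set (take n ks))) fst (states D ls P (insert v (set (take n ks)))) fst"
      using vU vn so(1) U_def by (intro foata_step[OF ls inv DW]) auto
    then show ?case using Suc matched_trans tk by fastforce
  qed
  from this[of "length ks"] show ?thesis using ks(1) by (simp add: U_def)
qed

section \<open>Rooted trees and their parent maps\<close>

definition rooted_map :: "'a set \<Rightarrow> 'a \<Rightarrow> ('a \<rightharpoonup> 'a) \<Rightarrow> bool" where
  "rooted_map V \<rho> p \<longleftrightarrow>
     finite V \<and> \<rho> \<in> V \<and> dom p = V - {\<rho>} \<and> ran p \<subseteq> V \<and> cyclic_points p = {}"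

definition map_tree :: "'a set \<Rightarrow> 'a \<Rightarrow> ('a \<rightharpoonup> 'a) \<Rightarrow> 'a rooted" where
  "map_tree V \<rho> p = (\<lparr>pverts = V, parcs = {(x, y). p x = Some y \<or> p y = Some x}\<rparr>, \<rho>)"

lemma rooted_map_path:
  assumes "rooted_map V \<rho> p" "x \<in> V"
  obtains xs where "full_path p xs" "hd xs = x" "set xs \<subseteq> V" "last xs = \<rho>"
proof -
  have fin: "finite V" and ran: "\<And>y z. p y = Some z \<Longrightarrow> z \<in> V" and cyc: "cyclic_points p = {}"
    using assms(1) by (auto simp: rooted_map_def ran_def)
  obtain xs where xs: "full_path p xs" "hd xs = x" "set xs \<subseteq> V"
    using full_path_exists[of V x p] fin assms(2) ran cyc by metis
  have "last xs \<in> V" "p (last xs) = None" using xs by (auto simp: full_path_def)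
  then have "last xs = \<rho>" using assms(1) unfolding rooted_map_def
    by (metis Diff_iff domIff empty_iff insert_iff)
  then show thesis using that xs by blast
qed

abbreviation linked :: "('a \<rightharpoonup> 'a) \<Rightarrow> 'a list \<Rightarrow> bool" where
  "linked p \<equiv> successively (\<lambda>x y. p x = Some y \<or> p y = Some x)"

lemma linked_rev: "linked p (rev xs) = linked p xs"
  by (auto simp: successively_rev disj_commute)

lemma fpath_imp_linked: "fpath p xs \<Longrightarrow> linked p xs"
  by (induction xs) (auto simp: fpath_Cons successively_Cons)

text \<open>A simple walk that has gone from parent to child cannot turn upwards: the only upward
  edge of the child leads back to where it came from.\<close>

lemma linked_descending:
  assumes "linked p (x # y # xs)" "distinct (x # y # xs)" "p y = Some x"
  shows "fpath p (rev (x # y # xs))"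
  using assms
proof (induction xs arbitrary: x y)
  case (Cons z xs)
  have "p z = Some y" using Cons.prems by auto
  then have "fpath p (rev (y # z # xs))" using Cons by auto
  then show ?case using Cons.prems(3) by (auto simp: fpath_append fpath_Cons)
qed (auto simp: fpath_Cons)

text \<open>A walk that starts downwards keeps descending, so read backwards it is the parent path
  from its end to its start. An end that is an ancestor of the start would then also be its
  descendant.\<close>

lemma linked_to_ancestor:
  assumes "linked p xs" "distinct xs" "xs \<noteq> []" "full_path p zs" "hd zs = hd xs" "last xs \<in> set zs"
  shows "fpath p xs"
  using assms
proof (induction xs arbitrary: zs)
  case (Cons x xs)
  show ?case
  proof (cases xs)
    case (Cons y ys)
    have zs: "zs \<noteq> []" "hd zs = x" using Cons.prems by (auto simp: full_path_def)
    have "last xs \<in> set xs" using Cons by simp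
    then have lx: "last xs \<in> set zs" "last xs \<noteq> x" using Cons.prems Cons by auto
    then obtain zs' where zs': "zs = x # zs'" using zs by (cases zs) auto
    have "zs' \<noteq> []" using lx zs' by auto
    note zs' = zs' this
    have pz: "p x = Some (hd zs')" "full_path p zs'"
      using Cons.prems(4) zs' by (auto simp: full_path_def fpath_Cons)
    show ?thesis
    proof (cases "p x = Some y")
      case True
      then have "hd zs' = y" using pz by simp
      then have "fpath p xs" using Cons.IH[of zs'] Cons.prems Cons pz lx zs' by auto
      then show ?thesis using True Cons by (simp add: fpath_Cons)
    next
      case False
      then have "p y = Some x" using Cons.prems(1) Cons by auto
      then have fr: "fpath p (rev (x # xs))" using linked_descending[of p x y ys] Cons.prems Cons by simp
      obtain A B where AB: "zs = A @ last xs # B" using lx by (meson split_list)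
      then have A: "A \<noteq> []" using zs lx(2) by auto
      have fB: "full_path p (last xs # B)" using full_path_suffix[of p A] AB Cons.prems(4) by simp
      have "hd (rev (x # xs)) = last xs" using Cons by (simp add: hd_rev)
      \<comment> \<open>Both lists follow \<open>p\<close> from \<open>last xs\<close>, so one is a
        prefix of the other. The complete one cannot be prolonged, hence it contains
        \<open>x\<close>.\<close>
      then have "(\<exists>us. rev (x # xs) = (last xs # B) @ us) \<or> (\<exists>us. last xs # B = rev (x # xs) @ us)"
        using fpath_comparable[of p "last xs # B" "rev (x # xs)"] fr fB unfolding full_path_def by auto
      then have "x \<in> set (last xs # B)"
      proof
        assume "\<exists>us. last xs # B = rev (x # xs) @ us"
        then obtain us where us: "last xs # B = rev (x # xs) @ us" by blast
        show ?thesis unfolding us by simp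
      next
        assume "\<exists>us. rev (x # xs) = (last xs # B) @ us"
        then obtain us where us: "rev (x # xs) = (last xs # B) @ us" by blast
        show ?thesis
        proof (cases "us = []")
          case True
          then have "x \<in> set ((last xs # B) @ us)" using us[symmetric] by simp
          then show ?thesis using True by simp
        next
          case False
          then have "p (last (last xs # B)) = Some (hd us)"
            using fr fpath_append[of p "last xs # B" us] unfolding us by blast
          then show ?thesis using fB by (simp add: full_path_def)
        qed
      qed
      moreover have "distinct zs" by (rule full_path_distinct[OF Cons.prems(4)])
      moreover have "x \<in> set A" using A zs AB by (metis hd_append2 hd_in_set)
      ultimately show ?thesis using AB by auto
    qed
  qed simp
qed simp

section \<open>Paths, cycles and connectivity of graphs in terms of vertex lists\<close>

lemma vwalk_arcs_iff_successively:
  "set (vwalk_arcs xs) \<subseteq> E \<longleftrightarrow> successively (\<lambda>x y. (x, y) \<in> E) xs"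
  by (induction xs rule: vwalk_arcs.induct) auto

lemma vpath_map_tree_iff:
  "vpath xs (with_proj (fst (map_tree V \<rho> p))) \<longleftrightarrow>
     set xs \<subseteq> V \<and> linked p xs \<and> xs \<noteq> [] \<and> distinct xs"
  unfolding vpath_def vwalk_def by (auto simp: map_tree_def vwalk_arcs_iff_successively)

text \<open>The end of \<open>xs\<close> is an ancestor of its start, so every simple path with
  these ends follows \<open>p\<close> and is equal to \<open>xs\<close>.\<close>

lemma tree_path_map_tree:
  assumes "full_path p (xs @ ys)" "xs \<noteq> []" "set xs \<subseteq> V"
  shows "tree_path (fst (map_tree V \<rho> p)) (hd xs) (last xs) = xs"
  unfolding tree_path_def
proof (rule the_equality)
  have ds: "distinct xs" and fp: "fpath p xs"
    using full_path_distinct[OF assms(1)] assms(1) by (auto simp: full_path_def fpath_append)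
  show "vpath xs (with_proj (fst (map_tree V \<rho> p))) \<and> hd xs = hd xs \<and> last xs = last xs"
    using assms ds fpath_imp_linked[OF fp] by (simp add: vpath_map_tree_iff)
  fix zs assume "vpath zs (with_proj (fst (map_tree V \<rho> p))) \<and> hd zs = hd xs \<and> last zs = last xs"
  then have zs: "linked p zs" "zs \<noteq> []" "distinct zs" "hd zs = hd xs" "last zs = last xs"
    by (auto simp: vpath_map_tree_iff)
  then have "fpath p zs"
    using linked_to_ancestor[OF zs(1,3,2) assms(1)] assms(2) by simp
  then show "zs = xs" using fpath_eqI_last zs fp ds assms(2) by blast
qed

lemma root_path_map_tree:
  assumes "full_path p xs" "set xs \<subseteq> V" "last xs = \<rho>"
  shows "root_path (map_tree V \<rho> p) (hd xs) = xs"
  using tree_path_map_tree[of p xs "[]" V \<rho>] assms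
  by (simp add: root_path_def full_path_def map_tree_def)

lemma parent_map_tree:
  assumes "rooted_map V \<rho> p"
  shows "parent (map_tree V \<rho> p) = p"
proof
  fix v
  show "parent (map_tree V \<rho> p) v = p v"
  proof (cases "v \<in> V \<and> v \<noteq> \<rho>")
    case True
    then obtain xs where xs: "full_path p xs" "hd xs = v" "set xs \<subseteq> V" "last xs = \<rho>"
      using rooted_map_path[OF assms] by blast
    then obtain x y ys where "xs = x # y # ys" using True
      by (cases xs rule: vwalk_arcs.cases) (auto simp: full_path_def)
    moreover have "root_path (map_tree V \<rho> p) v = xs"
      using root_path_map_tree xs by metis
    ultimately show ?thesis using xs True by (auto simp: parent_def map_tree_def full_path_def fpath_Cons)
  next
    case False
    then have "p v = None" using assms unfolding rooted_map_def by (metis Diff_iff domIff insertCI)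
    then show ?thesis using False by (auto simp: parent_def map_tree_def)
  qed
qed

lemma pcas_vwalk_arcs: "pcas u (vwalk_arcs (u # ws)) (last (u # ws))"
  by (induction ws arbitrary: u) auto

lemma pawalk_verts_vwalk_arcs: "pawalk_verts u (vwalk_arcs (u # ws)) = u # ws"
  by (induction ws arbitrary: u) auto

lemma length_vwalk_arcs: "length (vwalk_arcs (u # ws)) = length ws"
  by (induction ws arbitrary: u) auto

lemma pawalk_vwalk_arcs: "pcas u c v \<Longrightarrow> vwalk_arcs (pawalk_verts u c) = c \<and> last (pawalk_verts u c) = v"
proof (induction c arbitrary: u)
  case (Cons e c)
  then show ?case by (cases c) auto
qed simp

lemma hd_pawalk_verts: "pcas u c v \<Longrightarrow> hd (pawalk_verts u c) = u"
  by (cases c) auto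

lemma cycle_with_proj_iff:
  "pre_digraph.cycle (with_proj G) c \<and> length c \<ge> 3 \<longleftrightarrow>
     (\<exists>u ws. c = vwalk_arcs (u # ws) \<and> u \<in> pverts G \<and> length ws \<ge> 3 \<and> distinct ws \<and> last ws = u \<and>
        successively (\<lambda>x y. (x, y) \<in> parcs G) (u # ws))" (is "?L = ?R")
proof
  assume ?L
  then obtain u where u: "u \<in> pverts G" "set c \<subseteq> parcs G" "pcas u c u" "length c \<ge> 3"
    "distinct (tl (pawalk_verts u c))"
    by (auto simp: pre_digraph.cycle_def pre_digraph.awalk_def cas_with_proj_eq awalk_verts_with_proj_eq)
  have pv: "pawalk_verts u c = u # tl (pawalk_verts u c)"
    using hd_pawalk_verts[OF u(3)] by (cases c) auto
  define ws where "ws = tl (pawalk_verts u c)"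
  have c: "c = vwalk_arcs (u # ws)" "last (u # ws) = u"
    using pawalk_vwalk_arcs[OF u(3)] pv ws_def by auto
  then have len: "length ws \<ge> 3" using u(4) length_vwalk_arcs[of u ws] by simp
  then have "ws \<noteq> []" by auto
  then have "last ws = u" using c(2) by simp
  moreover have "successively (\<lambda>x y. (x, y) \<in> parcs G) (u # ws)"
    using u(2) c(1) vwalk_arcs_iff_successively[of "u # ws" "parcs G"] by simp
  moreover have "distinct ws" using u(5) by (simp only: ws_def)
  ultimately show ?R using c(1) u(1) len by blast
next
  assume ?R
  then obtain u ws where u: "c = vwalk_arcs (u # ws)" "u \<in> pverts G" "length ws \<ge> 3" "distinct ws"
    "last ws = u" "successively (\<lambda>x y. (x, y) \<in> parcs G) (u # ws)" by blast
  have "ws \<noteq> []" using u(3) by auto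
  then have "last (u # ws) = u" using u(5) by simp
  then have "pcas u c u" using pcas_vwalk_arcs[of u ws] u(1) by simp
  moreover have "set c \<subseteq> parcs G" using u(1,6) vwalk_arcs_iff_successively[of "u # ws" "parcs G"] by simp
  moreover have "pawalk_verts u c = u # ws" using u(1) pawalk_verts_vwalk_arcs[of u ws] by simp
  moreover have "length c \<ge> 3" using u length_vwalk_arcs[of u ws] by simp
  ultimately show ?L using u
    by (auto simp: pre_digraph.cycle_def pre_digraph.awalk_def cas_with_proj_eq awalk_verts_with_proj_eq
       intro!: exI[of _ u])
qed

lemma successively_imp_rtrancl_on:
  assumes "successively (\<lambda>x y. (x, y) \<in> E) xs" "xs \<noteq> []" "set xs \<subseteq> F"
  shows "(hd xs, last xs) \<in> rtrancl_on F E"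
  using assms
proof (induction xs)
  case (Cons x xs)
  show ?case
  proof (cases xs)
    case Nil
    then show ?thesis using Cons.prems by auto
  next
    case (Cons y ys)
    then have "(hd xs, last xs) \<in> rtrancl_on F E" using Cons.prems Cons.IH by auto
    then show ?thesis using Cons Cons.prems by (auto intro: converse_rtrancl_on_into_rtrancl_on)
  qed
qed simp

lemma rtrancl_on_imp_successively:
  assumes "(a, b) \<in> rtrancl_on F E"
  shows "\<exists>xs. successively (\<lambda>x y. (x, y) \<in> E) xs \<and> xs \<noteq> [] \<and> set xs \<subseteq> F \<and> hd xs = a \<and> last xs = b"
  using assms
proof (induction rule: rtrancl_on.induct)
  case (rtrancl_on_refl a)
  then show ?case by (intro exI[of _ "[a]"]) auto
next
  case (rtrancl_on_into_rtrancl_on a b c)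
  then obtain xs where "successively (\<lambda>x y. (x, y) \<in> E) xs" "xs \<noteq> []" "set xs \<subseteq> F" "hd xs = a" "last xs = b"
    by blast
  then show ?case using rtrancl_on_into_rtrancl_on
    by (intro exI[of _ "xs @ [c]"]) (auto simp: successively_append_iff)
qed

lemma connected_with_proj_iff:
  assumes "pair_graph G"
  shows "Digraph_Component.connected (with_proj G) \<longleftrightarrow> pverts G \<noteq> {} \<and> (\<forall>u\<in>pverts G. \<forall>v\<in>pverts G.
    \<exists>xs. successively (\<lambda>x y. (x, y) \<in> parcs G) xs \<and> xs \<noteq> [] \<and> set xs \<subseteq> pverts G \<and> hd xs = u \<and> last xs = v)"
proof -
  interpret pair_graph G by fact
  \<comment> \<open>The arcs are symmetric already, so the symmetric closure in the definition of
    connectedness changes nothing.\<close>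
  have eq: "parcs (mk_symmetric (with_proj G)) = parcs G"
    using adj_mk_symmetric_eq[OF pair_sym_arcs] by simp
  have "reachable (with_proj (mk_symmetric (with_proj G))) u v \<longleftrightarrow>
    (\<exists>xs. successively (\<lambda>x y. (x, y) \<in> parcs G) xs \<and> xs \<noteq> [] \<and> set xs \<subseteq> pverts G \<and> hd xs = u \<and> last xs = v)"
    for u v
  proof -
    have "reachable (with_proj (mk_symmetric (with_proj G))) u v \<longleftrightarrow> (u, v) \<in> rtrancl_on (pverts G) (parcs G)"
      by (simp add: reachable_def eq)
    then show ?thesis
      using successively_imp_rtrancl_on[of "parcs G" _ "pverts G"]
        rtrancl_on_imp_successively[of u v "pverts G" "parcs G"] by auto
  qed
  then show ?thesis
    unfolding Digraph_Component.connected_def strongly_connected_def by simp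
qed

text \<open>Any two vertices are connected through the root. A cycle of length at least 3 without
  one of its edges is a simple path of at least three vertices between adjacent ones; read in a
  suitable direction, such a path follows \<open>p\<close> and thus consists of the edge
  alone.\<close>

lemma rooted_tree_map_tree:
  assumes "rooted_map V \<rho> p"
  shows "rooted_tree V (map_tree V \<rho> p)"
proof -
  define G where "G = fst (map_tree V \<rho> p)"
  have G: "pverts G = V" "parcs G = {(x, y). p x = Some y \<or> p y = Some x}"
    by (auto simp: G_def map_tree_def)
  have pV: "x \<in> V \<and> y \<in> V \<and> x \<noteq> y" if "p x = Some y" for x y
  proof -
    have "x \<in> V" "y \<in> V" using that assms by (auto simp: rooted_map_def ran_def)
    moreover have "x \<noteq> y"
    proof
      assume "x = y"
      then have "fcycle p [x]" using that by (simp add: fcycle_def)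
      then show False using assms unfolding rooted_map_def cyclic_points_def by fastforce
    qed
    ultimately show ?thesis by blast
  qed
  have sub: "parcs G \<subseteq> V \<times> V" using pV by (auto simp: G)
  have fin: "finite V" using assms by (simp add: rooted_map_def)
  have gr: "pair_graph G"
  proof
    show "finite (pverts G)" using fin G by simp
    show "finite (parcs G)" using sub fin by (meson finite_SigmaI finite_subset)
    show "symmetric (with_proj G)" by (auto simp: symmetric_def G sym_def)
    show "fst e \<noteq> snd e" if "e \<in> parcs G" for e
      using that pV[of "fst e" "snd e"] pV[of "snd e" "fst e"] by (auto simp: G split_beta)
  qed (use sub G in auto)
  have "Digraph_Component.connected (with_proj G)"
    unfolding connected_with_proj_iff[OF gr]
  proof (intro conjI ballI)
    show "pverts G \<noteq> {}" using assms by (auto simp: G rooted_map_def)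
    fix u v assume uv: "u \<in> pverts G" "v \<in> pverts G"
    obtain xs where xs: "full_path p xs" "hd xs = u" "set xs \<subseteq> V" "last xs = \<rho>"
      using rooted_map_path[OF assms] uv G by metis
    obtain ys where ys: "full_path p ys" "hd ys = v" "set ys \<subseteq> V" "last ys = \<rho>"
      using rooted_map_path[OF assms] uv G by metis
    have ne: "xs \<noteq> []" "ys \<noteq> []" using xs ys by (auto simp: full_path_def)
    obtain ys' where ys': "rev ys = \<rho> # ys'" using ys(4) ne
      by (metis hd_rev list.collapse rev_is_Nil_conv)
    have "linked p xs" "linked p (rev ys)"
      using xs ys fpath_imp_linked unfolding linked_rev full_path_def by blast+
    then have "linked p (xs @ ys')"
      using ys' xs(4) ne by (auto simp: successively_append_iff successively_Cons)
    moreover have "last (xs @ ys') = v"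
    proof -
      have "last (rev ys) = v" using ys(2) ne by (simp add: last_rev)
      then show ?thesis using ys' xs(4) by (cases "ys' = []") auto
    qed
    moreover have "set ys' \<subseteq> V" using ys' ys(3) by (metis list.set_intros(2) set_rev subset_iff)
    ultimately show "\<exists>xs. successively (\<lambda>x y. (x, y) \<in> parcs G) xs \<and> xs \<noteq> [] \<and> set xs \<subseteq> pverts G \<and> hd xs = u \<and> last xs = v"
      using xs ne by (intro exI[of _ "xs @ ys'"]) (auto simp: G)
  qed
  moreover have False if cyc: "pre_digraph.cycle (with_proj G) c" "length c \<ge> 3" for c
  proof -
    obtain u ws where u: "u \<in> V" "length ws \<ge> 3" "distinct ws" "last ws = u" "linked p (u # ws)"
      using iffD1[OF cycle_with_proj_iff conjI[OF cyc]] unfolding G by auto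
    have ne: "ws \<noteq> []" using u by auto
    have l: "linked p ws" "p u = Some (hd ws) \<or> p (hd ws) = Some u"
      using u(5) ne by (auto simp: successively_Cons)
    have short: "vs = [hd vs, last vs]" if vs: "linked p vs" "distinct vs" "vs \<noteq> []" "p (hd vs) = Some (last vs)" for vs
    proof -
      have "hd vs \<in> V" using pV vs by blast
      then obtain zs where zs: "full_path p zs" "hd zs = hd vs" using rooted_map_path[OF assms] by metis
      obtain z zs' where z: "zs = z # zs'" using zs by (cases zs) (auto simp: full_path_def)
      then have "zs' \<noteq> []" "hd zs' = last vs" using zs vs(4) by (auto simp: full_path_def fpath_Cons)
      then have "last vs \<in> set zs" using z by (metis hd_in_set list.set_intros(2))
      then have "fpath p vs" using linked_to_ancestor[OF vs(1,2,3) zs] by blast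
      moreover have "fpath p [hd vs, last vs]" using vs by (simp add: fpath_Cons)
      moreover have "hd vs \<noteq> last vs" using pV vs by blast
      ultimately show ?thesis using vs by (intro fpath_eqI_last[of p]) auto
    qed
    from l(2) show False
    proof
      assume "p (hd ws) = Some u"
      then have "ws = [hd ws, last ws]" using short[of ws] u l ne by simp
      then have "length ws = length [hd ws, last ws]" by (rule arg_cong)
      then show False using u(2) by simp
    next
      assume "p u = Some (hd ws)"
      then have "rev ws = [last ws, hd ws]"
        using short[of "rev ws"] u l ne linked_rev[of p ws]
        by (simp add: hd_rev last_rev del: successively_rev)
      then have "length (rev ws) = length [hd ws, last ws]" by simp
      then show False using u(2) by simp
    qed
  qed
  ultimately have "tree_graph G" using gr by (auto simp: tree_graph_def)
  then show ?thesis using assms by (simp add: rooted_tree_def G_def rooted_map_def map_tree_def)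
qed

text \<open>The parent of a vertex is a neighbour nearer to the root. An arc not of this kind would
  close a cycle with the paths from its ends up to their first common vertex.\<close>

lemma rooted_tree_obtain_map:
  assumes "rooted_tree V T"
  obtains p where "rooted_map V (snd T) p" "T = map_tree V (snd T) p"
proof -
  define G \<rho> where "G = fst T" and "\<rho> = snd T"
  have gr: "pair_graph G" and G: "pverts G = V" "\<rho> \<in> V" and con: "Digraph_Component.connected (with_proj G)"
    and nocyc: "\<And>c. \<not> (pre_digraph.cycle (with_proj G) c \<and> length c \<ge> 3)"
    using assms by (auto simp: rooted_tree_def tree_graph_def G_def \<rho>_def)
  interpret pair_graph G by fact
  define walk where "walk x xs \<longleftrightarrow> successively (\<lambda>x y. (x, y) \<in> parcs G) xs \<and> xs \<noteq> [] \<and>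
      set xs \<subseteq> V \<and> hd xs = x \<and> last xs = \<rho>" for x xs
  define d where "d x = (LEAST n. \<exists>xs. walk x xs \<and> length xs = n)" for x
  have sym: "(y, x) \<in> parcs G" if "(x, y) \<in> parcs G" for x y
    using that pair_sym_arcs by (auto simp: symmetric_def sym_def)
  have ex: "\<exists>xs. walk x xs" if "x \<in> V" for x
    using con that G unfolding connected_with_proj_iff[OF gr] walk_def by blast
  have nbr: "\<exists>y. (x, y) \<in> parcs G \<and> d y < d x" if x: "x \<in> V" "x \<noteq> \<rho>" for x
  proof -
    have "\<exists>n xs. walk x xs \<and> length xs = n" using ex x by blast
    from LeastI_ex[OF this] obtain xs where xs: "walk x xs" "length xs = d x"
      unfolding d_def by blast
    obtain y ys where ys: "xs = x # y # ys" using xs x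
      by (cases xs rule: vwalk_arcs.cases) (auto simp: walk_def)
    then have "walk y (y # ys)" "(x, y) \<in> parcs G" using xs by (auto simp: walk_def)
    then have "d y \<le> length (y # ys)" unfolding d_def by (intro Least_le) blast
    then show ?thesis using xs ys \<open>(x, y) \<in> parcs G\<close> by auto
  qed
  \<comment> \<open>Any nearer neighbour will do here. That there are no cycles is used only when
    \<open>p\<close> is shown to account for all arcs.\<close>
  define p where "p x = (if x \<in> V \<and> x \<noteq> \<rho> then Some (SOME y. (x, y) \<in> parcs G \<and> d y < d x) else None)" for x
  have p: "x \<in> V \<and> x \<noteq> \<rho> \<and> (x, y) \<in> parcs G \<and> d y < d x" if "p x = Some y" for x y
    using that someI_ex[OF nbr[of x]] by (auto simp: p_def split: if_splits)
  have dec: "d (last xs) \<le> d (hd xs)" if "fpath p xs" "xs \<noteq> []" for xs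
    using that
  proof (induction xs)
    case (Cons x xs)
    then show ?case using p[of x "hd xs"] by (cases "xs = []") (auto simp: fpath_Cons)
  qed simp
  have "cyclic_points p = {}"
  proof (rule ccontr)
    assume "cyclic_points p \<noteq> {}"
    then obtain c where c: "fcycle p c" by (auto simp: cyclic_points_def)
    then show False using dec[of c] p[of "last c" "hd c"] by (auto simp: fcycle_def)
  qed
  moreover have "dom p = V - {\<rho>}" by (auto simp: p_def dom_def)
  moreover have "ran p \<subseteq> V" using p in_arcsD2 G unfolding ran_def by blast
  moreover have "finite V" using G pair_finite_verts by simp
  ultimately have rm: "rooted_map V \<rho> p" using G by (simp add: rooted_map_def)
  have arcs: "p x = Some y \<or> p y = Some x" if xy: "(x, y) \<in> parcs G" for x y
  proof (rule ccontr)
    assume neg: "\<not> ?thesis"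
    have xyV: "x \<in> V" "y \<in> V" "x \<noteq> y" using xy wellformed' G pair_no_loops[OF xy] by auto
    obtain xs where xs: "full_path p xs" "hd xs = x" "set xs \<subseteq> V" "last xs = \<rho>"
      using rooted_map_path[OF rm xyV(1)] by metis
    obtain ys where ys: "full_path p ys" "hd ys = y" "set ys \<subseteq> V" "last ys = \<rho>"
      using rooted_map_path[OF rm xyV(2)] by metis
    have "\<rho> \<in> set xs \<inter> set ys" using xs ys by (metis IntI full_path_def last_in_set)
    then have "\<exists>z\<in>set xs. z \<in> set ys" by blast
    then obtain \<alpha> z \<alpha>' where \<alpha>: "xs = \<alpha> @ z # \<alpha>'" "z \<in> set ys" "\<forall>u\<in>set \<alpha>. u \<notin> set ys"
      using split_list_first_prop[of xs "\<lambda>z. z \<in> set ys"] by blast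
    then obtain \<beta> \<beta>' where \<beta>: "ys = \<beta> @ z # \<beta>'" by (meson split_list)
    define ws where "ws = \<alpha> @ z # rev \<beta>"
    have link: "successively (\<lambda>x y. (x, y) \<in> parcs G) us" if "linked p us" for us
      by (rule successively_mono[OF that]) (use p sym in blast)
    have fpa: "fpath p (\<alpha> @ [z])" "fpath p (\<beta> @ [z])"
      using xs(1) ys(1) by (auto simp: \<alpha> \<beta> full_path_def fpath_append fpath_Cons)
    then have "linked p (\<alpha> @ [z])" "linked p (rev (\<beta> @ [z]))"
      using fpath_imp_linked linked_rev by blast+
    then have "linked p ws"
      by (auto simp: ws_def successively_append_iff successively_Cons)
    then have "successively (\<lambda>x y. (x, y) \<in> parcs G) ws" by (rule link)
    moreover have hdx: "hd ws = x" using xs(2) by (cases \<alpha>) (auto simp: ws_def \<alpha>)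
    moreover have "ws \<noteq> []" by (simp add: ws_def)
    ultimately have "successively (\<lambda>x y. (x, y) \<in> parcs G) (y # ws)"
      using sym[OF xy] by (auto simp: successively_Cons)
    moreover have "last ws = y" using ys(2) by (cases \<beta>) (auto simp: ws_def \<beta>)
    moreover have "distinct ws"
      using full_path_distinct[OF xs(1)] full_path_distinct[OF ys(1)] \<alpha>(3) by (auto simp: ws_def \<alpha>(1) \<beta>)
    \<comment> \<open>With at most two vertices on \<open>ws\<close>, the ends \<open>x\<close> and
      \<open>y\<close> would coincide or be joined by \<open>p\<close>.\<close>
    moreover have "length ws \<ge> 3"
    proof (rule ccontr)
      assume "\<not> ?thesis"
      then consider "\<alpha> = []" "\<beta> = []" | a where "\<alpha> = [a]" "\<beta> = []" | b where "\<alpha> = []" "\<beta> = [b]"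
        by (cases \<alpha>; cases \<beta>) (auto simp: ws_def Suc_le_eq)
      then show False
        by cases (use xs(2) ys(2) xyV neg fpa in \<open>auto simp: \<alpha> \<beta> fpath_Cons\<close>)
    qed
    ultimately show False
      using nocyc[of "vwalk_arcs (y # ws)"] cycle_with_proj_iff[of G "vwalk_arcs (y # ws)"] xyV G by blast
  qed
  have "parcs G = {(x, y). p x = Some y \<or> p y = Some x}" using arcs p sym by auto
  then have "G = \<lparr>pverts = V, parcs = {(x, y). p x = Some y \<or> p y = Some x}\<rparr>" using G by simp
  then have "T = map_tree V \<rho> p" by (simp add: map_tree_def G_def \<rho>_def prod_eq_iff)
  then show thesis using that rm unfolding \<rho>_def by blast
qed

text \<open>The two root paths share exactly the stretch from \<open>z\<close> on, along which the
  distance to the root decreases.\<close>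

lemma meet_map_tree:
  assumes "rooted_map V \<rho> p" "full_path p (A @ z # B)" "full_path p (C @ z # B)" "set A \<inter> set C = {}"
    "set (A @ z # B) \<subseteq> V" "set (C @ z # B) \<subseteq> V"
  shows "meet (map_tree V \<rho> p) (hd (A @ [z])) (hd (C @ [z])) = z"
proof -
  let ?T = "map_tree V \<rho> p"
  have last: "last (z # B) = \<rho>"
  proof -
    have "last (z # B) \<in> V" "p (last (z # B)) = None"
      using assms(2,5) last_in_set[of "z # B"] by (auto simp: full_path_def split: if_splits)
    then show ?thesis using assms(1) unfolding rooted_map_def by (metis Diff_iff domIff insert_iff empty_iff)
  qed
  have "root_path ?T (hd (A @ z # B)) = A @ z # B" "root_path ?T (hd (C @ z # B)) = C @ z # B"
    using root_path_map_tree assms last by (metis last_appendR list.distinct(1))+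
  then have rp: "root_path ?T (hd (A @ [z])) = A @ z # B" "root_path ?T (hd (C @ [z])) = C @ z # B"
    by (cases A; cases C; simp)+
  have ds: "distinct (A @ z # B)" "distinct (C @ z # B)" using assms full_path_distinct by blast+
  have common: "set (A @ z # B) \<inter> set (C @ z # B) = set (z # B)" using ds assms(4) by auto
  have len: "length (root_path ?T x) < length (root_path ?T z)" if x: "x \<in> set (z # B)" "x \<noteq> z" for x
  proof -
    obtain B1 B2 where B: "B = B1 @ x # B2" using x by (auto dest: split_list)
    have "root_path ?T (hd (z # B)) = z # B"
      using assms(2,5) last by (intro root_path_map_tree) (auto dest: full_path_suffix)
    moreover have "full_path p (x # B2)" using full_path_suffix[of p "A @ z # B1"] assms(2) B by simp
    then have "root_path ?T (hd (x # B2)) = x # B2"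
      using assms(5) last B by (intro root_path_map_tree) auto
    ultimately show ?thesis by (simp add: B)
  qed
  have "arg_max (\<lambda>x. length (root_path ?T x)) (\<lambda>x. x \<in> set (A @ z # B) \<inter> set (C @ z # B)) = z"
    unfolding common
  proof (rule arg_maxI[where x = z and Q = "\<lambda>x. x = z"])
    show "z \<in> set (z # B)" by simp
    show "\<not> length (root_path ?T z) < length (root_path ?T y)" if "y \<in> set (z # B)" for y
      using len[OF that] by (cases "y = z") auto
    show "x = z" if "x \<in> set (z # B)" "\<forall>y. y \<in> set (z # B) \<longrightarrow> \<not> length (root_path ?T x) < length (root_path ?T y)" for x
      using len[OF that(1)] that(2) by fastforce
  qed
  then show ?thesis by (simp add: meet_def rp)
qed

section \<open>The functions of the theorem\<close>

lemma successively_map_upto: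
  "successively P (map h [a..b]) \<longleftrightarrow> (\<forall>i\<in>{a..<b}. P (h i) (h (i + 1)))"
proof -
  have "successively P (map h [a..b]) \<longleftrightarrow>
    (\<forall>k. Suc k < nat (b - a + 1) \<longrightarrow> P (h (a + int k)) (h (a + int k + 1)))"
    by (auto simp: successively_conv_nth algebra_simps)
  also have "\<dots> \<longleftrightarrow> (\<forall>i\<in>{a..<b}. P (h i) (h (i + 1)))"
  proof
    assume L: "\<forall>k. Suc k < nat (b - a + 1) \<longrightarrow> P (h (a + int k)) (h (a + int k + 1))"
    show "\<forall>i\<in>{a..<b}. P (h i) (h (i + 1))"
    proof
      fix i assume "i \<in> {a..<b}"
      then show "P (h i) (h (i + 1))" using L[rule_format, of "nat (i - a)"] by auto
    qed
  qed auto
  finally show ?thesis .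
qed

lemma distinct_append_last: "distinct (xs @ ys) \<Longrightarrow> xs \<noteq> [] \<Longrightarrow> ys \<noteq> [] \<Longrightarrow> last xs \<noteq> last ys"
  by (metis IntI distinct_append empty_iff last_in_set)

text \<open>Needed to recover the segments from the path. In a list without repetitions, the last
  entry of a block determines where the block ends.\<close>

lemma concat_blocks_last_unique:
  assumes "concat (map s ls) = concat (map s' ls)" "distinct (concat (map s ls))"
    "\<And>i. i \<in> set ls \<Longrightarrow> s i \<noteq> [] \<and> s' i \<noteq> [] \<and> last (s i) = last (s' i)" "i \<in> set ls"
  shows "s i = s' i"
  using assms
proof (induction ls)
  case (Cons j ls)
  have ne: "s j \<noteq> []" "s' j \<noteq> []" "last (s j) = last (s' j)" using Cons.prems(3)[of j] by auto
  have eq: "s j @ concat (map s ls) = s' j @ concat (map s' ls)" using Cons.prems(1) by simp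
  have dist: "distinct (s j @ concat (map s ls))" "distinct (s' j @ concat (map s' ls))"
    using Cons.prems(1,2) by auto
  have "s j = s' j"
  proof -
    consider us where "s j = s' j @ us" | us where "s j @ us = s' j"
      using eq by (auto simp: append_eq_append_conv2)
    then show ?thesis
    proof cases
      case 1
      then show ?thesis using ne dist(1) distinct_append_last[of "s' j" us] by (cases "us = []") auto
    next
      case 2
      then have "s' j = s j @ us" by simp
      then show ?thesis using ne dist(2) distinct_append_last[of "s j" us] by (cases "us = []") auto
    qed
  qed
  moreover have "s i = s' i" if "i \<in> set ls"
    using Cons.IH[OF _ _ _ that] Cons.prems eq \<open>s j = s' j\<close> by auto
  ultimately show ?case using Cons.prems(4) by auto
qed simp

lemma concat_blocks_hd_unique:
  assumes "concat (map s ls) = concat (map s' ls)" "distinct (concat (map s ls))"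
    "\<And>i. i \<in> set ls \<Longrightarrow> s i \<noteq> [] \<and> s' i \<noteq> [] \<and> hd (s i) = hd (s' i)" "i \<in> set ls"
  shows "s i = s' i"
proof -
  have "concat (map (\<lambda>i. rev (t i)) (rev ls)) = rev (concat (map t ls))" for t :: "'b \<Rightarrow> 'a list"
    by (simp add: rev_concat rev_map comp_def)
  then have "rev (s i) = rev (s' i)"
    using assms by (intro concat_blocks_last_unique[of "\<lambda>i. rev (s i)" "rev ls" "\<lambda>i. rev (s' i)"])
      (auto simp: last_rev)
  then show ?thesis by simp
qed

lemma spine_no_links: "spine ls s (\<lambda>_. []) = concat (map s ls)"
  by (simp add: spine_def)

lemma concat_singletons:
  "set xs \<subseteq> I \<Longrightarrow> concat (map (\<lambda>i. if i \<in> I then [h i] else []) xs) = map h xs"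
  by (induction xs) auto

text \<open>With nothing processed, a segment begins and ends with its base vertex; as the path has
  no repetition, it is that single vertex.\<close>

lemma state_initial_iff:
  "state D ls {} f s q \<longleftrightarrow>
     s = (\<lambda>i. if i \<in> set ls then [(i, 1)] else []) \<and>
     full_path (restr D f) (spine ls s q) \<and> set (spine ls s q) \<subseteq> D" (is "?L \<longleftrightarrow> ?R")
proof
  assume L: ?L
  have "s i = [(i, 1)]" if i: "i \<in> set ls" for i
  proof -
    have s: "s i \<noteq> []" "hd (s i) = (i, 1)" "last (s i) = (i, 1)" using L i by (auto simp: state_def)
    have "full_path (restr D f) (spine ls s q)" using L by (simp add: state_def)
    then have "distinct (spine ls s q)" by (rule full_path_distinct)
    then have "distinct (s i)" using i by (auto simp: spine_def distinct_concat_iff)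
    then show ?thesis using s distinct_append_last[of "[(i, 1)]" "tl (s i)"]
      by (cases "s i") (auto split: if_splits)
  qed
  then show ?R using L by (auto simp: state_def fun_eq_iff)
next
  assume R: ?R
  then have "s i = (if i \<in> set ls then [(i, 1)] else [])" for i by metis
  then show ?L using R by (auto simp: state_def)
qed

section \<open>Relabelling that interchanges the ends of segments\<close>

definition flip :: "int set \<Rightarrow> (int \<Rightarrow> vertex list) \<Rightarrow> vertex \<Rightarrow> vertex" where
  "flip J s x = (if fst x \<in> J then transpose (hd (s (fst x))) (last (s (fst x))) x else x)"

text \<open>For an involution \<open>\<kappa>\<close> this renames the vertices, so paths and cycles
  are carried along, and for a level-preserving one it is also a rearrangement.\<close>

definition conj_map :: "(vertex \<Rightarrow> vertex) \<Rightarrow> (vertex \<rightharpoonup> vertex) \<Rightarrow> vertex \<rightharpoonup> vertex" where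
  "conj_map \<kappa> f x = map_option \<kappa> (f (\<kappa> x))"

lemma conj_map_Some:
  assumes "\<And>x. \<kappa> (\<kappa> x) = x"
  shows "conj_map \<kappa> f (\<kappa> x) = Some (\<kappa> y) \<longleftrightarrow> f x = Some y" "conj_map \<kappa> f (\<kappa> x) = None \<longleftrightarrow> f x = None"
  using assms by (auto simp: conj_map_def) (metis assms)

lemma conj_map_conj_map:
  assumes "\<And>x. \<kappa> (\<kappa> x) = x" shows "conj_map \<kappa> (conj_map \<kappa> f) = f"
  using assms by (simp add: conj_map_def fun_eq_iff option.map_comp comp_def option.map_ident)

lemma fpath_conj_map:
  assumes "\<And>x. \<kappa> (\<kappa> x) = x" shows "fpath (conj_map \<kappa> f) (map \<kappa> xs) \<longleftrightarrow> fpath f xs"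
  by (simp add: fpath_def successively_map conj_map_Some[of \<kappa>, OF assms])

lemma full_path_conj_map:
  assumes "\<And>x. \<kappa> (\<kappa> x) = x" shows "full_path (conj_map \<kappa> f) (map \<kappa> xs) \<longleftrightarrow> full_path f xs"
  using fpath_conj_map[of \<kappa> f xs, OF assms] conj_map_Some[of \<kappa> f "last xs", OF assms]
  by (cases "xs = []") (auto simp: full_path_def last_map)

lemma cyclic_points_conj_map:
  assumes inv: "\<And>x. \<kappa> (\<kappa> x) = x" and "cyclic_points f = {}" shows "cyclic_points (conj_map \<kappa> f) = {}"
proof (rule ccontr)
  assume "\<not> ?thesis"
  then obtain c where c: "fcycle (conj_map \<kappa> f) c" by (auto simp: cyclic_points_def)
  define d where "d = map \<kappa> c"
  have cd: "c = map \<kappa> d" by (simp add: d_def comp_def inv)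
  have "inj \<kappa>" using inv by (metis injI)
  then have "distinct d" using c by (simp add: d_def distinct_map fcycle_def inj_on_def)
  moreover have ne: "d \<noteq> []" "fpath f d" using c fpath_conj_map[of \<kappa> f d, OF inv] by (auto simp: cd fcycle_def)
  moreover have "conj_map \<kappa> f (\<kappa> (last d)) = Some (\<kappa> (hd d))"
    using c ne by (simp add: cd fcycle_def last_map hd_map)
  then have "f (last d) = Some (hd d)" using conj_map_Some(1)[of \<kappa> f, OF inv] by blast
  ultimately have "fcycle f d" by (simp add: fcycle_def)
  then have "hd d \<in> cyclic_points f" using ne(1) unfolding cyclic_points_def by auto
  then show False using assms(2) by simp
qed

lemma restr_conj_map:
  assumes "\<And>x. \<kappa> x \<in> D \<longleftrightarrow> x \<in> D"
  shows "restr D (conj_map \<kappa> f) = conj_map \<kappa> (restr D f)"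
proof
  fix x
  show "restr D (conj_map \<kappa> f) x = conj_map \<kappa> (restr D f) x"
    using assms[of x] assms[of "the (f (\<kappa> x))"]
    by (cases "f (\<kappa> x)") (simp_all add: restr_def conj_map_def image_iff)
qed

lemma level_perm_inv_conj: "level_perm W \<kappa> \<Longrightarrow> similar W f (conj_map \<kappa> f)"
  using similarI[of W \<kappa> \<kappa> f] by (simp add: conj_map_def[abs_def])

context
  fixes J :: "int set" and s :: "int \<Rightarrow> vertex list" and W :: "vertex set"
  assumes s: "\<And>j. j \<in> J \<Longrightarrow> s j \<noteq> [] \<and> fst (hd (s j)) = j \<and> fst (last (s j)) = j \<and> set (s j) \<subseteq> W"
begin

lemma flip_fst: "fst (flip J s x) = fst x"
  using s by (auto simp: flip_def transpose_def)

lemma flip_flip: "flip J s (flip J s x) = x"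
  using flip_fst[of x] by (auto simp: flip_def)

lemma flip_level_perm: "level_perm W (flip J s)"
proof -
  have "bij (flip J s)" using flip_flip by (metis bijI' )
  moreover have "flip J s x = x" if "x \<notin> W" for x
  proof (cases "fst x \<in> J")
    case True
    then have "hd (s (fst x)) \<in> W" "last (s (fst x)) \<in> W" using s by (auto dest: hd_in_set last_in_set)
    then show ?thesis using that by (auto simp: flip_def transpose_def)
  qed (simp add: flip_def)
  ultimately show ?thesis using flip_fst by (simp add: level_perm_def)
qed

lemma flip_ends: "j \<in> J \<Longrightarrow> flip J s (hd (s j)) = last (s j)" "j \<in> J \<Longrightarrow> flip J s (last (s j)) = hd (s j)"
  using s by (auto simp: flip_def)

text \<open>Renaming swaps the two ends of each segment, and the pair of ends is the same; so the
  renamed segments define the same involution, and the operation is its own inverse.\<close>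

lemma flip_map: "flip J (\<lambda>i. map (flip J s) (s i)) = flip J s"
proof
  fix x
  show "flip J (\<lambda>i. map (flip J s) (s i)) x = flip J s x"
  proof (cases "fst x \<in> J")
    case True
    then have "hd (map (flip J s) (s (fst x))) = last (s (fst x))" "last (map (flip J s) (s (fst x))) = hd (s (fst x))"
      using s flip_ends by (simp_all add: hd_map last_map)
    then show ?thesis using True by (simp add: flip_def[of J s x] flip_def[of J "\<lambda>i. map (flip J s) (s i)"] transpose_commute)
  qed (simp add: flip_def)
qed

end

section \<open>The vertex set, enlarged by one vertex on top\<close>

locale profile =
  fixes l r :: int and n :: "int \<Rightarrow> nat" and S :: "int set" and V :: "vertex set"
  assumes l: "l < 0" and r: "0 \<le> r"
    and n: "\<forall>i\<in>{l..r}. n i > 0"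
    and V: "V = vertex_set l r n"
    and S: "finite S" "S \<noteq> {}" "Min S = -1" "Max S = 1"
begin

definition W :: "vertex set" where "W = insert (r + 1, 1) V"

definition D :: "vertex set" where "D = {x \<in> W. 1 \<le> fst x}"

text \<open>Covers the given functions as well as parent maps. The vertex without image is
  \<open>(0, 1)\<close> at the start and the root in the end, and it may move within abscissa
  0.\<close>

definition Fun :: "(vertex \<rightharpoonup> vertex) \<Rightarrow> bool" where
  "Fun f \<longleftrightarrow> (\<exists>\<rho>\<in>level V 0. dom f = W - {\<rho>}) \<and> ran f \<subseteq> V \<and>
     (\<forall>x y. f x = Some y \<longrightarrow> fst x - fst y \<in> S)"

lemma S_sub: "s \<in> S \<Longrightarrow> -1 \<le> s \<and> s \<le> 1"
  using Min_le[OF S(1)] Max_ge[OF S(1)] S by metis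

lemma finite_V: "finite V" and finite_W: "finite W"
  unfolding W_def by (auto simp: V vertex_set_def)

lemma base_in_V: "l \<le> i \<Longrightarrow> i \<le> r \<Longrightarrow> (i, 1) \<in> V"
  using n by (force simp: V vertex_set_def Suc_le_eq)

lemma base_in_W: "l \<le> i \<Longrightarrow> i \<le> r + 1 \<Longrightarrow> (i, 1) \<in> W"
  using base_in_V[of i] by (cases "i = r + 1") (auto simp: W_def)

lemma fst_V: "x \<in> V \<Longrightarrow> l \<le> fst x \<and> fst x \<le> r"
  by (auto simp: V vertex_set_def)

lemma fst_W: "x \<in> W \<Longrightarrow> l \<le> fst x \<and> fst x \<le> r + 1"
  using fst_V l r by (fastforce simp: W_def)

lemma top_W: "x \<in> W \<Longrightarrow> fst x = r + 1 \<Longrightarrow> x = (r + 1, 1)"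
  using fst_V by (fastforce simp: W_def)

lemma in_V_iff: "x \<in> V \<longleftrightarrow> x \<in> W \<and> fst x \<noteq> r + 1"
  using fst_V top_W by (fastforce simp: W_def)

lemma Fun_step: "Fun f \<Longrightarrow> f x = Some y \<Longrightarrow> fst y \<le> fst x + 1 \<and> fst x \<le> fst y + 1"
  using S_sub unfolding Fun_def by (metis add.commute diff_le_eq le_diff_eq minus_diff_eq diff_ge_0_iff_ge
      add_le_cancel_left diff_add_cancel uminus_add_conv_diff)

lemma Fun_in: "Fun f \<Longrightarrow> f x = Some y \<Longrightarrow> x \<in> W \<and> y \<in> V"
  unfolding Fun_def by (metis Diff_iff domI ranI subsetD)

lemma Fun_V_W: "V \<subseteq> W" by (auto simp: W_def)

lemma Fun_None: "Fun f \<Longrightarrow> x \<in> W \<Longrightarrow> f x = None \<Longrightarrow> fst x = 0"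
  unfolding Fun_def level_def by (metis (mono_tags, lifting) Diff_iff domIff insert_iff empty_iff mem_Collect_eq)

lemma Fun_None_unique: "Fun f \<Longrightarrow> x \<in> W \<Longrightarrow> f x = None \<Longrightarrow> y \<in> W \<Longrightarrow> f y = None \<Longrightarrow> x = y"
  unfolding Fun_def by (metis Diff_iff domIff insert_iff empty_iff)

lemma level_perm_V:
  assumes "level_perm W \<pi>" shows "\<pi> x \<in> V \<longleftrightarrow> x \<in> V"
  using level_perm_in[OF assms, of x] assms unfolding in_V_iff level_perm_def by simp

lemma Fun_similar:
  assumes "similar W f p" "Fun f" shows "Fun p"
proof -
  obtain \<sigma> \<pi> where *: "level_perm W \<sigma>" "level_perm W \<pi>" and p: "p = (\<lambda>x. map_option \<sigma> (f (\<pi> x)))"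
    using assms(1) unfolding similar_def by blast
  obtain \<rho> where \<rho>: "\<rho> \<in> level V 0" "dom f = W - {\<rho>}" using assms(2) by (auto simp: Fun_def)
  have lev: "fst (\<sigma> x) = fst x" "fst (\<pi> x) = fst x" for x using * by (auto simp: level_perm_def)
  have "bij \<pi>" using * by (simp add: level_perm_def)
  then obtain \<rho>' where \<rho>': "\<pi> \<rho>' = \<rho>" by (metis bij_pointE)
  have "\<rho>' \<in> level V 0" using \<rho>' \<rho>(1) lev(2)[of \<rho>'] level_perm_V[OF *(2), of \<rho>'] by (auto simp: level_def)
  moreover have "dom p = W - {\<rho>'}"
  proof -
    have "p x \<noteq> None \<longleftrightarrow> x \<in> W - {\<rho>'}" for x
    proof -
      have "p x \<noteq> None \<longleftrightarrow> \<pi> x \<in> dom f" by (auto simp: p)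
      also have "\<dots> \<longleftrightarrow> x \<in> W \<and> \<pi> x \<noteq> \<pi> \<rho>'" using \<rho>(2) \<rho>' level_perm_in[OF *(2), of x] by auto
      also have "\<pi> x \<noteq> \<pi> \<rho>' \<longleftrightarrow> x \<noteq> \<rho>'" using \<open>bij \<pi>\<close> by (metis bij_pointE)
      finally show ?thesis by simp
    qed
    then show ?thesis by (auto simp: dom_def)
  qed
  moreover have "ran p \<subseteq> V"
  proof
    fix y assume "y \<in> ran p"
    then obtain x z where "f (\<pi> x) = Some z" "y = \<sigma> z" by (auto simp: p ran_def)
    then show "y \<in> V" using assms(2) level_perm_V[OF *(1), of z] unfolding Fun_def ran_def by auto
  qed
  moreover have "fst x - fst y \<in> S" if "p x = Some y" for x y
  proof -
    obtain z where "f (\<pi> x) = Some z" "y = \<sigma> z" using \<open>p x = Some y\<close> by (auto simp: p)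
    then show ?thesis using assms(2) lev unfolding Fun_def by metis
  qed
  ultimately show ?thesis unfolding Fun_def by blast
qed

lemma restr_W: "Fun f \<Longrightarrow> restr W f = f"
proof
  fix x assume f: "Fun f"
  show "restr W f x = f x"
    using Fun_in[OF f, of x] Fun_V_W by (cases "f x") (auto simp: restr_def)
qed

section \<open>Insertion of the cycles of positive abscissa\<close>

abbreviation ups :: "int list" where "ups \<equiv> rev [1..r + 1]"

text \<open>The ends of a segment are restricted only by their abscissa, so the condition is the
  same before and after the interchange of ends.\<close>

definition positive_part :: "(vertex \<rightharpoonup> vertex) \<Rightarrow> (int \<Rightarrow> vertex list) \<Rightarrow> bool" where
  "positive_part f s \<longleftrightarrow> full_path (restr D f) (concat (map s ups)) \<and> set (concat (map s ups)) \<subseteq> D \<and>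
     (\<forall>i. i \<notin> {1..r + 1} \<longrightarrow> s i = []) \<and> cyclic_points (restr D f) = {} \<and>
     (\<forall>i\<in>{1..r + 1}. s i \<noteq> [] \<and> (\<forall>x\<in>set (s i). i \<le> fst x) \<and> fst (hd (s i)) = i \<and> fst (last (s i)) = i)"

definition negative_part :: "(vertex \<rightharpoonup> vertex) \<Rightarrow> bool" where
  "negative_part f \<longleftrightarrow> fpath f (map (\<lambda>i. (i, 1)) [l..-1]) \<and> f (-1, 1) \<in> Some ` level V 0 \<and> f (0, 1) = None"

definition A0 :: "(vertex \<rightharpoonup> vertex) set" where
  "A0 = {f. Fun f \<and> negative_part f \<and> (\<forall>i\<in>{1..r + 1}. f (i, 1) = Some (i - 1, 1))}"

text \<open>The condition \<open>T1\<close> on the side of functions. It depends on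
  \<open>restr D f\<close> alone, so changes at abscissas at most 0 do not affect it.\<close>

definition T1_map :: "(vertex \<rightharpoonup> vertex) \<Rightarrow> bool" where
  "T1_map f \<longleftrightarrow> (\<exists>s. positive_part f s \<and> (\<forall>i\<in>{1..r + 1}. last (s i) = (i, 1)))"

definition A1 :: "(vertex \<rightharpoonup> vertex) set" where
  "A1 = {f. Fun f \<and> negative_part f \<and> f (1, 1) = Some (0, 1) \<and> T1_map f}"

lemma negative_part_cong:
  assumes "\<And>x. fst x \<le> 0 \<Longrightarrow> f x = f' x" shows "negative_part f = negative_part f'"
proof -
  have "fpath f (map (\<lambda>i. (i, 1)) [l..-1]) = fpath f' (map (\<lambda>i. (i, 1)) [l..-1])"
    by (intro fpath_cong assms) (auto dest!: in_set_butlastD)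
  then show ?thesis using assms by (simp add: negative_part_def)
qed

text \<open>An insertion at abscissa 1 passes the edge into \<open>(0, 1)\<close> on to the new end
  of segment 1; hence the edge is tied to \<open>last (s 1)\<close> and not to
  \<open>(1, 1)\<close>.\<close>

definition inv_pos :: "(vertex \<rightharpoonup> vertex) \<Rightarrow> (int \<Rightarrow> vertex list) \<Rightarrow> (int \<Rightarrow> vertex list) \<Rightarrow> bool" where
  "inv_pos f s q \<longleftrightarrow> Fun f \<and> negative_part f \<and> q = (\<lambda>_. []) \<and> s 1 \<noteq> [] \<and> fst (last (s 1)) = 1 \<and>
     f (last (s 1)) = Some (0, 1)"

lemma Fun_comp_transpose_iff:
  assumes "e \<in> W" "v \<in> W" "fst e = fst v"
  shows "Fun (f \<circ> transpose e v) \<longleftrightarrow> Fun f"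
proof -
  have lp: "level_perm W (transpose e v)" using assms by (rule level_perm_transpose)
  have "f = (f \<circ> transpose e v) \<circ> transpose e v" by (simp add: comp_assoc)
  then show ?thesis using Fun_similar similar_comp[OF lp] by metis
qed

lemma foata_invariant_inv_pos: "foata_invariant D ups inv_pos"
  unfolding foata_invariant_def
proof (intro allI impI)
  fix f f' :: "vertex \<rightharpoonup> vertex" and s q s' :: "int \<Rightarrow> vertex list" and i c e v
  assume i: "i \<in> set ups" and ne: "s i \<noteq> []" "c \<noteq> []" and ev: "e = last (s i)" "v = last c" "fst e = i" "fst v = i"
    "e \<in> D" "v \<in> D" and f': "f' = f \<circ> transpose e v" and s': "s' = s(i := s i @ c)"
  have "Fun f' = Fun f" unfolding f' by (rule Fun_comp_transpose_iff) (use ev in \<open>auto simp: D_def\<close>)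
  moreover have "negative_part f = negative_part f'"
    by (rule negative_part_cong) (use ev in \<open>auto simp: f' transpose_def D_def\<close>)
  moreover have "(s 1 \<noteq> [] \<and> fst (last (s 1)) = 1 \<and> f (last (s 1)) = Some (0, 1)) =
     (s' 1 \<noteq> [] \<and> fst (last (s' 1)) = 1 \<and> f' (last (s' 1)) = Some (0, 1))"
    using ne ev by (cases "i = 1") (auto simp: s' f' transpose_def)
  ultimately show "inv_pos f s q = inv_pos f' s' q" unfolding inv_pos_def by blast
qed

lemma set_ups: "set ups = {1..r + 1}" "distinct ups" by auto

lemma restr_base_path:
  assumes "\<forall>i\<in>{1..r + 1}. f (i, 1) = Some (i - 1, 1)"
  shows "full_path (restr D f) (map (\<lambda>i. (i, 1)) ups)"
proof -
  have "restr D f (i, 1) = Some (i - 1, 1)" if "i \<in> {2..r + 1}" for i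
    using that assms base_in_W[of i] base_in_W[of "i - 1"] l by (auto simp: restr_Some D_def)
  then have "fpath (restr D f) (map (\<lambda>i. (i, 1)) ups)"
    by (auto simp: fpath_def rev_map[symmetric] successively_map_upto)
  moreover have "restr D f (1, 1) = None" using assms r by (auto simp: restr_def D_def)
  moreover have "last (map (\<lambda>i. (i, 1)) ups) = ((1, 1) :: vertex)" "map (\<lambda>i. (i, 1)) ups \<noteq> []"
    using r by (auto simp: rev_map[symmetric] last_rev upto_rec1)
  ultimately show ?thesis by (auto simp: full_path_def)
qed

lemma A0_states: "matched W A0 id (states D ups inv_pos {}) fst"
proof (rule matchedI[where F = "\<lambda>f. (f, \<lambda>i. if i \<in> set ups then [(i, 1)] else [], \<lambda>_. [])" and G = fst])
  define s0 :: "int \<Rightarrow> vertex list" where "s0 = (\<lambda>i. if i \<in> set ups then [(i, 1)] else [])"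
  have sp: "spine ups s0 (\<lambda>_. []) = map (\<lambda>i. (i, 1)) ups"
    unfolding spine_no_links s0_def by (rule concat_singletons) (rule order_refl)
  have spD: "set (spine ups s0 (\<lambda>_. [])) \<subseteq> D" unfolding sp using base_in_W l by (auto simp: D_def)
  fix f assume "f \<in> A0"
  then show "(f, \<lambda>i. if i \<in> set ups then [(i, 1)] else [], \<lambda>_. []) \<in> states D ups inv_pos {}"
    using restr_base_path[of f] sp spD r unfolding s0_def
    by (auto simp: states_def state_initial_iff inv_pos_def A0_def)
next
  fix y assume y: "y \<in> states D ups inv_pos {}"
  then obtain f s q where fs: "y = (f, s, q)" "state D ups {} f s q" "inv_pos f s q" by (auto simp: states_def)
  have s: "s = (\<lambda>i. if i \<in> set ups then [(i, 1)] else [])" using fs(2) unfolding state_initial_iff by blast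
  have q: "q = (\<lambda>_. [])" using fs(3) by (simp add: inv_pos_def)
  show "(fst y, \<lambda>i. if i \<in> set ups then [(i, 1)] else [], \<lambda>_. []) = y" using fs s q by simp
  have "spine ups s q = map (\<lambda>i. (i, 1)) ups"
    unfolding q spine_no_links s by (rule concat_singletons) (rule order_refl)
  then have "fpath (restr D f) (map (\<lambda>i. (i, 1)) ups)"
    using fs(2) unfolding state_def full_path_def by simp
  then have step: "restr D f (i + 1, 1) = Some (i, 1)" if "i \<in> {1..<r + 1}" for i
    using that unfolding fpath_def rev_map[symmetric] by (auto simp: successively_map_upto)
  have "f (i, 1) = Some (i - 1, 1)" if i: "i \<in> {1..r + 1}" for i
  proof (cases "i = 1")
    case True
    then show ?thesis using fs(3) i by (simp add: inv_pos_def s)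
  next
    case False
    then have "restr D f (i - 1 + 1, 1) = Some (i - 1, 1)" using i by (intro step) auto
    then show ?thesis by (simp add: restr_Some)
  qed
  then show "fst y \<in> A0" using fs by (auto simp: A0_def inv_pos_def)
qed auto

end

text \<open>Once all vertices at the abscissas of \<open>ls\<close> are processed, except base
  vertices, the bookkeeping with \<open>K\<close> says only that no cycle meets these abscissas:
  base vertices lie on the spine anyway.\<close>

lemma state_full_iff:
  assumes K: "K = {x \<in> D. fst x \<in> set ls \<and> x \<noteq> (fst x, 1)}"
  shows "state D ls K f s q \<longleftrightarrow>
     full_path (restr D f) (spine ls s q) \<and> set (spine ls s q) \<subseteq> D \<and>
     (\<forall>i\<in>set ls. s i \<noteq> [] \<and> hd (s i) = (i, 1) \<and> (\<forall>x\<in>set (s i). i \<le> fst x) \<and> fst (last (s i)) = i) \<and>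
     (\<forall>i. i \<notin> set ls \<longrightarrow> s i = []) \<and> (\<forall>x\<in>cyclic_points (restr D f). fst x \<notin> set ls)" (is "?L \<longleftrightarrow> ?R")
proof
  assume L: ?L
  have "fst x \<notin> set ls" if x: "x \<in> cyclic_points (restr D f)" for x
  proof
    assume i: "fst x \<in> set ls"
    obtain c where c: "fcycle (restr D f) c" "x \<in> set c" using x by (auto simp: cyclic_points_def)
    then have "x \<in> D" using fcycle_restr by blast
    moreover have "x \<notin> K" using L x by (auto simp: state_def)
    ultimately have "x = (fst x, 1)" using K i by blast
    moreover have "s (fst x) \<noteq> []" "hd (s (fst x)) = (fst x, 1)" using L i by (auto simp: state_def)
    ultimately have "x \<in> set (s (fst x))" by (metis hd_in_set)
    then have "x \<in> set (spine ls s q)" using i by (auto simp: spine_def)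
    then show False using L c full_path_no_cycle[of "restr D f" "spine ls s q" c] by (auto simp: state_def)
  qed
  then show ?R using L by (auto simp: state_def)
next
  assume R: ?R
  have "last (s i) \<in> insert (i, 1) K" if i: "i \<in> set ls" for i
  proof -
    have "last (s i) \<in> set (spine ls s q)" using R i by (force simp: spine_def)
    then have "last (s i) \<in> D" "fst (last (s i)) = i" using R i by auto
    then show ?thesis using i by (cases "last (s i) = (i, 1)") (auto simp: K)
  qed
  moreover have "K \<inter> cyclic_points (restr D f) = {}" using R by (auto simp: K)
  ultimately show ?L using R unfolding state_def by blast
qed

context profile
begin

text \<open>What holds both before the interchange of ends, when segment \<open>i\<close> starts
  with \<open>(i, 1)\<close>, and after it, when it ends with \<open>(i, 1)\<close>.\<close>

definition common :: "(vertex \<rightharpoonup> vertex) \<Rightarrow> (int \<Rightarrow> vertex list) \<Rightarrow> bool" where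
  "common f s \<longleftrightarrow> Fun f \<and> negative_part f \<and> f (last (s 1)) = Some (0, 1) \<and> positive_part f s"

lemma states_inv_pos_full:
  "matched W (states D ups inv_pos {x \<in> D. fst x \<in> set ups \<and> x \<noteq> (fst x, 1)}) fst
     {(f, s). common f s \<and> (\<forall>i\<in>{1..r + 1}. hd (s i) = (i, 1))} fst" (is "matched W ?P fst ?Q fst")
proof (rule matchedI[where F = "\<lambda>(f, s, q). (f, s)" and G = "\<lambda>(f, s). (f, s, \<lambda>_. [])"])
  have cycD: "fst x \<in> set ups" if "x \<in> cyclic_points (restr D f)" for x f
  proof -
    have "x \<in> D" using that fcycle_restr by (fastforce simp: cyclic_points_def)
    then show ?thesis using fst_W by (auto simp: D_def)
  qed
  have *: "(f, s, q) \<in> ?P \<longleftrightarrow> (f, s) \<in> ?Q \<and> q = (\<lambda>_. [])" for f s q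
  proof -
    have "(f, s, q) \<in> ?P \<longleftrightarrow> state D ups {x \<in> D. fst x \<in> set ups \<and> x \<noteq> (fst x, 1)} f s q \<and> inv_pos f s q"
      by (simp add: states_def)
    also have "\<dots> \<longleftrightarrow> (f, s) \<in> ?Q \<and> q = (\<lambda>_. [])"
    proof
      assume A: "state D ups {x \<in> D. fst x \<in> set ups \<and> x \<noteq> (fst x, 1)} f s q \<and> inv_pos f s q"
      then have q: "q = (\<lambda>_. [])" by (simp add: inv_pos_def)
      have st: "full_path (restr D f) (concat (map s ups)) \<and> set (concat (map s ups)) \<subseteq> D \<and>
     (\<forall>i\<in>set ups. s i \<noteq> [] \<and> hd (s i) = (i, 1) \<and> (\<forall>x\<in>set (s i). i \<le> fst x) \<and> fst (last (s i)) = i) \<and>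
     (\<forall>i. i \<notin> set ups \<longrightarrow> s i = []) \<and> (\<forall>x\<in>cyclic_points (restr D f). fst x \<notin> set ups)"
        using A unfolding state_full_iff[OF refl] q spine_no_links by blast
      then have "cyclic_points (restr D f) = {}" using cycD by blast
      then have "positive_part f s" using st unfolding positive_part_def set_ups by simp
      then show "(f, s) \<in> ?Q \<and> q = (\<lambda>_. [])" using A st q
        unfolding common_def inv_pos_def set_ups by simp
    next
      assume A: "(f, s) \<in> ?Q \<and> q = (\<lambda>_. [])"
      then have q: "q = (\<lambda>_. [])" and pp: "positive_part f s" "common f s"
        and h: "\<forall>i\<in>{1..r + 1}. hd (s i) = (i, 1)" by (auto simp: common_def)
      have "1 \<in> {1..r + 1}" using r by simp
      then have "s 1 \<noteq> []" "fst (last (s 1)) = 1" using pp(1) unfolding positive_part_def by blast+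
      then have "inv_pos f s q" using pp(2) q by (simp add: inv_pos_def common_def)
      moreover have "state D ups {x \<in> D. fst x \<in> set ups \<and> x \<noteq> (fst x, 1)} f s q"
        unfolding state_full_iff[OF refl] q spine_no_links unfolding set_ups using pp(1) h
        unfolding positive_part_def by blast
      ultimately show "state D ups {x \<in> D. fst x \<in> set ups \<and> x \<noteq> (fst x, 1)} f s q \<and> inv_pos f s q" by blast
    qed
    finally show ?thesis .
  qed
  {
    fix x assume x: "x \<in> ?P"
    obtain f s q where fsq: "x = (f, s, q)" by (metis prod_cases3)
    have "(f, s) \<in> ?Q \<and> q = (\<lambda>_. [])" using x unfolding fsq * .
    then show "(case x of (f, s, q) \<Rightarrow> (f, s)) \<in> ?Q"
      "(case case x of (f, s, q) \<Rightarrow> (f, s) of (f, s) \<Rightarrow> (f, s, \<lambda>_. [])) = x"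
      unfolding fsq by simp_all
  next
    fix y assume y: "y \<in> ?Q"
    obtain f s where fs: "y = (f, s)" by (metis prod.exhaust)
    have "(f, s, \<lambda>_. []) \<in> ?P" unfolding * using y fs by blast
    then show "(case y of (f, s) \<Rightarrow> (f, s, \<lambda>_. [])) \<in> ?P" unfolding fs by simp
  }
qed auto

lemma positive_partD:
  assumes "positive_part f s" "j \<in> {1..r + 1}"
  shows "s j \<noteq> [] \<and> fst (hd (s j)) = j \<and> fst (last (s j)) = j \<and> set (s j) \<subseteq> D"
  using assms by (fastforce simp: positive_part_def)

text \<open>\<open>T1\<close> requires \<open>(i, 1)\<close> right before the first visit to
  \<open>i - 1\<close>, that is, at the end of segment \<open>i\<close>, while insertion has left it
  at the beginning.\<close>

lemma common_flip:
  assumes "common f s"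
  defines "\<kappa> \<equiv> flip {1..r + 1} s"
  shows "common (conj_map \<kappa> f) (\<lambda>i. map \<kappa> (s i))"
    and "conj_map (flip {1..r + 1} (\<lambda>i. map \<kappa> (s i))) (conj_map \<kappa> f) = f"
    and "(\<lambda>i. map (flip {1..r + 1} (\<lambda>i. map \<kappa> (s i))) (map \<kappa> (s i))) = s"
    and "similar W f (conj_map \<kappa> f)"
    and "i \<in> {1..r + 1} \<Longrightarrow> hd (map \<kappa> (s i)) = last (s i) \<and> last (map \<kappa> (s i)) = hd (s i)"
proof -
  have pp: "positive_part f s" using assms by (simp add: common_def)
  have sD: "s j \<noteq> [] \<and> fst (hd (s j)) = j \<and> fst (last (s j)) = j \<and> set (s j) \<subseteq> D" if "j \<in> {1..r + 1}" for j
    using positive_partD[OF pp that] .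
  have sW: "s j \<noteq> [] \<and> fst (hd (s j)) = j \<and> fst (last (s j)) = j \<and> set (s j) \<subseteq> W" if "j \<in> {1..r + 1}" for j
    using sD[OF that] by (auto simp: D_def)
  have inv: "\<kappa> (\<kappa> x) = x" for x unfolding \<kappa>_def by (rule flip_flip[OF sD])
  have fst: "fst (\<kappa> x) = fst x" for x unfolding \<kappa>_def by (rule flip_fst[OF sD])
  have lpD: "level_perm D \<kappa>" unfolding \<kappa>_def by (rule flip_level_perm[OF sD])
  have lpW: "level_perm W \<kappa>" unfolding \<kappa>_def by (rule flip_level_perm[OF sW])
  have fix0: "\<kappa> x = x" if "fst x \<le> 0" for x using that by (auto simp: \<kappa>_def flip_def)
  show sim: "similar W f (conj_map \<kappa> f)" by (rule level_perm_inv_conj[OF lpW])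
  have fm: "flip {1..r + 1} (\<lambda>i. map \<kappa> (s i)) = \<kappa>" unfolding \<kappa>_def by (rule flip_map[OF sD])
  show "conj_map (flip {1..r + 1} (\<lambda>i. map \<kappa> (s i))) (conj_map \<kappa> f) = f"
    unfolding fm by (rule conj_map_conj_map[OF inv])
  show "(\<lambda>i. map (flip {1..r + 1} (\<lambda>i. map \<kappa> (s i))) (map \<kappa> (s i))) = s"
    unfolding fm by (simp add: comp_def inv)
  show ends: "hd (map \<kappa> (s i)) = last (s i) \<and> last (map \<kappa> (s i)) = hd (s i)" if "i \<in> {1..r + 1}" for i
    using flip_ends[OF sD that] sD[OF that] by (simp add: hd_map last_map \<kappa>_def)
  have "Fun (conj_map \<kappa> f)" using Fun_similar[OF sim] assms by (simp add: common_def)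
  moreover have "negative_part (conj_map \<kappa> f)"
  proof -
    have ng: "negative_part f" using assms by (simp add: common_def)
    have "map \<kappa> (map (\<lambda>i. (i, 1)) [l..-1]) = map (\<lambda>i. (i, 1)) [l..-1]" using fix0 by auto
    then have "fpath (conj_map \<kappa> f) (map (\<lambda>i. (i, 1)) [l..-1])"
      using fpath_conj_map[of \<kappa> f "map (\<lambda>i. (i, 1)) [l..-1]", OF inv] ng unfolding negative_part_def
      by metis
    moreover obtain w where "f (-1, 1) = Some w" "w \<in> level V 0" using ng by (auto simp: negative_part_def)
    then have "conj_map \<kappa> f (-1, 1) \<in> Some ` level V 0" using fix0 by (auto simp: conj_map_def level_def)
    moreover have "conj_map \<kappa> f (0, 1) = None" using ng fix0 by (simp add: conj_map_def negative_part_def)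
    ultimately show ?thesis by (simp add: negative_part_def)
  qed
  moreover have "conj_map \<kappa> f (last (map \<kappa> (s 1))) = Some (0, 1)"
    using assms(1) sD[of 1] r inv fix0 by (simp add: conj_map_def last_map common_def)
  moreover have "positive_part (conj_map \<kappa> f) (\<lambda>i. map \<kappa> (s i))"
  proof -
    have cm: "concat (map (\<lambda>i. map \<kappa> (s i)) ups) = map \<kappa> (concat (map s ups))"
      by (simp add: map_concat comp_def)
    have rs: "restr D (conj_map \<kappa> f) = conj_map \<kappa> (restr D f)"
      by (rule restr_conj_map) (rule level_perm_in[OF lpD])
    have "full_path (restr D (conj_map \<kappa> f)) (concat (map (\<lambda>i. map \<kappa> (s i)) ups))"
      unfolding cm rs using full_path_conj_map[of \<kappa>, OF inv] pp by (simp add: positive_part_def)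
    moreover have "set (concat (map (\<lambda>i. map \<kappa> (s i)) ups)) \<subseteq> D"
    proof -
      have "set (concat (map s ups)) \<subseteq> D" using pp by (simp add: positive_part_def)
      then show ?thesis unfolding cm set_map using level_perm_in[OF lpD] by blast
    qed
    moreover have "cyclic_points (restr D (conj_map \<kappa> f)) = {}"
      unfolding rs using cyclic_points_conj_map[of \<kappa>, OF inv] pp by (simp add: positive_part_def)
    moreover have "map \<kappa> (s i) \<noteq> [] \<and> (\<forall>x\<in>set (map \<kappa> (s i)). i \<le> fst x) \<and>
        fst (hd (map \<kappa> (s i))) = i \<and> fst (last (map \<kappa> (s i))) = i" if i: "i \<in> {1..r + 1}" for i
    proof -
      have "\<forall>x\<in>set (s i). i \<le> fst x" using pp i by (simp add: positive_part_def)
      then have "\<forall>x\<in>set (map \<kappa> (s i)). i \<le> fst x" using fst by simp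
      then show ?thesis using ends[OF i] sD[OF i] by simp
    qed
    ultimately show ?thesis using pp by (simp add: positive_part_def)
  qed
  ultimately show "common (conj_map \<kappa> f) (\<lambda>i. map \<kappa> (s i))" by (simp add: common_def)
qed

text \<open>Both lists are the complete path of \<open>restr D f\<close> from
  \<open>(r + 1, 1)\<close>, the only vertex of its abscissa. The vertices \<open>(i, 1)\<close>
  then mark the ends of the segments.\<close>

lemma positive_part_unique:
  assumes "positive_part f s" "positive_part f s'"
    "\<forall>i\<in>{1..r + 1}. last (s i) = (i, 1)" "\<forall>i\<in>{1..r + 1}. last (s' i) = (i, 1)"
  shows "s = s'"
proof -
  have top: "hd (concat (map t ups)) = (r + 1, 1)" if "positive_part f t" for t
  proof -
    have t: "t (r + 1) \<noteq> []" "fst (hd (t (r + 1))) = r + 1" "set (t (r + 1)) \<subseteq> D"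
      using positive_partD[OF that, of "r + 1"] r by auto
    then have "hd (t (r + 1)) = (r + 1, 1)" using top_W[of "hd (t (r + 1))"] hd_in_set[of "t (r + 1)"] unfolding D_def by blast
    moreover have "ups = (r + 1) # rev [1..r]" using r by (simp add: upto_rec2)
    ultimately show ?thesis using t(1) by simp
  qed
  have "concat (map s ups) = concat (map s' ups)"
    using assms top full_path_unique[of "restr D f"] by (simp add: positive_part_def)
  moreover have "distinct (concat (map s ups))"
    using assms(1) full_path_distinct unfolding positive_part_def by blast
  ultimately have "s i = s' i" if "i \<in> {1..r + 1}" for i
    using that assms by (intro concat_blocks_last_unique[of s ups s']) (auto simp: positive_part_def)
  moreover have "s i = s' i" if "i \<notin> {1..r + 1}" for i using that assms by (simp add: positive_part_def)
  ultimately show ?thesis by (metis ext)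
qed

lemma A0_A1: "matched W A0 id A1 id"
proof -
  let ?X1 = "{(f, s). common f s \<and> (\<forall>i\<in>{1..r + 1}. hd (s i) = (i, 1))}"
  let ?X2 = "{(f, s). common f s \<and> (\<forall>i\<in>{1..r + 1}. last (s i) = (i, 1))}"
  define \<Theta> where "\<Theta> = (\<lambda>(f, s). (conj_map (flip {1..r + 1} s) f, \<lambda>i. map (flip {1..r + 1} s) (s i)))"
  have "matched W (states D ups inv_pos {}) fst
    (states D ups inv_pos {x \<in> D. fst x \<in> set ups \<and> x \<noteq> (fst x, 1)}) fst"
    by (rule foata[OF _ foata_invariant_inv_pos]) (use finite_W in \<open>auto simp: D_def\<close>)
  moreover have "matched W ?X1 fst ?X2 fst"
  proof (rule matchedI[where F = \<Theta> and G = \<Theta>])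
    fix x assume "x \<in> ?X1"
    then obtain f s where x: "x = (f, s)" "common f s" "\<forall>i\<in>{1..r + 1}. hd (s i) = (i, 1)" by blast
    show "\<Theta> x \<in> ?X2" using common_flip[OF x(2)] x by (simp add: \<Theta>_def)
    show "\<Theta> (\<Theta> x) = x" "similar W (fst x) (fst (\<Theta> x))"
      using common_flip(2,3,4)[OF x(2)] x by (simp_all add: \<Theta>_def)
  next
    fix x assume "x \<in> ?X2"
    then obtain f s where x: "x = (f, s)" "common f s" "\<forall>i\<in>{1..r + 1}. last (s i) = (i, 1)" by blast
    show "\<Theta> x \<in> ?X1" using common_flip[OF x(2)] x by (simp add: \<Theta>_def)
    show "\<Theta> (\<Theta> x) = x" using common_flip(2,3)[OF x(2)] x by (simp add: \<Theta>_def)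
  qed
  moreover have "inj_on fst ?X2"
  proof (rule inj_onI)
    fix x y assume xy: "x \<in> ?X2" "y \<in> ?X2" "fst x = fst y"
    then have "snd x = snd y"
      by (intro positive_part_unique[of "fst x"]) (simp_all add: common_def split_beta)
    then show "x = y" using xy(3) by (simp add: prod_eq_iff)
  qed
  moreover have "fst ` ?X2 = A1"
  proof
    have "1 \<in> {1..r + 1}" using r by simp
    show "fst ` ?X2 \<subseteq> A1"
    proof
      fix f assume "f \<in> fst ` ?X2"
      then obtain s where s: "common f s" "\<forall>i\<in>{1..r + 1}. last (s i) = (i, 1)" by auto
      then have "T1_map f" unfolding T1_map_def common_def by blast
      then show "f \<in> A1" using s \<open>1 \<in> {1..r + 1}\<close> by (simp add: A1_def common_def)
    qed
    show "A1 \<subseteq> fst ` ?X2"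
    proof
      fix f assume "f \<in> A1"
      then obtain s where "Fun f" "negative_part f" "f (1, 1) = Some (0, 1)" "positive_part f s"
        "\<forall>i\<in>{1..r + 1}. last (s i) = (i, 1)" by (auto simp: A1_def T1_map_def)
      then have "(f, s) \<in> ?X2" using \<open>1 \<in> {1..r + 1}\<close> by (simp add: common_def)
      then show "f \<in> fst ` ?X2" by force
    qed
  qed
  ultimately show ?thesis
    using matched_trans[OF A0_states matched_trans[OF _ matched_trans[OF states_inv_pos_full
        matched_trans[OF _ matched_image[of fst ?X2 W]]]]] by simp
qed

end

section \<open>Functions without a path from the image of \<open>(-1, 1)\<close> to \<open>(1, 1)\<close>\<close>

text \<open>The edges of a path end in the tail of the list, so an injective change of values that
  fixes the tail neither creates nor destroys any of them.\<close>

lemma fpath_map_option_fixed: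
  assumes "inj \<tau>" "\<forall>y\<in>set (tl xs). \<tau> y = y"
  shows "fpath (map_option \<tau> \<circ> f) xs \<longleftrightarrow> fpath f xs"
  using assms(2)
proof (induction xs)
  case (Cons x xs)
  show ?case
  proof (cases xs)
    case (Cons y ys)
    then have "\<tau> y = y" "\<forall>y\<in>set (tl xs). \<tau> y = y" using Cons.prems by auto
    moreover have "map_option \<tau> (f x) = Some y \<longleftrightarrow> f x = Some y"
    proof (cases "f x")
      case (Some z)
      have "\<tau> z = y \<longleftrightarrow> z = y" using inj_eq[OF assms(1), of z y] \<open>\<tau> y = y\<close> by simp
      then show ?thesis using Some by simp
    qed simp
    ultimately show ?thesis using Cons.IH Cons by (simp add: fpath_Cons)
  qed simp
qed simp

definition leads :: "('a \<rightharpoonup> 'a) \<Rightarrow> 'a \<Rightarrow> 'a \<Rightarrow> bool" where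
  "leads f x y \<longleftrightarrow> (\<exists>xs. fpath f xs \<and> xs \<noteq> [] \<and> hd xs = x \<and> last xs = y)"

context profile
begin

abbreviation downs :: "int list" where "downs \<equiv> [l..0]"

abbreviation bases :: "int list \<Rightarrow> vertex list" where "bases \<equiv> map (\<lambda>i. (i, 1))"

lemma T1_map_cong: "restr D f = restr D f' \<Longrightarrow> T1_map f = T1_map f'"
  by (simp add: T1_map_def positive_part_def)

lemma restr_D_cong:
  assumes "\<And>x. 1 \<le> fst x \<Longrightarrow> f x = f' x" shows "restr D f = restr D f'"
  using assms by (auto simp: restr_def D_def fun_eq_iff)

text \<open>The exchanged values lie outside \<open>D\<close>, so edges into them are absent from
  \<open>restr D f\<close> before and after.\<close>

lemma restr_D_map_transpose:
  assumes "fst a \<le> 0" "fst b \<le> 0"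
  shows "restr D (map_option (transpose a b) \<circ> f) = restr D f"
proof
  fix x
  show "restr D (map_option (transpose a b) \<circ> f) x = restr D f x"
    using assms by (cases "f x") (auto simp: restr_def D_def transpose_def)
qed

lemma level_0: "w \<in> level V 0 \<longleftrightarrow> w \<in> W \<and> fst w = 0"
  using r by (auto simp: level_def in_V_iff)

text \<open>The exchange concerns the edges into \<open>(0, 1)\<close> and \<open>w\<close>: it
  sends \<open>(-1, 1)\<close> to \<open>(0, 1)\<close> and in return \<open>(1, 1)\<close> to
  \<open>w\<close>.\<close>

definition swap0 :: "vertex \<Rightarrow> (vertex \<rightharpoonup> vertex) \<Rightarrow> vertex \<rightharpoonup> vertex" where
  "swap0 w f = map_option (transpose (0, 1) w) \<circ> f"

lemma swap0_swap0: "swap0 w (swap0 w f) = f"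
  by (simp add: swap0_def fun_eq_iff option.map_comp option.map_id)

lemma swap0:
  assumes "w \<in> level V 0"
  shows "similar W f (swap0 w f)" "T1_map (swap0 w f) = T1_map f"
proof -
  have "(0, 1) \<in> W" using base_in_W[of 0] l r by simp
  then show "similar W f (swap0 w f)" using assms
    unfolding swap0_def by (intro similar_map level_perm_transpose) (auto simp: level_0)
  show "T1_map (swap0 w f) = T1_map f"
    unfolding swap0_def by (rule T1_map_cong, rule restr_D_map_transpose) (use assms in \<open>auto simp: level_0\<close>)
qed

text \<open>A path from \<open>w\<close> to \<open>(1, 1)\<close> is complete after appending \<open>(0, 1)\<close>, so its inner edges do not end in
  \<open>w\<close> or \<open>(0, 1)\<close> and are not affected by the exchange.\<close>

lemma leads_iff_cyclic_swap0:
  assumes "f (0, 1) = None" "f (1, 1) = Some (0, 1)"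
  shows "leads f w (1, 1) \<longleftrightarrow> (1, 1) \<in> cyclic_points (swap0 w f)"
proof
  assume "leads f w (1, 1)"
  then obtain xs where xs: "fpath f xs" "xs \<noteq> []" "hd xs = w" "last xs = (1, 1)" by (auto simp: leads_def)
  have "full_path f (xs @ [(0, 1)])" using xs assms by (auto simp: full_path_def fpath_append)
  then have d: "distinct (xs @ [(0, 1)])" by (rule full_path_distinct)
  have "\<forall>y\<in>set (tl xs). transpose (0, 1) w y = y"
    using d xs(2,3) by (cases xs) (auto simp: transpose_def)
  then have "fpath (swap0 w f) xs" unfolding swap0_def using xs(1) fpath_map_option_fixed by (metis inj_transpose)
  then have "fcycle (swap0 w f) xs" using xs d assms by (auto simp: fcycle_def swap0_def)
  then show "(1, 1) \<in> cyclic_points (swap0 w f)" using xs(2,4) last_in_set[of xs] unfolding cyclic_points_def by auto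
next
  assume "(1, 1) \<in> cyclic_points (swap0 w f)"
  then obtain c where c: "fcycle (swap0 w f) c" "(1, 1) \<in> set c" by (auto simp: cyclic_points_def)
  obtain d where d: "fcycle (swap0 w f) d" "last d = (1, 1)" using fcycle_rotate[OF c] by metis
  have "(0, 1) \<notin> set d" using fcycle_defined[OF d(1), of "(0, 1)"] assms(1) by (auto simp: swap0_def)
  moreover have hd: "hd d = w" "d \<noteq> []" "distinct d" "fpath (swap0 w f) d"
    using d assms(2) by (auto simp: fcycle_def swap0_def)
  ultimately have "\<forall>y\<in>set (tl d). transpose (0, 1) w y = y"
    by (cases d) (auto simp: transpose_def)
  then have "fpath f d" using hd(4) unfolding swap0_def using fpath_map_option_fixed by (metis inj_transpose)
  then show "leads f w (1, 1)" using hd d(2) by (auto simp: leads_def)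
qed

definition A1_I :: "(vertex \<rightharpoonup> vertex) set" where
  "A1_I = {f \<in> A1. \<not> leads f (the (f (-1, 1))) (1, 1)}"

definition B1 :: "(vertex \<rightharpoonup> vertex) set" where
  "B1 = {f. Fun f \<and> full_path f (bases downs) \<and> f (1, 1) \<in> Some ` level V 0 \<and> T1_map f \<and>
     (1, 1) \<notin> cyclic_points f}"

lemma downs_snoc: "downs = [l..-1] @ [0]"
  using l upto_rec2[of l 0] by simp

lemma full_path_bases_downs:
  "full_path f (bases downs) \<longleftrightarrow> fpath f (bases [l..-1]) \<and> f (-1, 1) = Some (0, 1) \<and> f (0, 1) = None"
proof -
  have "[l..-1] \<noteq> []" "last (bases [l..-1]) = (-1, 1)" using l upto_rec2[of l "-1"] by auto
  then show ?thesis unfolding downs_snoc by (auto simp: full_path_def fpath_append)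
qed

lemma swap0_bases: "fpath (swap0 w f) (bases [l..-1]) = fpath f (bases [l..-1])" if "fst w = 0"
  unfolding swap0_def
proof (rule fpath_map_option_fixed)
  show "\<forall>y\<in>set (tl (bases [l..-1])). transpose (0, 1) w y = y"
  proof
    fix y assume "y \<in> set (tl (bases [l..-1]))"
    then have "y \<in> set (bases [l..-1])" by (cases "bases [l..-1]") auto
    then show "transpose (0, 1) w y = y" using that by (auto simp: transpose_def)
  qed
qed simp

lemma A1_I_B1: "matched W A1_I id B1 id"
\<comment> \<open>The vertex \<open>w\<close> is the image of \<open>(-1, 1)\<close> before the
  exchange and that of \<open>(1, 1)\<close> after it, so each direction reads it off the
  function.\<close>
proof (rule matchedI[where F = "\<lambda>f. swap0 (the (f (-1, 1))) f" and G = "\<lambda>f. swap0 (the (f (1, 1))) f"])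
  fix f assume f: "f \<in> A1_I"
  then obtain w where w: "f (-1, 1) = Some w" "w \<in> level V 0" by (auto simp: A1_I_def A1_def negative_part_def)
  have f': "Fun f" "negative_part f" "f (1, 1) = Some (0, 1)" "T1_map f" "\<not> leads f w (1, 1)"
    using f w by (auto simp: A1_I_def A1_def)
  have f0: "f (0, 1) = None" using f' by (simp add: negative_part_def)
  have w0: "fst w = 0" using w by (simp add: level_0)
  have s1: "swap0 w f (1, 1) = Some w" using f' by (simp add: swap0_def)
  have s2: "swap0 w f (-1, 1) = Some (0, 1)" "swap0 w f (0, 1) = None" using f0 w by (auto simp: swap0_def)
  have "swap0 w f \<in> B1"
    using Fun_similar[OF swap0(1)[OF w(2)] f'(1)] swap0(2)[OF w(2)] s1 s2 w(2) f'
      leads_iff_cyclic_swap0[OF f0 f'(3)] swap0_bases[OF w0]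
    unfolding B1_def mem_Collect_eq full_path_bases_downs negative_part_def by simp
  then show "swap0 (the (f (-1, 1))) f \<in> B1" using w by simp
  show "swap0 (the (swap0 (the (f (-1, 1))) f (1, 1))) (swap0 (the (f (-1, 1))) f) = f"
    using s1 w by (simp add: swap0_swap0)
  show "similar W (id f) (id (swap0 (the (f (-1, 1))) f))" using swap0(1)[OF w(2)] w by simp
next
  fix f assume f: "f \<in> B1"
  then obtain w where w: "f (1, 1) = Some w" "w \<in> level V 0" by (auto simp: B1_def)
  have f': "Fun f" "full_path f (bases downs)" "T1_map f" "(1, 1) \<notin> cyclic_points f"
    using f by (auto simp: B1_def)
  then have fb: "fpath f (bases [l..-1])" "f (-1, 1) = Some (0, 1)" "f (0, 1) = None"
    unfolding full_path_bases_downs by blast+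
  have w0: "fst w = 0" using w by (simp add: level_0)
  have s1: "swap0 w f (-1, 1) = Some w" using fb by (simp add: swap0_def)
  have s2: "swap0 w f (1, 1) = Some (0, 1)" "swap0 w f (0, 1) = None" using fb w by (auto simp: swap0_def)
  have "\<not> leads (swap0 w f) w (1, 1)"
    using leads_iff_cyclic_swap0[OF s2(2,1)] f'(4) by (simp add: swap0_swap0)
  then have "swap0 w f \<in> A1_I"
    using Fun_similar[OF swap0(1)[OF w(2)] f'(1)] swap0(2)[OF w(2)] s1 s2 w(2) f' fb swap0_bases[OF w0]
    by (simp add: A1_I_def A1_def negative_part_def)
  then show "swap0 (the (f (1, 1))) f \<in> A1_I" using w by simp
  show "swap0 (the (swap0 (the (f (1, 1))) f (-1, 1))) (swap0 (the (f (1, 1))) f) = f"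
    using s1 w by (simp add: swap0_swap0)
qed

text \<open>When no cycle is left, \<open>(1, 1)\<close> outside the \<open>core\<close> means that
  it is not on the path from \<open>(l, 1)\<close>; this becomes the first half of
  \<open>T2'\<close>.\<close>

definition inv_I :: "(vertex \<rightharpoonup> vertex) \<Rightarrow> (int \<Rightarrow> vertex list) \<Rightarrow> (int \<Rightarrow> vertex list) \<Rightarrow> bool" where
  "inv_I f s q \<longleftrightarrow> Fun f \<and> T1_map f \<and> f (1, 1) \<in> Some ` level V 0 \<and> q = (\<lambda>_. []) \<and>
     (1, 1) \<notin> core W downs f s q"

lemma comp_transpose_positive:
  fixes e v x :: vertex
  assumes "fst e \<le> 0" "fst v \<le> 0" "1 \<le> fst x" shows "(f \<circ> transpose e v) x = f x"
  using assms by (auto simp: transpose_def)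

lemma T1_map_comp_transpose:
  assumes "fst e \<le> 0" "fst v \<le> 0" shows "T1_map (f \<circ> transpose e v) = T1_map f"
  by (rule T1_map_cong, rule restr_D_cong, rule comp_transpose_positive[OF assms])

lemma foata_invariant_inv_I: "foata_invariant W downs inv_I"
  unfolding foata_invariant_def
proof (intro allI impI)
  fix f f' :: "vertex \<rightharpoonup> vertex" and s q s' :: "int \<Rightarrow> vertex list" and i c e v
  assume i: "i \<in> set downs" and ev: "fst e = i" "fst v = i" "e \<in> W" "v \<in> W"
    and f': "f' = f \<circ> transpose e v" and core: "core W downs f' s' q = core W downs f s q"
  have le: "fst e \<le> 0" "fst v \<le> 0" using i ev by auto
  have "Fun f' = Fun f" unfolding f' by (rule Fun_comp_transpose_iff) (use ev in auto)
  moreover have "T1_map f' = T1_map f" unfolding f' by (rule T1_map_comp_transpose[OF le])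
  moreover have "f' (1, 1) = f (1, 1)" unfolding f' by (rule comp_transpose_positive[OF le]) simp
  ultimately show "inv_I f s q = inv_I f' s' q" using core unfolding inv_I_def by simp
qed

lemma downs_low: "x \<in> W \<Longrightarrow> i \<in> set downs \<Longrightarrow> fst x < i \<Longrightarrow> fst x \<in> set downs"
  using fst_W by fastforce

lemma spine_initial: "spine ls (\<lambda>i. if i \<in> set ls then [(i, 1)] else []) (\<lambda>_. []) = bases ls"
  unfolding spine_no_links by (rule concat_singletons) (rule order_refl)

lemma bases_downs_W: "set (bases downs) \<subseteq> W"
  using base_in_W r by auto

lemma B1_states: "matched W B1 id (states W downs inv_I {}) fst"
proof (rule matchedI[where F = "\<lambda>f. (f, \<lambda>i. if i \<in> set downs then [(i, 1)] else [], \<lambda>_. [])" and G = fst])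
  fix f assume f: "f \<in> B1"
  then have "restr W f = f" using restr_W by (simp add: B1_def)
  moreover have "(1, 1) \<notin> set (bases downs)" by auto
  ultimately show "(f, \<lambda>i. if i \<in> set downs then [(i, 1)] else [], \<lambda>_. []) \<in> states W downs inv_I {}"
    using f bases_downs_W unfolding states_def state_initial_iff inv_I_def core_def B1_def
    by (simp add: spine_initial del: set_upto)
next
  fix y assume y: "y \<in> states W downs inv_I {}"
  then obtain f s q where fs: "y = (f, s, q)" "state W downs {} f s q" "inv_I f s q" by (auto simp: states_def)
  have s: "s = (\<lambda>i. if i \<in> set downs then [(i, 1)] else [])" using fs(2) unfolding state_initial_iff by blast
  have q: "q = (\<lambda>_. [])" and F: "Fun f" using fs(3) by (simp_all add: inv_I_def)
  show "(fst y, \<lambda>i. if i \<in> set downs then [(i, 1)] else [], \<lambda>_. []) = y" using fs s q by simp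
  have "full_path f (bases downs)"
    using fs(2) unfolding state_initial_iff q restr_W[OF F] s spine_initial by blast
  then show "fst y \<in> B1" using fs restr_W[OF F] by (simp add: B1_def inv_I_def core_def)
qed auto

text \<open>A cycle without vertices of abscissa at most 0 lies inside \<open>D\<close>, where
  \<open>T1_map\<close> leaves no cycle.\<close>

lemma acyclic_if_no_low_cycle:
  assumes "Fun f" "T1_map f" "\<forall>x\<in>cyclic_points f. fst x \<notin> set downs"
  shows "cyclic_points f = {}"
proof (rule ccontr)
  assume "\<not> ?thesis"
  then obtain c where c: "fcycle f c" by (auto simp: cyclic_points_def)
  have cD: "set c \<subseteq> D"
  proof
    fix x assume x: "x \<in> set c"
    then have "fst x \<notin> set downs" using assms(3) c by (auto simp: cyclic_points_def)
    moreover have "f x \<noteq> None" using fcycle_defined[OF c x] .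
    then have "x \<in> W" using Fun_in[OF assms(1)] by blast
    ultimately show "x \<in> D" using fst_W by (auto simp: D_def)
  qed
  have "f x = restr D f x" if x: "x \<in> set c" for x
  proof -
    obtain y where y: "f x = Some y" using fcycle_defined[OF c x] by blast
    then show ?thesis using cD x fcycle_closed[OF c x y] by (auto simp: restr_def)
  qed
  then have "fcycle (restr D f) c" using fcycle_cong[of c f "restr D f"] c by blast
  moreover have "c \<noteq> []" using c by (simp add: fcycle_def)
  ultimately have "hd c \<in> cyclic_points (restr D f)" using hd_in_set unfolding cyclic_points_def by blast
  then show False using assms(2) by (auto simp: T1_map_def positive_part_def)
qed

text \<open>The conditions \<open>T1\<close> and \<open>T2'\<close> expressed through the segments
  of the path from \<open>(l, 1)\<close>.\<close>

definition FinI :: "((vertex \<rightharpoonup> vertex) \<times> (int \<Rightarrow> vertex list)) set" where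
  "FinI = {(f, s). Fun f \<and> T1_map f \<and> f (1, 1) \<in> Some ` level V 0 \<and> cyclic_points f = {} \<and>
     full_path f (concat (map s downs)) \<and> set (concat (map s downs)) \<subseteq> W \<and>
     (\<forall>i\<in>{l..0}. s i \<noteq> [] \<and> hd (s i) = (i, 1) \<and> (\<forall>x\<in>set (s i). i \<le> fst x) \<and> fst (last (s i)) = i) \<and>
     (\<forall>i. i \<notin> {l..0} \<longrightarrow> s i = []) \<and> (1, 1) \<notin> set (concat (map s downs))}"

lemma states_inv_I_full:
  "matched W (states W downs inv_I {x \<in> W. fst x \<in> set downs \<and> x \<noteq> (fst x, 1)}) fst FinI fst"
    (is "matched W ?P fst ?Q fst")
proof (rule matchedI[where F = "\<lambda>(f, s, q). (f, s)" and G = "\<lambda>(f, s). (f, s, \<lambda>_. [])"])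
  have *: "(f, s, q) \<in> ?P \<longleftrightarrow> (f, s) \<in> ?Q \<and> q = (\<lambda>_. [])" for f s q
  proof
    assume A: "(f, s, q) \<in> ?P"
    then have P: "inv_I f s q" and q: "q = (\<lambda>_. [])" and F: "Fun f" and T: "T1_map f"
      by (auto simp: inv_I_def states_def)
    have st: "full_path f (concat (map s downs)) \<and> set (concat (map s downs)) \<subseteq> W \<and>
     (\<forall>i\<in>set downs. s i \<noteq> [] \<and> hd (s i) = (i, 1) \<and> (\<forall>x\<in>set (s i). i \<le> fst x) \<and> fst (last (s i)) = i) \<and>
     (\<forall>i. i \<notin> set downs \<longrightarrow> s i = []) \<and> (\<forall>x\<in>cyclic_points f. fst x \<notin> set downs)"
      using A unfolding states_def mem_Collect_eq split_conv state_full_iff[OF refl] q spine_no_links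
        restr_W[OF F] by blast
    then have "cyclic_points f = {}" using acyclic_if_no_low_cycle[OF F T] by blast
    then show "(f, s) \<in> ?Q \<and> q = (\<lambda>_. [])" using P st
      unfolding FinI_def inv_I_def core_def q spine_no_links set_upto by simp
  next
    assume A: "(f, s) \<in> ?Q \<and> q = (\<lambda>_. [])"
    then have q: "q = (\<lambda>_. [])" and F: "Fun f" by (auto simp: FinI_def)
    show "(f, s, q) \<in> ?P"
      unfolding states_def mem_Collect_eq split_conv state_full_iff[OF refl] q inv_I_def core_def spine_no_links
        restr_W[OF F]
      using A unfolding set_upto by (simp add: FinI_def)
  qed
  {
    fix x assume x: "x \<in> ?P"
    obtain f s q where fsq: "x = (f, s, q)" by (metis prod_cases3)
    have "(f, s) \<in> ?Q \<and> q = (\<lambda>_. [])" using x unfolding fsq * .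
    then show "(case x of (f, s, q) \<Rightarrow> (f, s)) \<in> ?Q"
      "(case case x of (f, s, q) \<Rightarrow> (f, s) of (f, s) \<Rightarrow> (f, s, \<lambda>_. [])) = x"
      unfolding fsq by simp_all
  next
    fix y assume y: "y \<in> ?Q"
    obtain f s where fs: "y = (f, s)" by (metis prod.exhaust)
    have "(f, s, \<lambda>_. []) \<in> ?P" unfolding * using y fs by blast
    then show "(case y of (f, s) \<Rightarrow> (f, s, \<lambda>_. [])) \<in> ?P" unfolding fs by simp
  }
qed auto

lemma downs_Cons: "downs = l # [l + 1..0]"
  using l by (simp add: upto_rec1)

text \<open>The complete path from \<open>(l, 1)\<close> is determined by \<open>f\<close>, and the
  vertices \<open>(i, 1)\<close> mark the beginnings of its segments.\<close>

lemma inj_on_FinI: "inj_on fst FinI"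
proof (rule inj_onI)
  fix x y assume xy: "x \<in> FinI" "y \<in> FinI" "fst x = fst y"
  obtain f s s' where x: "x = (f, s)" "y = (f, s')" using xy(3) by (metis prod.collapse)
  have hd: "hd (concat (map t downs)) = (l, 1)" if "(f, t) \<in> FinI" for t
  proof -
    have "t l \<noteq> []" "hd (t l) = (l, 1)" using that l by (auto simp: FinI_def)
    then show ?thesis unfolding downs_Cons by simp
  qed
  have fp: "full_path f (concat (map s downs))" "full_path f (concat (map s' downs))"
    using xy x by (auto simp: FinI_def)
  then have eq: "concat (map s downs) = concat (map s' downs)"
    using full_path_unique hd xy x by metis
  have "s i = s' i" for i
  proof (cases "i \<in> {l..0}")
    case True
    then show ?thesis
      using xy x by (intro concat_blocks_hd_unique[OF eq full_path_distinct[OF fp(1)]]) (auto simp: FinI_def)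
  next
    case False
    then show ?thesis using xy x by (auto simp: FinI_def)
  qed
  then show "x = y" using x by auto
qed

lemma A1_I_FinI: "matched W A1_I id (fst ` FinI) id"
proof -
  have "matched W (states W downs inv_I {}) fst (states W downs inv_I {x \<in> W. fst x \<in> set downs \<and> x \<noteq> (fst x, 1)}) fst"
    by (rule foata[OF _ foata_invariant_inv_I _ finite_W downs_low]) auto
  then show ?thesis
    using matched_trans[OF A1_I_B1 matched_trans[OF B1_states matched_trans[OF _
          matched_trans[OF states_inv_I_full matched_image[OF inj_on_FinI]]]]] by simp
qed

end

section \<open>Functions with such a path\<close>

lemma append_last_unique:
  assumes "xs @ ys = xs' @ ys'" "distinct (xs @ ys)" "xs \<noteq> []" "xs' \<noteq> []" "last xs = last xs'"
  shows "xs = xs' \<and> ys = ys'"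
proof -
  consider us where "xs = xs' @ us" "us @ ys = ys'" | us where "xs @ us = xs'" "ys = us @ ys'"
    using assms(1) by (auto simp: append_eq_append_conv2)
  then show ?thesis
  proof cases
    case 1
    then have "distinct (xs' @ us)" using assms(2) by auto
    then show ?thesis using 1 assms distinct_append_last[of xs' us] by (cases "us = []") auto
  next
    case 2
    then have "distinct (xs @ us)" using assms(2) by auto
    then show ?thesis using 2 assms distinct_append_last[of xs us] by (cases "us = []") auto
  qed
qed

lemma append_hd_split_unique:
  assumes "xs @ ys = xs' @ ys'" "ys \<noteq> []" "ys' \<noteq> []" "P (hd ys)" "P (hd ys')"
    "\<And>y. y \<in> set xs \<Longrightarrow> \<not> P y" "\<And>y. y \<in> set xs' \<Longrightarrow> \<not> P y"
  shows "xs = xs' \<and> ys = ys'"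
proof -
  consider us where "xs = xs' @ us" "us @ ys = ys'" | us where "xs @ us = xs'" "ys = us @ ys'"
    using assms(1) by (auto simp: append_eq_append_conv2)
  then show ?thesis
  proof cases
    case 1
    then show ?thesis using assms(5)  assms(6)[of "hd us"] by (cases us) auto
  next
    case 2
    then show ?thesis using assms(4) assms(7)[of "hd us"] by (cases us) auto
  qed
qed

definition double_swap :: "'a \<Rightarrow> 'a \<Rightarrow> 'a \<Rightarrow> 'a \<Rightarrow> ('a \<Rightarrow> 'b) \<Rightarrow> 'a \<Rightarrow> 'b" where
  "double_swap u x y z f = f \<circ> transpose u x \<circ> transpose y z"

lemma double_swap_upd:
  assumes "distinct [u, x, y, z]"
  shows "double_swap u x y z f = f(u := f x, x := f u, y := f z, z := f y)"
proof
  fix t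
  show "double_swap u x y z f t = (f(u := f x, x := f u, y := f z, z := f y)) t"
    using assms by (auto simp: double_swap_def transpose_def)
qed

lemma double_swap_twice:
  assumes "distinct [u, x, y, z]" shows "double_swap u x y z (double_swap u x y z f) = f"
proof -
  have "double_swap u x y z (f(u := f x, x := f u, y := f z, z := f y)) = f"
    unfolding double_swap_upd[OF assms] using assms by (auto simp: fun_eq_iff)
  then show ?thesis unfolding double_swap_upd[OF assms] .
qed

text \<open>The reordering changes successors only at the ends of \<open>N\<close>,
  \<open>A\<close>, \<open>B\<close> and at \<open>z\<close>. The ends of \<open>N\<close> and
  \<open>B\<close> exchange the heads of \<open>A\<close> and \<open>C\<close>; the end of
  \<open>A\<close> and \<open>z\<close> exchange the head of \<open>B\<close> and the undefined
  value. In the application these pairs are at abscissas -1 and 0.\<close>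

lemma full_path_rearrange:
  assumes ds: "distinct (N @ A @ B @ C @ [z])" and ne: "N \<noteq> []" "A \<noteq> []" "B \<noteq> []" "C \<noteq> []"
    and g': "g' = double_swap (last N) (last B) (last A) z g"
  shows "distinct [last N, last B, last A, z]"
    and "full_path g (N @ A @ B @ C @ [z]) \<longleftrightarrow> full_path g' (N @ C @ [z] @ B @ A)"
proof -
  have mem: "last N \<in> set N" "last A \<in> set A" "last B \<in> set B" "last C \<in> set C" using ne by auto
  show d4: "distinct [last N, last B, last A, z]" using ds mem by (auto 4 4)
  note g'' = g'[unfolded double_swap_upd[OF d4]]
  have vals: "g' (last N) = g (last B)" "g' (last B) = g (last N)" "g' (last A) = g z" "g' z = g (last A)"
    using d4 by (auto simp: g'')
  have oth: "g' t = g t" if "t \<noteq> last N" "t \<noteq> last B" "t \<noteq> last A" "t \<noteq> z" for t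
    using that by (simp add: g'')
  have nb: "last X \<notin> set (butlast X)" if "distinct X" "X \<noteq> []" for X :: "'a list"
    using that by (rule last_notin_butlast)
  have "g t = g' t" if "t \<in> set (butlast N)" for t
  proof -
    have "t \<in> set N" "t \<noteq> last N" using that nb[of N] ds ne in_set_butlastD[OF that] by auto
    then show ?thesis using ds mem by (intro oth[symmetric]) (auto 4 4)
  qed
  then have "fpath g N = fpath g' N" by (rule fpath_cong)
  moreover have "g t = g' t" if "t \<in> set (butlast A)" for t
  proof -
    have "t \<in> set A" "t \<noteq> last A" using that nb[of A] ds ne in_set_butlastD[OF that] by auto
    then show ?thesis using ds mem by (intro oth[symmetric]) (auto 4 4)
  qed
  then have "fpath g A = fpath g' A" by (rule fpath_cong)
  moreover have "g t = g' t" if "t \<in> set (butlast B)" for t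
  proof -
    have "t \<in> set B" "t \<noteq> last B" using that nb[of B] ds ne in_set_butlastD[OF that] by auto
    then show ?thesis using ds mem by (intro oth[symmetric]) (auto 4 4)
  qed
  then have "fpath g B = fpath g' B" by (rule fpath_cong)
  moreover have C: "g t = g' t" if "t \<in> set C" for t
    using ds mem that by (intro oth[symmetric]) (auto 4 4)
  then have "fpath g C = fpath g' C" by (intro fpath_cong) (auto dest: in_set_butlastD)
  moreover have "g (last C) = g' (last C)" using C mem by blast
  ultimately show "full_path g (N @ A @ B @ C @ [z]) \<longleftrightarrow> full_path g' (N @ C @ [z] @ B @ A)"
    using ne vals by (auto simp: full_path_def fpath_append hd_append fpath_Cons)
qed

context profile
begin

text \<open>In the reordered path, \<open>q (-1)\<close> is the piece \<open>C\<close>, and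
  \<open>q 0\<close> consists of the pieces \<open>B\<close> and \<open>A\<close>. What is recorded
  is their shape, from which the cuts can be found again.\<close>

definition links :: "(int \<Rightarrow> vertex list) \<Rightarrow> bool" where
  "links q \<longleftrightarrow> (\<forall>i. i \<noteq> -1 \<and> i \<noteq> 0 \<longrightarrow> q i = []) \<and> q (-1) \<noteq> [] \<and> (\<forall>x\<in>set (q (-1)). 0 \<le> fst x) \<and>
     fst (hd (q (-1))) = 0 \<and> last (q (-1)) = (1, 1) \<and> (q 0 = [] \<or> fst (hd (q 0)) = -1)"

definition inv_II :: "(vertex \<rightharpoonup> vertex) \<Rightarrow> (int \<Rightarrow> vertex list) \<Rightarrow> (int \<Rightarrow> vertex list) \<Rightarrow> bool" where
  "inv_II f s q \<longleftrightarrow> Fun f \<and> T1_map f \<and> links q"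

lemma foata_invariant_inv_II: "foata_invariant W downs inv_II"
  unfolding foata_invariant_def
proof (intro allI impI)
  fix f f' :: "vertex \<rightharpoonup> vertex" and s q s' :: "int \<Rightarrow> vertex list" and i c e v
  assume i: "i \<in> set downs" and ev: "fst e = i" "fst v = i" "e \<in> W" "v \<in> W"
    and f': "f' = f \<circ> transpose e v"
  have le: "fst e \<le> 0" "fst v \<le> 0" using i ev by auto
  have "Fun f' = Fun f" unfolding f' by (rule Fun_comp_transpose_iff) (use ev in auto)
  moreover have "T1_map f' = T1_map f" unfolding f' by (rule T1_map_comp_transpose[OF le])
  ultimately show "inv_II f s q = inv_II f' s' q" unfolding inv_II_def by simp
qed

lemma spine_downs:
  assumes "\<forall>i. i \<noteq> -1 \<and> i \<noteq> 0 \<longrightarrow> q i = []"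
  shows "spine downs s q = concat (map s [l..-1]) @ q (-1) @ s 0 @ q 0"
proof -
  have "downs = [l..-2] @ [-1, 0]" "[l..-1] = [l..-2] @ [-1]"
    using l upto_rec2[of l 0] upto_rec2[of l "-1"] by auto
  moreover have "spine [l..-2] s q = concat (map s [l..-2])"
    unfolding spine_def using assms by (intro arg_cong[of _ _ concat]) auto
  ultimately show ?thesis by (simp add: spine_append spine_Cons) (simp add: spine_def)
qed

abbreviation N :: "vertex list" where "N \<equiv> bases [l..-1]"

lemma N: "N \<noteq> []" "last N = (-1, 1)" "hd N = (l, 1)"
proof -
  show "N \<noteq> []" "last N = (-1, 1)" using l upto_rec2[of l "-1"] by auto
  show "hd N = (l, 1)" using l by (simp add: upto_rec1)
qed

lemma full_path_in_W:
  assumes "Fun f" "full_path f xs" "hd xs \<in> W" shows "set xs \<subseteq> W"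
  using fpath_closed[of f xs W] assms Fun_in[OF assms(1)] Fun_V_W unfolding full_path_def by blast

definition s0 :: "int \<Rightarrow> vertex list" where "s0 = (\<lambda>i. if i \<in> set downs then [(i, 1)] else [])"

lemma spine_s0: "links q \<Longrightarrow> spine downs s0 q = N @ q (-1) @ [(0, 1)] @ q 0"
proof -
  assume "links q"
  moreover have "concat (map s0 [l..-1]) = N" unfolding s0_def by (rule concat_singletons) auto
  moreover have "s0 0 = [(0, 1)]" using l by (simp add: s0_def)
  ultimately show ?thesis using spine_downs[of q s0] by (simp add: links_def)
qed

definition A1_II :: "(vertex \<rightharpoonup> vertex) set" where
  "A1_II = {f \<in> A1. leads f (the (f (-1, 1))) (1, 1)}"

definition links_of :: "vertex list \<Rightarrow> vertex list \<Rightarrow> int \<Rightarrow> vertex list" where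
  "links_of C E i = (if i = -1 then C else if i = 0 then E else [])"

lemma links_links_of:
  "links (links_of C E) \<longleftrightarrow> C \<noteq> [] \<and> (\<forall>x\<in>set C. 0 \<le> fst x) \<and> fst (hd C) = 0 \<and> last C = (1, 1) \<and>
     (E = [] \<or> fst (hd E) = -1)"
  by (simp add: links_def links_of_def)

lemma links_of_links: "links q \<Longrightarrow> q = links_of (q (-1)) (q 0)"
  by (auto simp: links_def links_of_def fun_eq_iff)

text \<open>The pieces \<open>A\<close> and \<open>B\<close> are empty precisely when the path from the image of \<open>(-1, 1)\<close> to \<open>(1, 1)\<close>
  has no vertex of negative abscissa.\<close>

definition cut_II where
  "cut_II f A B C \<longleftrightarrow> C \<noteq> [] \<and> last C = (1, 1) \<and> (\<forall>x\<in>set C. 0 \<le> fst x) \<and> fst (hd C) = 0 \<and>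
     full_path f (N @ A @ B @ C @ [(0, 1)]) \<and> (A = [] \<longleftrightarrow> B = []) \<and>
     (A \<noteq> [] \<longrightarrow> (\<forall>x\<in>set A. 0 \<le> fst x) \<and> fst (hd A) = 0 \<and> fst (last A) = 0 \<and> fst (hd B) = -1 \<and> fst (last B) = -1)"

definition surgery :: "vertex list \<Rightarrow> vertex list \<Rightarrow> (vertex \<rightharpoonup> vertex) \<Rightarrow> vertex \<rightharpoonup> vertex" where
  "surgery A B f = (if A = [] then f else double_swap (-1, 1) (last B) (last A) (0, 1) f)"

text \<open>\<open>B\<close> reaches from the first to the last negative vertex on the path from the
  image of \<open>(-1, 1)\<close> to \<open>(1, 1)\<close>.\<close>

lemma A1_II_cut:
  assumes "Fun f" "T1_map f"
  shows "f \<in> A1_II \<longleftrightarrow> (\<exists>A B C. cut_II f A B C)"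
proof
  assume f: "f \<in> A1_II"
  then obtain w where w: "f (-1, 1) = Some w" "w \<in> level V 0" and ng: "negative_part f"
    by (auto simp: A1_II_def A1_def negative_part_def)
  then obtain ws where ws: "fpath f ws" "ws \<noteq> []" "hd ws = w" "last ws = (1, 1)"
    using f by (auto simp: A1_II_def leads_def)
  have "f (1, 1) = Some (0, 1)" using f by (simp add: A1_II_def A1_def)
  then have fp: "full_path f (N @ ws @ [(0, 1)])"
    using ws ng N w unfolding full_path_def negative_part_def by (simp add: fpath_append)
  have w0: "fst (hd ws) = 0" using w ws by (simp add: level_0)
  show "\<exists>A B C. cut_II f A B C"
  proof (cases "\<forall>x\<in>set ws. 0 \<le> fst x")
    case True
    then have "cut_II f [] [] ws" using fp ws w0 by (simp add: cut_II_def)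
    then show ?thesis by blast
  next
    case False
    then have "\<exists>x\<in>set ws. fst x < 0" using not_le by blast
    then obtain A b rest where A: "ws = A @ b # rest" "fst b < 0" "\<forall>x\<in>set A. \<not> fst x < 0"
      using split_list_first_prop[of ws "\<lambda>x. fst x < 0"] by blast
    have "\<exists>x\<in>set (b # rest). fst x < 0" using A by auto
    then obtain B0 b' C where B: "b # rest = B0 @ b' # C" "fst b' < 0" "\<forall>x\<in>set C. \<not> fst x < 0"
      using split_list_last_prop[of "b # rest" "\<lambda>x. fst x < 0"] by blast
    define B where "B = B0 @ [b']"
    have ws': "ws = A @ B @ C" using A B by (simp add: B_def)
    have An: "A \<noteq> []" using A w0 by auto
    have Cn: "C \<noteq> []" using ws' ws(4) B(2) by (auto simp: B_def)
    have Bn: "B \<noteq> []" "last B = b'" by (auto simp: B_def)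
    have hB: "hd B = b" using B(1) by (cases B0) (auto simp: B_def)
    have st: "f (last A) = Some b" "f b' = Some (hd C)"
      using ws(1) An Bn Cn hB unfolding ws' by (auto simp: fpath_append)
    have "fst (last A) \<ge> 0" using A(3) An by (meson last_in_set not_less)
    \<comment> \<open>A step of size at most 1 from a nonnegative to a negative abscissa leads from
      0 to -1.\<close>
    then have l1: "fst b = -1" "fst (last A) = 0" using Fun_step[OF assms(1) st(1)] A(2) by auto
    have "fst (hd C) \<ge> 0" using B(3) Cn by (meson hd_in_set not_less)
    then have l2: "fst b' = -1" "fst (hd C) = 0" using Fun_step[OF assms(1) st(2)] B(2) by auto
    have "hd A = w" using An ws(3) ws' by simp
    moreover have "last C = (1, 1)" using ws(4) ws' Cn by simp
    ultimately have "cut_II f A B C"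
      using fp An Bn Cn hB l1 l2 w A(3) B(3) unfolding cut_II_def ws' by (auto simp: level_0 not_less)
    then show ?thesis by blast
  qed
next
  assume "\<exists>A B C. cut_II f A B C"
  then obtain A B C where c: "cut_II f A B C" by blast
  define ws where "ws = A @ B @ C"
  have ws: "ws \<noteq> []" "last ws = (1, 1)" "fst (hd ws) = 0" "full_path f (N @ ws @ [(0, 1)])"
    using c by (auto simp: cut_II_def ws_def)
  then have fp: "fpath f N" "f (-1, 1) = Some (hd ws)" "fpath f ws" "f (1, 1) = Some (0, 1)" "f (0, 1) = None"
    using N unfolding full_path_def by (auto simp: fpath_append)
  moreover have "hd ws \<in> level V 0" using Fun_in[OF assms(1) fp(2)] ws(3) by (simp add: level_def)
  ultimately have "negative_part f" unfolding negative_part_def by auto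
  moreover have "leads f (hd ws) (1, 1)" using fp ws unfolding leads_def by blast
  ultimately show "f \<in> A1_II" using assms fp by (simp add: A1_II_def A1_def)
qed

text \<open>Behind \<open>N\<close>, the first and the last negative vertex determine the
  cuts.\<close>

lemma cut_II_unique:
  assumes "cut_II f A B C" "cut_II f A' B' C'"
  shows "A = A' \<and> B = B' \<and> C = C'"
proof -
  have "N @ A @ B @ C @ [(0, 1)] = N @ A' @ B' @ C' @ [(0, 1)]"
    using assms N unfolding cut_II_def by (intro full_path_unique[of f]) auto
  then have eq: "(A @ B) @ C = (A' @ B') @ C'" by simp
  have neg: "last B \<in> set B" "fst (last B) = -1" if "cut_II f A B C" "A \<noteq> []" for A B C
    using that by (auto simp: cut_II_def)
  have pos: "\<forall>x\<in>set C. 0 \<le> fst x" if "cut_II f A B C" for A B C using that by (simp add: cut_II_def)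
  have iff: "A = [] \<longleftrightarrow> A' = []"
  proof -
    have "A' = []" if "cut_II f A B C" "cut_II f A' B' C'" "A = []" "(A @ B) @ C = (A' @ B') @ C'" for A B C A' B' C'
    proof (rule ccontr)
      assume "A' \<noteq> []"
      then have "last B' \<in> set C" using neg[OF that(2)] that by (auto simp: cut_II_def)
      then show False using pos[OF that(1)] neg[OF that(2) \<open>A' \<noteq> []\<close>] by fastforce
    qed
    then show ?thesis using assms eq by metis
  qed
  show ?thesis
  proof (cases "A = []")
    case True
    then show ?thesis using iff assms eq by (auto simp: cut_II_def)
  next
    case False
    then have ne: "A \<noteq> []" "A' \<noteq> []" "B \<noteq> []" "B' \<noteq> []" using iff assms by (auto simp: cut_II_def)
    have "A @ B = A' @ B' \<and> C = C'"
      using eq ne neg[OF assms(1)] neg[OF assms(2)] pos[OF assms(1)] pos[OF assms(2)]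
      by (intro append_split_unique[of _ _ _ _ "\<lambda>x. fst x < 0"]) (auto simp: not_less)
    moreover have "A = A' \<and> B = B'"
      using calculation ne assms
      by (intro append_hd_split_unique[of A B A' B' "\<lambda>x. fst x < 0"]) (auto simp: cut_II_def not_less)
    ultimately show ?thesis by blast
  qed
qed

lemma cut_II_surgery:
  assumes F: "Fun f" and c: "cut_II f A B C"
  shows "full_path (surgery A B f) (N @ C @ [(0, 1)] @ B @ A)" "Fun (surgery A B f)"
    "T1_map (surgery A B f) = T1_map f" "similar W f (surgery A B f)" "surgery A B (surgery A B f) = f"
    "links (links_of C (B @ A))"
proof -
  have fp: "full_path f (N @ A @ B @ C @ [(0, 1)])" using c by (simp add: cut_II_def)
  have ne: "C \<noteq> []" "A \<noteq> [] \<Longrightarrow> B \<noteq> []" using c by (auto simp: cut_II_def)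
  have "(l, 1) \<in> W" using base_in_W l r by simp
  then have inW: "set (N @ A @ B @ C @ [(0, 1)]) \<subseteq> W"
    using N by (intro full_path_in_W[OF F fp]) simp
  show "links (links_of C (B @ A))" using c by (cases "A = []") (auto simp: links_links_of cut_II_def)
  have "full_path (surgery A B f) (N @ C @ [(0, 1)] @ B @ A) \<and> Fun (surgery A B f) \<and>
    T1_map (surgery A B f) = T1_map f \<and> similar W f (surgery A B f) \<and> surgery A B (surgery A B f) = f"
  proof (cases "A = []")
    case True
    then show ?thesis using fp F c by (auto simp: surgery_def cut_II_def)
  next
    case False
    then have B: "B \<noteq> []" and lev: "fst (last A) = 0" "fst (last B) = -1" using c by (auto simp: cut_II_def)
    define g where "g = double_swap (last N) (last B) (last A) (0, 1) f"
    have g: "surgery A B f' = double_swap (last N) (last B) (last A) (0, 1) f'" for f'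
      unfolding surgery_def N(2) using False by simp
    note re = full_path_rearrange[OF full_path_distinct[OF fp] N(1) False B ne(1) g_def]
    have mem: "last A \<in> W" "last B \<in> W" "(0, 1) \<in> W" "(-1, 1) \<in> W"
      using inW False B N(1,2) last_in_set[of A] last_in_set[of B] last_in_set[of N] by auto
    have lp: "level_perm W (transpose (-1, 1) (last B))" "level_perm W (transpose (last A) (0, 1))"
      using mem lev by (auto intro!: level_perm_transpose)
    have "similar W f g" unfolding g_def double_swap_def N(2)
      using similar_trans[OF similar_comp[OF lp(1)] similar_comp[OF lp(2)]] .
    moreover have "T1_map g = T1_map f" unfolding g_def double_swap_def N(2)
      using lev by (simp add: T1_map_comp_transpose)
    ultimately show ?thesis
      using re fp Fun_similar[of f g] F double_swap_twice[OF re(1)] unfolding g g_def[symmetric]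
      unfolding g_def by blast
  qed
  then show "full_path (surgery A B f) (N @ C @ [(0, 1)] @ B @ A)" "Fun (surgery A B f)"
    "T1_map (surgery A B f) = T1_map f" "similar W f (surgery A B f)" "surgery A B (surgery A B f) = f"
    by blast+
qed

lemma surgery_cut_II:
  assumes F: "Fun f" and q: "links q" and fp: "full_path f (N @ q (-1) @ [(0, 1)] @ q 0)"
  obtains A B where "cut_II (surgery A B f) A B (q (-1))" "q 0 = B @ A" "Fun (surgery A B f)"
    "T1_map (surgery A B f) = T1_map f" "surgery A B (surgery A B f) = f"
proof (cases "q 0 = []")
  case True
  have "cut_II (surgery [] [] f) [] [] (q (-1))"
    using q fp True by (auto simp: cut_II_def surgery_def links_def)
  then show thesis using that[of "[]" "[]"] True F by (simp add: surgery_def)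
next
  case False
  define C where "C = q (-1)"
  have C: "C \<noteq> []" "last C = (1, 1)" "\<forall>x\<in>set C. 0 \<le> fst x" "fst (hd C) = 0" and h: "fst (hd (q 0)) = -1"
    using q False by (auto simp: links_def C_def)
  have "(l, 1) \<in> W" using base_in_W l r by simp
  then have inW: "set (N @ C @ [(0, 1)] @ q 0) \<subseteq> W"
    using N fp by (intro full_path_in_W[OF F]) (auto simp: C_def)
  have "last (q 0) \<in> W" using inW False by auto
  moreover have "f (last (q 0)) = None" using fp False by (simp add: full_path_def)
  ultimately have l0: "fst (last (q 0)) = 0" using Fun_None[OF F] by blast
  have "\<exists>x\<in>set (q 0). fst x < 0" using h False by (metis hd_in_set neg_less_0_iff_less zero_less_one)
  then obtain B0 b' A where B0: "q 0 = B0 @ b' # A" "fst b' < 0" "\<forall>x\<in>set A. \<not> fst x < 0"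
    using split_list_last_prop[of "q 0" "\<lambda>x. fst x < 0"] by blast
  define B where "B = B0 @ [b']"
  have BA: "q 0 = B @ A" and Bn: "B \<noteq> []" and lB: "last B = b'" using B0 by (auto simp: B_def)
  have An: "A \<noteq> []" using B0 l0 by auto
  have "fpath f (q 0)" using fp by (auto simp: full_path_def fpath_append fpath_Cons)
  then have st: "f b' = Some (hd A)" using An Bn lB unfolding BA by (auto simp: fpath_append)
  have "fst (hd A) \<ge> 0" using B0(3) An by (meson hd_in_set not_less)
  then have lev: "fst b' = -1" "fst (hd A) = 0" using Fun_step[OF F st] B0(2) by auto
  have lA: "fst (last A) = 0" "fst (hd B) = -1" using l0 h An Bn BA by auto
  define g where "g = surgery A B f"
  have g: "g = double_swap (last N) (last B) (last A) (0, 1) f" unfolding g_def surgery_def N(2) using An by simp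
  have "distinct (N @ C @ [(0, 1)] @ B @ A)" using full_path_distinct[OF fp] by (simp add: C_def BA)
  then have ds: "distinct (N @ A @ B @ C @ [(0, 1)])" by auto
  note re0 = full_path_rearrange(1)[OF ds N(1) An Bn C(1) refl]
  have gg: "f = double_swap (last N) (last B) (last A) (0, 1) g"
    unfolding g by (rule double_swap_twice[OF re0, symmetric])
  have fpg: "full_path g (N @ A @ B @ C @ [(0, 1)])"
    using full_path_rearrange(2)[OF ds N(1) An Bn C(1) gg] fp by (simp add: C_def BA)
  have mem: "last A \<in> W" "last B \<in> W" "(0, 1) \<in> W" "(-1, 1) \<in> W"
    using inW An Bn N(1,2) last_in_set[of A] last_in_set[of B] last_in_set[of N] by (auto simp: BA)
  have "Fun g" unfolding g double_swap_def N(2)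
    using F mem lev lA lB by (simp add: Fun_comp_transpose_iff)
  moreover have "T1_map g = T1_map f" unfolding g double_swap_def N(2)
    using lev lA lB by (simp add: T1_map_comp_transpose)
  moreover have "cut_II g A B C"
    using fpg C An Bn lev lA lB B0(3) by (simp add: cut_II_def not_less)
  moreover have "surgery A B g = f" using gg An unfolding surgery_def N(2) by simp
  ultimately show thesis using that[of A B] BA unfolding g_def C_def by blast
qed

lemma A1_II_states: "matched W A1_II id (states W downs inv_II {}) fst"
proof (rule matched_relI[where R = "\<lambda>f y. \<exists>A B C. cut_II f A B C \<and> y = (surgery A B f, s0, links_of C (B @ A))"])
  have st: "(f, s, q) \<in> states W downs inv_II {} \<longleftrightarrow> s = s0 \<and> inv_II f s q \<and> full_path f (N @ q (-1) @ [(0, 1)] @ q 0)" for f s q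
  proof
    assume "(f, s, q) \<in> states W downs inv_II {}"
    then have *: "inv_II f s q" "s = s0" "full_path (restr W f) (spine downs s q)"
      unfolding states_def mem_Collect_eq split_conv state_initial_iff s0_def by blast+
    then have "Fun f" "links q" by (auto simp: inv_II_def)
    then show "s = s0 \<and> inv_II f s q \<and> full_path f (N @ q (-1) @ [(0, 1)] @ q 0)"
      using * restr_W spine_s0 by metis
  next
    assume A: "s = s0 \<and> inv_II f s q \<and> full_path f (N @ q (-1) @ [(0, 1)] @ q 0)"
    then have F: "Fun f" "links q" by (auto simp: inv_II_def)
    have "(l, 1) \<in> W" using base_in_W l r by simp
    then have "set (N @ q (-1) @ [(0, 1)] @ q 0) \<subseteq> W"
      using N A by (intro full_path_in_W[OF F(1)]) auto
    then show "(f, s, q) \<in> states W downs inv_II {}"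
      unfolding states_def mem_Collect_eq split_conv state_initial_iff s0_def[symmetric]
      using A restr_W[OF F(1)] spine_s0[OF F(2)] by (simp add: inv_II_def)
  qed
  have AF: "Fun f \<and> T1_map f" if "f \<in> A1_II" for f using that by (simp add: A1_II_def A1_def)
  {
    fix f assume f: "f \<in> A1_II"
    then obtain A B C where c: "cut_II f A B C" using A1_II_cut AF by blast
    note cs = cut_II_surgery[OF _ c]
    have "(surgery A B f, s0, links_of C (B @ A)) \<in> states W downs inv_II {}"
      unfolding st inv_II_def using cs AF[OF f] by (simp add: links_of_def)
    then show "\<exists>y\<in>states W downs inv_II {}. \<exists>A B C. cut_II f A B C \<and> y = (surgery A B f, s0, links_of C (B @ A))"
      using c by blast
  next
    fix y assume y: "y \<in> states W downs inv_II {}"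
    obtain f s q where fsq: "y = (f, s, q)" by (metis prod_cases3)
    then have *: "s = s0" "Fun f" "T1_map f" "links q" "full_path f (N @ q (-1) @ [(0, 1)] @ q 0)"
      using y st[of f s q] by (auto simp: inv_II_def)
    obtain A B where AB: "cut_II (surgery A B f) A B (q (-1))" "q 0 = B @ A" "Fun (surgery A B f)"
      "T1_map (surgery A B f) = T1_map f" "surgery A B (surgery A B f) = f"
      using surgery_cut_II[OF *(2,4,5)] by metis
    have "surgery A B f \<in> A1_II" using A1_II_cut AB *(3) by blast
    moreover have "y = (surgery A B (surgery A B f), s0, links_of (q (-1)) (B @ A))"
      using AB fsq *(1) links_of_links[OF *(4)] by simp
    ultimately show "\<exists>x\<in>A1_II. \<exists>A B C. cut_II x A B C \<and> y = (surgery A B x, s0, links_of C (B @ A))"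
      using AB(1) by blast
  next
    fix f y y'
    assume "\<exists>A B C. cut_II f A B C \<and> y = (surgery A B f, s0, links_of C (B @ A))"
      "\<exists>A B C. cut_II f A B C \<and> y' = (surgery A B f, s0, links_of C (B @ A))"
    then show "y = y'" using cut_II_unique by blast
  next
    fix f f' y assume f: "f \<in> A1_II" "f' \<in> A1_II"
      "\<exists>A B C. cut_II f A B C \<and> y = (surgery A B f, s0, links_of C (B @ A))"
      "\<exists>A B C. cut_II f' A B C \<and> y = (surgery A B f', s0, links_of C (B @ A))"
    then obtain A B C A' B' C' where c: "cut_II f A B C" "cut_II f' A' B' C'"
      "y = (surgery A B f, s0, links_of C (B @ A))" "y = (surgery A' B' f', s0, links_of C' (B' @ A'))" by blast
    then have "links_of C (B @ A) 0 = links_of C' (B' @ A') 0" "surgery A B f = surgery A' B' f'" by auto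
    then have BA: "B @ A = B' @ A'" by (simp add: links_of_def)
    \<comment> \<open>\<open>B\<close> is the part of \<open>B @ A\<close> up to the last negative
      vertex.\<close>
    have "A = A' \<and> B = B'"
    proof (cases "B @ A = []")
      case True
      then show ?thesis using BA by simp
    next
      case False
      then have ne: "A \<noteq> []" "B \<noteq> []" "A' \<noteq> []" "B' \<noteq> []" using BA c(1,2) by (auto simp: cut_II_def)
      then have "B = B' \<and> A = A'" using BA c(1,2)
        by (intro append_split_unique[of B A B' A' "\<lambda>x. fst x < 0"]) (auto simp: cut_II_def not_less)
      then show ?thesis by blast
    qed
    then show "f = f'" using cut_II_surgery(5)[OF _ c(1)] cut_II_surgery(5)[OF _ c(2)] AF f(1,2)
        \<open>surgery A B f = surgery A' B' f'\<close> by metis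
  next
    fix f y assume "f \<in> A1_II" "\<exists>A B C. cut_II f A B C \<and> y = (surgery A B f, s0, links_of C (B @ A))"
    then show "similar W (id f) (fst y)" using cut_II_surgery(4) AF by fastforce
  }
qed

text \<open>The ends of segment 0 are restricted by their abscissa only, so that they can be
  interchanged.\<close>

definition pre_II :: "(vertex \<rightharpoonup> vertex) \<Rightarrow> (int \<Rightarrow> vertex list) \<Rightarrow> (int \<Rightarrow> vertex list) \<Rightarrow> bool" where
  "pre_II f s q \<longleftrightarrow> Fun f \<and> T1_map f \<and> links q \<and> cyclic_points f = {} \<and>
     full_path f (spine downs s q) \<and> set (spine downs s q) \<subseteq> W \<and>
     (\<forall>i\<in>{l..0}. s i \<noteq> [] \<and> (\<forall>x\<in>set (s i). i \<le> fst x) \<and> fst (hd (s i)) = i \<and> fst (last (s i)) = i) \<and>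
     (\<forall>i. i \<notin> {l..0} \<longrightarrow> s i = []) \<and> (\<forall>i\<in>{l..-1}. hd (s i) = (i, 1))"

lemma states_inv_II_full:
  "states W downs inv_II {x \<in> W. fst x \<in> set downs \<and> x \<noteq> (fst x, 1)} = {(f, s, q). pre_II f s q \<and> hd (s 0) = (0, 1)}"
    (is "?P = ?Q")
proof -
  have "(f, s, q) \<in> ?P \<longleftrightarrow> (f, s, q) \<in> ?Q" for f s q
  proof
    assume A: "(f, s, q) \<in> ?P"
    then have F: "Fun f" and T: "T1_map f" and q: "links q" by (auto simp: inv_II_def states_def)
    have st: "full_path f (spine downs s q) \<and> set (spine downs s q) \<subseteq> W \<and>
     (\<forall>i\<in>set downs. s i \<noteq> [] \<and> hd (s i) = (i, 1) \<and> (\<forall>x\<in>set (s i). i \<le> fst x) \<and> fst (last (s i)) = i) \<and>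
     (\<forall>i. i \<notin> set downs \<longrightarrow> s i = []) \<and> (\<forall>x\<in>cyclic_points f. fst x \<notin> set downs)"
      using A unfolding states_def mem_Collect_eq split_conv state_full_iff[OF refl] restr_W[OF F] by blast
    then have "cyclic_points f = {}" using acyclic_if_no_low_cycle[OF F T] by blast
    then show "(f, s, q) \<in> ?Q" using F T q st l unfolding pre_II_def set_upto by auto
  next
    assume A: "(f, s, q) \<in> ?Q"
    then have F: "Fun f" "T1_map f" "links q" by (auto simp: pre_II_def)
    have "hd (s i) = (i, 1)" if "i \<in> {l..0}" for i
      using A that by (cases "i = 0") (auto simp: pre_II_def)
    then show "(f, s, q) \<in> ?P"
      unfolding states_def mem_Collect_eq split_conv state_full_iff[OF refl] restr_W[OF F(1)] inv_II_def
      using A F unfolding set_upto by (simp add: pre_II_def)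
  qed
  then show ?thesis by auto
qed

text \<open>\<open>T2''\<close> speaks of the first visit to abscissa -1 behind segment 0, or of the
  root, and thus prescribes the end of segment 0; insertion has left \<open>(0, 1)\<close> at its
  beginning.\<close>

lemma pre_II_flip:
  assumes pre: "pre_II f s q"
  defines "\<kappa> \<equiv> flip {0} s"
  shows "pre_II (conj_map \<kappa> f) (\<lambda>i. map \<kappa> (s i)) (\<lambda>i. map \<kappa> (q i))"
    and "conj_map (flip {0} (\<lambda>i. map \<kappa> (s i))) (conj_map \<kappa> f) = f"
    and "(\<lambda>i. map (flip {0} (\<lambda>i. map \<kappa> (s i))) (map \<kappa> (s i))) = s"
    and "(\<lambda>i. map (flip {0} (\<lambda>i. map \<kappa> (s i))) (map \<kappa> (q i))) = q"
    and "similar W f (conj_map \<kappa> f)"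
    and "hd (map \<kappa> (s 0)) = last (s 0) \<and> last (map \<kappa> (s 0)) = hd (s 0)"
proof -
  have 0: "0 \<in> {l..0}" using l by simp
  have sW: "s j \<noteq> [] \<and> fst (hd (s j)) = j \<and> fst (last (s j)) = j \<and> set (s j) \<subseteq> W" if "j \<in> {0}" for j
  proof -
    have "set (s 0) \<subseteq> set (spine downs s q)" using 0 by (auto simp: spine_def)
    then have "set (s 0) \<subseteq> W" using pre unfolding pre_II_def by blast
    moreover have "s 0 \<noteq> [] \<and> fst (hd (s 0)) = 0 \<and> fst (last (s 0)) = 0" using pre 0 unfolding pre_II_def by blast
    ultimately show ?thesis using that by simp
  qed
  have inv: "\<kappa> (\<kappa> x) = x" for x unfolding \<kappa>_def by (rule flip_flip[OF sW])
  have fst: "fst (\<kappa> x) = fst x" for x unfolding \<kappa>_def by (rule flip_fst[OF sW])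
  have lpW: "level_perm W \<kappa>" unfolding \<kappa>_def by (rule flip_level_perm[OF sW])
  have fix0: "\<kappa> x = x" if "fst x \<noteq> 0" for x using that by (auto simp: \<kappa>_def flip_def)
  show sim: "similar W f (conj_map \<kappa> f)" by (rule level_perm_inv_conj[OF lpW])
  have fm: "flip {0} (\<lambda>i. map \<kappa> (s i)) = \<kappa>" unfolding \<kappa>_def by (rule flip_map[OF sW])
  show "conj_map (flip {0} (\<lambda>i. map \<kappa> (s i))) (conj_map \<kappa> f) = f"
    unfolding fm by (rule conj_map_conj_map[OF inv])
  show "(\<lambda>i. map (flip {0} (\<lambda>i. map \<kappa> (s i))) (map \<kappa> (s i))) = s"
    "(\<lambda>i. map (flip {0} (\<lambda>i. map \<kappa> (s i))) (map \<kappa> (q i))) = q"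
    unfolding fm by (simp_all add: comp_def inv)
  show ends: "hd (map \<kappa> (s 0)) = last (s 0) \<and> last (map \<kappa> (s 0)) = hd (s 0)"
    using flip_ends[of "{0}" s W 0, OF sW] sW[of 0] by (simp add: hd_map last_map \<kappa>_def)
  have "Fun (conj_map \<kappa> f)" using Fun_similar[OF sim] pre by (simp add: pre_II_def)
  moreover have "T1_map (conj_map \<kappa> f)"
  proof -
    \<comment> \<open>The renaming moves vertices of abscissa 0 only, so inside \<open>D\<close>
      nothing changes.\<close>
    have D: "\<kappa> x = x" if "x \<in> D" for x using that by (intro fix0) (auto simp: D_def)
    have "\<kappa> x \<in> D \<longleftrightarrow> x \<in> D" for x using D inv by metis
    then have "restr D (conj_map \<kappa> f) = conj_map \<kappa> (restr D f)" by (rule restr_conj_map)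
    also have "\<dots> = restr D f"
    proof
      fix x
      show "conj_map \<kappa> (restr D f) x = restr D f x"
      proof (cases "x \<in> D")
        case True
        show ?thesis
        proof (cases "restr D f x")
          case (Some y)
          then have "\<kappa> y = y" using D by (simp add: restr_Some)
          then show ?thesis using Some D[OF True] by (simp add: conj_map_def)
        qed (simp add: conj_map_def D[OF True])
      next
        case False
        then have "\<kappa> x \<notin> D" using D inv by metis
        then show ?thesis using False by (simp add: conj_map_def restr_def)
      qed
    qed
    finally show ?thesis using T1_map_cong pre by (metis pre_II_def)
  qed
  moreover have "links (\<lambda>i. map \<kappa> (q i))"
    using pre fst fix0[of "(1, 1)"] unfolding pre_II_def links_def
    by (cases "q 0 = []") (simp_all add: hd_map last_map)
  moreover have "cyclic_points (conj_map \<kappa> f) = {}"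
    using cyclic_points_conj_map[of \<kappa>, OF inv] pre by (simp add: pre_II_def)
  moreover have sp: "spine downs (\<lambda>i. map \<kappa> (s i)) (\<lambda>i. map \<kappa> (q i)) = map \<kappa> (spine downs s q)"
    by (simp add: spine_def map_concat comp_def)
  moreover have "full_path (conj_map \<kappa> f) (map \<kappa> (spine downs s q))"
    using full_path_conj_map[of \<kappa>, OF inv] pre by (simp add: pre_II_def)
  moreover have "set (map \<kappa> (spine downs s q)) \<subseteq> W"
    using pre level_perm_in[OF lpW] unfolding pre_II_def set_map by blast
  moreover have "\<forall>i\<in>{l..0}. map \<kappa> (s i) \<noteq> [] \<and> (\<forall>x\<in>set (map \<kappa> (s i)). i \<le> fst x) \<and>
      fst (hd (map \<kappa> (s i))) = i \<and> fst (last (map \<kappa> (s i))) = i"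
  proof
    fix i assume "i \<in> {l..0}"
    then have "s i \<noteq> [] \<and> (\<forall>x\<in>set (s i). i \<le> fst x) \<and> fst (hd (s i)) = i \<and> fst (last (s i)) = i"
      using pre unfolding pre_II_def by blast
    then show "map \<kappa> (s i) \<noteq> [] \<and> (\<forall>x\<in>set (map \<kappa> (s i)). i \<le> fst x) \<and>
      fst (hd (map \<kappa> (s i))) = i \<and> fst (last (map \<kappa> (s i))) = i" using fst by (simp add: hd_map last_map)
  qed
  moreover have "\<forall>i\<in>{l..-1}. hd (map \<kappa> (s i)) = (i, 1)"
  proof
    fix i assume i: "i \<in> {l..-1}"
    then have "s i \<noteq> []" "hd (s i) = (i, 1)" using pre by (auto simp: pre_II_def)
    then show "hd (map \<kappa> (s i)) = (i, 1)" using fix0[of "(i, 1)"] i by (simp add: hd_map)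
  qed
  ultimately show "pre_II (conj_map \<kappa> f) (\<lambda>i. map \<kappa> (s i)) (\<lambda>i. map \<kappa> (q i))"
    using pre unfolding pre_II_def by simp
qed

text \<open>The conditions \<open>T1\<close> and \<open>T2''\<close> expressed through the segments
  and links of the path from \<open>(l, 1)\<close>.\<close>

definition FinII :: "((vertex \<rightharpoonup> vertex) \<times> (int \<Rightarrow> vertex list) \<times> (int \<Rightarrow> vertex list)) set" where
  "FinII = {(f, s, q). pre_II f s q \<and> last (s 0) = (0, 1)}"

lemma pre_II_spine: "pre_II f s q \<Longrightarrow> spine downs s q = concat (map s [l..-1]) @ q (-1) @ s 0 @ q 0"
  by (rule spine_downs) (simp add: pre_II_def links_def)

lemma concat_neg:
  assumes "pre_II f s q"
  shows "concat (map s [l..-1]) \<noteq> []" "hd (concat (map s [l..-1])) = (l, 1)"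
    "fst (last (concat (map s [l..-1]))) = -1"
proof -
  have "s l \<noteq> []" "hd (s l) = (l, 1)" using assms l by (auto simp: pre_II_def)
  then show "concat (map s [l..-1]) \<noteq> []" "hd (concat (map s [l..-1])) = (l, 1)"
    using l by (simp_all add: upto_rec1)
  have "s (-1) \<noteq> []" "fst (last (s (-1))) = -1" using assms l by (auto simp: pre_II_def)
  then show "fst (last (concat (map s [l..-1]))) = -1" using l by (simp add: upto_rec2)
qed

text \<open>On the path from \<open>(l, 1)\<close> all cuts can be recognized: \<open>q (-1)\<close>
  ends with \<open>(1, 1)\<close> and begins behind the last negative vertex before it, segment 0
  ends with \<open>(0, 1)\<close>, and the negative segments start with
  \<open>(i, 1)\<close>.\<close>

lemma inj_on_FinII: "inj_on fst FinII"
proof (rule inj_onI)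
  fix x y assume xy: "x \<in> FinII" "y \<in> FinII" "fst x = fst y"
  obtain f s q s' q' where x: "x = (f, s, q)" "y = (f, s', q')" using xy(3) by (metis prod.collapse)
  have pre: "pre_II f s q" "pre_II f s' q'" "last (s 0) = (0, 1)" "last (s' 0) = (0, 1)"
    using xy x by (auto simp: FinII_def)
  have fp: "full_path f (spine downs s q)" "full_path f (spine downs s' q')" using pre by (auto simp: pre_II_def)
  have "hd (spine downs s q) = hd (spine downs s' q')"
    unfolding pre_II_spine[OF pre(1)] pre_II_spine[OF pre(2)]
    using concat_neg[OF pre(1)] concat_neg[OF pre(2)] by simp
  then have eq: "spine downs s q = spine downs s' q'" using full_path_unique fp by blast
  define X where "X = concat (map s [l..-1]) @ q (-1)"
  define X' where "X' = concat (map s' [l..-1]) @ q' (-1)"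
  have lq: "links q" "links q'" using pre by (auto simp: pre_II_def)
  have lX: "X \<noteq> []" "X' \<noteq> []" "last X = (1, 1)" "last X' = (1, 1)" using lq by (auto simp: X_def X'_def links_def)
  have "distinct (spine downs s q)" by (rule full_path_distinct[OF fp(1)])
  then have ds: "distinct (X @ s 0 @ q 0)" unfolding pre_II_spine[OF pre(1)] X_def by simp
  have "X @ s 0 @ q 0 = X' @ s' 0 @ q' 0"
    using eq unfolding pre_II_spine[OF pre(1)] pre_II_spine[OF pre(2)] X_def X'_def by simp
  then have 1: "X = X'" "s 0 @ q 0 = s' 0 @ q' 0"
    using append_last_unique[of X "s 0 @ q 0" X' "s' 0 @ q' 0"] ds lX by auto
  have "s 0 \<noteq> []" "s' 0 \<noteq> []" using pre l by (auto simp: pre_II_def)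
  then have 2: "s 0 = s' 0" "q 0 = q' 0"
    using append_last_unique[OF 1(2)] ds pre(3,4) by auto
  have 3: "concat (map s [l..-1]) = concat (map s' [l..-1]) \<and> q (-1) = q' (-1)"
    using 1(1) concat_neg[OF pre(1)] concat_neg[OF pre(2)] lq unfolding X_def X'_def links_def
    by (intro append_split_unique[of _ _ _ _ "\<lambda>x. fst x < 0"]) (auto simp: not_less)
  have "s i = s' i" for i
  proof -
    consider "i \<in> {l..-1}" | "i = 0" | "i \<notin> {l..0}" by fastforce
    then show ?thesis
    proof cases
      case 1
      have "distinct (concat (map s [l..-1]))" using ds by (auto simp: X_def)
      then show ?thesis
        using 1 pre by (intro concat_blocks_hd_unique[OF conjunct1[OF 3]]) (auto simp: pre_II_def)
    next
      case 3
      then show ?thesis using pre by (auto simp: pre_II_def)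
    qed (use 2 in simp)
  qed
  moreover have "q = q'" using 2 3 links_of_links[OF lq(1)] links_of_links[OF lq(2)] by simp
  ultimately show "x = y" using x by auto
qed

lemma A1_II_FinII: "matched W A1_II id (fst ` FinII) id"
proof -
  let ?X1 = "{(f, s, q). pre_II f s q \<and> hd (s 0) = (0, 1)}"
  define \<Theta> where "\<Theta> = (\<lambda>(f, s, q). (conj_map (flip {0} s) f, \<lambda>i. map (flip {0} s) (s i), \<lambda>i :: int. map (flip {0} s) (q i)))"
  have "matched W (states W downs inv_II {}) fst ?X1 fst"
    unfolding states_inv_II_full[symmetric]
    by (rule foata[OF _ foata_invariant_inv_II _ finite_W downs_low]) auto
  moreover have "matched W ?X1 fst FinII fst"
  proof (rule matchedI[where F = \<Theta> and G = \<Theta>])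
    fix x assume "x \<in> ?X1"
    then obtain f s q where x: "x = (f, s, q)" "pre_II f s q" "hd (s 0) = (0, 1)" by blast
    show "\<Theta> x \<in> FinII" using pre_II_flip(1,6)[OF x(2)] x by (simp add: \<Theta>_def FinII_def)
    show "\<Theta> (\<Theta> x) = x" "similar W (fst x) (fst (\<Theta> x))"
      using pre_II_flip(2,3,4,5)[OF x(2)] x by (simp_all add: \<Theta>_def)
  next
    fix x assume "x \<in> FinII"
    then obtain f s q where x: "x = (f, s, q)" "pre_II f s q" "last (s 0) = (0, 1)" unfolding FinII_def by blast
    show "\<Theta> x \<in> ?X1" using pre_II_flip(1,6)[OF x(2)] x by (simp add: \<Theta>_def)
    show "\<Theta> (\<Theta> x) = x" using pre_II_flip(2,3,4)[OF x(2)] x by (simp add: \<Theta>_def)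
  qed
  ultimately show ?thesis
    using matched_trans[OF A1_II_states matched_trans[OF _ matched_trans[OF _ matched_image[OF inj_on_FinII]]]]
    by simp
qed

lemma A0_Fin: "matched W A0 id (fst ` FinI \<union> fst ` FinII) id"
proof -
  \<comment> \<open>In the second case the path from \<open>(l, 1)\<close> contains
    \<open>(1, 1)\<close>, in the first it does not.\<close>
  have disj: "fst ` FinI \<inter> fst ` FinII = {}"
  proof (rule ccontr)
    assume "\<not> ?thesis"
    then obtain f s s' q where I: "(f, s) \<in> FinI" and II: "(f, s', q) \<in> FinII" by force
    have pre: "pre_II f s' q" using II by (simp add: FinII_def)
    have "s l \<noteq> []" "hd (s l) = (l, 1)" using I l by (auto simp: FinI_def)
    then have "hd (concat (map s downs)) = (l, 1)" unfolding downs_Cons by simp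
    moreover have "hd (spine downs s' q) = (l, 1)" unfolding pre_II_spine[OF pre] using concat_neg[OF pre] by simp
    ultimately have "concat (map s downs) = spine downs s' q"
      using I pre by (intro full_path_unique[of f]) (auto simp: FinI_def pre_II_def)
    moreover have "(1, 1) \<in> set (spine downs s' q)"
      using pre last_in_set[of "q (-1)"] unfolding pre_II_spine[OF pre] by (auto simp: pre_II_def links_def)
    moreover have "(1, 1) \<notin> set (concat (map s downs))" using I unfolding FinI_def by blast
    ultimately show False by metis
  qed
  have "A1 = A1_I \<union> A1_II" "A1_I \<inter> A1_II = {}" by (auto simp: A1_I_def A1_II_def)
  then have "matched W A1 id (fst ` FinI \<union> fst ` FinII) id"
    using matched_Un[OF A1_I_FinI A1_II_FinII] disj by simp
  then show ?thesis by (rule matched_trans[OF A0_A1])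
qed

end

section \<open>Marked trees\<close>

lemma distinct_prefix:
  assumes "xs @ v # ys = X @ Y" "distinct (X @ Y)" "v \<notin> set X"
  shows "\<exists>t. xs = X @ t \<and> Y = t @ v # ys"
proof -
  consider us where "xs = X @ us" "us @ v # ys = Y" | us where "xs @ us = X" "v # ys = us @ Y"
    using assms(1) by (auto simp: append_eq_append_conv2)
  then show ?thesis
  proof cases
    case 2
    then show ?thesis using assms(3) by (cases us) auto
  qed auto
qed

lemma full_paths_meet:
  assumes "full_path p xs" "full_path p ys" "last xs = last ys"
  obtains A z B C where "xs = A @ z # B" "ys = C @ z # B" "set A \<inter> set (C @ z # B) = {}"
proof -
  have "last xs \<in> set xs" "last xs \<in> set ys" using assms unfolding full_path_def by (metis last_in_set)+
  then have "\<exists>z\<in>set xs. z \<in> set ys" by blast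
  then obtain A z B where A: "xs = A @ z # B" "z \<in> set ys" "\<forall>u\<in>set A. u \<notin> set ys"
    using split_list_first_prop[of xs "\<lambda>z. z \<in> set ys"] by blast
  obtain C B' where C: "ys = C @ z # B'" using A(2) by (meson split_list)
  have "full_path p (z # B)" "full_path p (z # B')"
    using full_path_suffix[of p A "z # B"] full_path_suffix[of p C "z # B'"] assms A C by auto
  then have "B = B'" using full_path_unique by fastforce
  then show thesis using that[of A z B C] A C by auto
qed

lemma fpath_restr: "fpath (restr D f) xs \<Longrightarrow> fpath f xs"
  by (induction xs) (auto simp: fpath_Cons restr_Some)

lemma fcycle_restr_imp: "fcycle (restr D f) c \<Longrightarrow> fcycle f c"
  using fpath_restr by (auto simp: fcycle_def restr_Some)

lemma fpath_imp_restr: "fpath f xs \<Longrightarrow> set xs \<subseteq> D \<Longrightarrow> fpath (restr D f) xs"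
proof (induction xs)
  case (Cons x xs)
  then show ?case by (cases xs) (auto simp: fpath_Cons restr_Some)
qed simp

section \<open>Conditions on first and last visits as decompositions into segments\<close>

context profile
begin

text \<open>Steps change the abscissa by at most one, so getting below \<open>i\<close> would
  require a visit to \<open>i - 1\<close>.\<close>

lemma level_avoid:
  assumes "Fun p" "fpath p xs" "i \<le> fst (hd xs)" "\<forall>x\<in>set xs. fst x \<noteq> i - 1" "x \<in> set xs"
  shows "i \<le> fst x"
  using assms(2-)
proof (induction xs)
  case (Cons y ys)
  show ?case
  proof (cases "x = y")
    case False
    then have x: "x \<in> set ys" "ys \<noteq> []" using Cons.prems(4) by auto
    then have st: "p y = Some (hd ys)" "fpath p ys" using Cons.prems(1) by (auto simp: fpath_Cons)
    have "fst (hd ys) \<noteq> i - 1" using Cons.prems(3) x(2) by simp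
    then have "i \<le> fst (hd ys)" using Fun_step[OF assms(1) st(1)] Cons.prems(2) by auto
    then show ?thesis using Cons.IH st(2) Cons.prems(3) x(1) by simp
  qed (use Cons.prems in simp)
qed simp

definition block :: "(int \<Rightarrow> vertex list) \<Rightarrow> int \<Rightarrow> bool" where
  "block s i \<longleftrightarrow> s i \<noteq> [] \<and> hd (s i) = (i, 1) \<and> (\<forall>x\<in>set (s i). i \<le> fst x) \<and> fst (last (s i)) = i"

text \<open>Segments are split off from the lowest upwards. The remainder \<open>Y\<close> starts
  with its base vertex and stays at or above \<open>K\<close>; its last visit to \<open>K\<close>
  closes the next segment.\<close>

lemma blocks_of_last_followed:
  assumes p: "Fun p" "fpath p L" "distinct L" "L \<noteq> []" "hd L = (l, 1)" "\<forall>x\<in>set L. l \<le> fst x"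
    and K: "l \<le> K" "\<forall>i\<in>{l+1..K}. last_followed_by L (i - 1) (i, 1)"
  shows "\<exists>s Y. L = concat (map s [l..K-1]) @ Y \<and> Y \<noteq> [] \<and> hd Y = (K, 1) \<and> (\<forall>x\<in>set Y. K \<le> fst x) \<and>
     (\<forall>i\<in>{l..K-1}. block s i) \<and> (\<forall>i. i \<notin> {l..K-1} \<longrightarrow> s i = [])"
  using K
proof (induction K rule: int_ge_induct)
  case base
  show ?case using p by (intro exI[of _ "\<lambda>_. []"] exI[of _ L]) auto
next
  case (step k)
  then obtain s Y where sY: "L = concat (map s [l..k-1]) @ Y" "Y \<noteq> []" "hd Y = (k, 1)" "\<forall>x\<in>set Y. k \<le> fst x"
    "\<forall>i\<in>{l..k-1}. block s i" "\<forall>i. i \<notin> {l..k-1} \<longrightarrow> s i = []" by fastforce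
  have "last_followed_by L (k + 1 - 1) (k + 1, 1)" using step by (intro step.prems[rule_format]) auto
  then obtain xs w ys where w: "L = xs @ w # (k + 1, 1) # ys" "fst w = k" "\<forall>u\<in>set ((k + 1, 1) # ys). fst u \<noteq> k"
    unfolding last_followed_by_def by auto
  have "fpath p ((k + 1, 1) # ys)" using p(2) unfolding w(1) by (auto simp: fpath_append fpath_Cons)
  then have hi: "\<forall>x\<in>set ((k + 1, 1) # ys). k + 1 \<le> fst x"
    using level_avoid[OF p(1), of "(k + 1, 1) # ys" "k + 1"] w(3) by auto
  obtain Y' where Y': "Y = (k, 1) # Y'" using sY by (cases Y) auto
  \<comment> \<open>Behind the last visit to abscissa \<open>k\<close> the path stays above it, so
    the start of the segment lies no later than \<open>w\<close>.\<close>
  have "(k, 1) \<notin> set ((k + 1, 1) # ys)" using hi by fastforce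
  moreover have "(k, 1) \<in> set L" using sY(1) Y' by simp
  ultimately have "(k, 1) \<in> set (xs @ [w])" unfolding w(1) by auto
  then obtain X1 t where X1: "xs @ [w] = X1 @ (k, 1) # t" by (meson split_list)
  have L1: "L = X1 @ (k, 1) # t @ (k + 1, 1) # ys" using w(1) X1
    by (metis append.assoc append_Cons append_Nil)
  have ds: "distinct (X1 @ (k, 1) # t @ (k + 1, 1) # ys)" using p(3) unfolding L1 .
  have "(X1 @ [(k, 1)]) @ t @ (k + 1, 1) # ys = (concat (map s [l..k-1]) @ [(k, 1)]) @ Y'"
    using L1 sY(1) Y' by simp
  then have X: "X1 = concat (map s [l..k-1])" "Y' = t @ (k + 1, 1) # ys"
    using append_last_unique[of "X1 @ [(k, 1)]" "t @ (k + 1, 1) # ys" "concat (map s [l..k-1]) @ [(k, 1)]" Y'] ds by auto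
  define s' where "s' = s(k := (k, 1) # t)"
  have "last ((k, 1) # t) = w" using X1 by (metis last_appendR last_snoc list.distinct(1))
  then have bk: "block s' k" using w(2) sY(4) Y' X(2) by (auto simp: block_def s'_def)
  have "block s' i" if "i \<in> {l..k}" for i
    using bk sY(5) that by (cases "i = k") (auto simp: block_def s'_def)
  moreover have "concat (map s' [l..k]) = concat (map s [l..k-1]) @ (k, 1) # t"
  proof -
    have "[l..k] = [l..k-1] @ [k]" using step.hyps by (simp add: upto_rec2)
    moreover have "map s' [l..k-1] = map s [l..k-1]" by (auto simp: s'_def)
    ultimately show ?thesis by (simp add: s'_def)
  qed
  moreover have "\<forall>i. i \<notin> {l..k} \<longrightarrow> s' i = []" using sY(6) step.hyps by (auto simp: s'_def)
  ultimately show ?case using hi L1 X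
    by (intro exI[of _ s'] exI[of _ "(k + 1, 1) # ys"]) auto
qed

lemma last_followed_by_blocks:
  assumes "i \<in> {l+1..K}" "\<forall>i\<in>{l..K}. block s i" "\<forall>x\<in>set Y. K \<le> fst x"
  shows "last_followed_by (concat (map s [l..K]) @ Y) (i - 1) (i, 1)"
proof -
  have "[l..K] = [l..i-1] @ [i..K]" using assms(1) upto_split1[of l i K] by auto
  then have sp: "concat (map s [l..K]) = concat (map s [l..i-1]) @ concat (map s [i..K])" by simp
  have b: "block s (i - 1)" "block s i" using assms by auto
  have "[l..i-1] = [l..i-1-1] @ [i-1]" using assms(1) by (intro upto_rec2) auto
  then have 1: "concat (map s [l..i-1]) = (concat (map s [l..i-1-1]) @ butlast (s (i-1))) @ [last (s (i-1))]"
    using b by (simp add: block_def)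
  have "[i..K] = i # [i+1..K]" using assms(1) by (intro upto_rec1) auto
  then have 2: "concat (map s [i..K]) = (i, 1) # tl (s i) @ concat (map s [i+1..K])"
    using b by (simp add: block_def) (metis append_Cons hd_Cons_tl)
  have "i \<le> fst x" if "x \<in> set (concat (map s [i..K]) @ Y)" for x
    using that assms by (force simp: block_def)
  then have "\<forall>u\<in>set ((i, 1) # tl (s i) @ concat (map s [i+1..K]) @ Y). fst u \<noteq> i - 1"
    using 2 by fastforce
  moreover have "fst (last (s (i - 1))) = i - 1" using b by (simp add: block_def)
  moreover have "concat (map s [l..K]) @ Y = (concat (map s [l..i-1-1]) @ butlast (s (i-1))) @ last (s (i-1)) #
     (i, 1) # tl (s i) @ concat (map s [i+1..K]) @ Y" using sp 1 2 by simp
  ultimately show ?thesis unfolding last_followed_by_def by blast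
qed

text \<open>Mirror image of \<open>block\<close> for the path from the mark, where the base vertex
  ends its segment.\<close>

definition pblock :: "(int \<Rightarrow> vertex list) \<Rightarrow> int \<Rightarrow> bool" where
  "pblock s i \<longleftrightarrow> s i \<noteq> [] \<and> last (s i) = (i, 1) \<and> (\<forall>x\<in>set (s i). i \<le> fst x) \<and> fst (hd (s i)) = i"

text \<open>Segments are split off from the highest downwards. The extra vertex forms the segment
  \<open>r + 1\<close> by itself, since its image has abscissa \<open>r\<close>; every further
  segment ends right before the first visit to the next abscissa.\<close>

lemma blocks_of_first_preceded:
  assumes p: "Fun p" "full_path p ((r + 1, 1) # L)"
    and T: "\<forall>i\<in>{1..r}. first_preceded_by L (i - 1) (i, 1)"
    and k: "k \<le> r + 1" "1 \<le> k"
  shows "\<exists>s Y. (r + 1, 1) # L = concat (map s (rev [k..r+1])) @ Y \<and> Y \<noteq> [] \<and> fst (hd Y) = k - 1 \<and>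
     (\<forall>i\<in>{k..r+1}. pblock s i) \<and> (\<forall>i. i \<notin> {k..r+1} \<longrightarrow> s i = [])"
  using k
proof (induction k rule: int_le_induct)
  case base
  have "(r + 1, 1) \<in> W" by (simp add: W_def)
  then have "p (r + 1, 1) \<noteq> None" using Fun_None[OF p(1)] r by fastforce
  then have "L \<noteq> []" "p (r + 1, 1) = Some (hd L)" using p(2) by (auto simp: full_path_def fpath_Cons)
  moreover have "hd L \<in> V" using Fun_in[OF p(1)] calculation by blast
  then have "fst (hd L) = r" using Fun_step[OF p(1) calculation(2)] fst_V by fastforce
  ultimately show ?case
    by (intro exI[of _ "(\<lambda>_. [])(r + 1 := [(r + 1, 1)])"] exI[of _ L]) (auto simp: pblock_def)
next
  case (step k)
  define i where "i = k - 1"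
  obtain s Y where sY: "(r + 1, 1) # L = concat (map s (rev [k..r+1])) @ Y" "Y \<noteq> []" "fst (hd Y) = i"
     "\<forall>i\<in>{k..r+1}. pblock s i" "\<forall>i. i \<notin> {k..r+1} \<longrightarrow> s i = []"
    using step i_def by auto
  have "i \<in> {1..r}" using step i_def by auto
  then obtain xs w ys where w: "L = xs @ (i, 1) # w # ys" "fst w = i - 1" "\<forall>u\<in>set (xs @ [(i, 1)]). fst u \<noteq> i - 1"
    using T unfolding first_preceded_by_def by metis
  define X where "X = concat (map s (rev [k..r+1]))"
  have "i + 1 \<le> fst x" if "x \<in> set X" for x using that sY(4) by (force simp: X_def pblock_def i_def)
  then have "(i, 1) \<notin> set X" by fastforce
  moreover have "((r + 1, 1) # xs) @ (i, 1) # w # ys = X @ Y" using sY(1) w(1) by (simp add: X_def)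
  moreover have "distinct (X @ Y)" using full_path_distinct[OF p(2)] unfolding sY(1) X_def .
  ultimately obtain t where t: "(r + 1, 1) # xs = X @ t" "Y = t @ (i, 1) # w # ys"
    using distinct_prefix by meson
  \<comment> \<open>The condition on first visits concerns the path without its extra first vertex,
    which therefore has to be located outside \<open>t\<close>.\<close>
  have "(r + 1, 1) \<in> set X"
  proof -
    have "X \<noteq> []" using sY(4) step.hyps by (auto simp: X_def pblock_def)
    then show ?thesis using t(1) by (metis hd_append2 hd_in_set list.sel(1))
  qed
  then have "set t \<subseteq> set xs" using t(1) \<open>distinct (X @ Y)\<close> unfolding t(2)
    by (auto) (metis Un_iff disjoint_iff set_ConsD set_append)
  then have av: "\<forall>u\<in>set (t @ [(i, 1)]). fst u \<noteq> i - 1" using w(3) by auto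
  have fY: "fpath p Y" using p(2) sY(1) unfolding full_path_def by (simp add: fpath_append)
  then have ft: "fpath p (t @ [(i, 1)])" unfolding t(2) by (auto simp: fpath_append fpath_Cons)
  have hdt: "fst (hd (t @ [(i, 1)])) = i" using sY(3) unfolding t(2) by (cases t) auto
  define s' where "s' = s(i := t @ [(i, 1)])"
  have bi: "pblock s' i" using level_avoid[OF p(1) ft _ av] hdt by (auto simp: pblock_def s'_def)
  have "pblock s' j" if "j \<in> {i..r+1}" for j
    using bi sY(4) that i_def by (cases "j = i") (auto simp: pblock_def s'_def)
  moreover have "concat (map s' (rev [i..r+1])) = X @ t @ [(i, 1)]"
  proof -
    have "[i..r+1] = i # [k..r+1]" using step.hyps i_def by (simp add: upto_rec1)
    moreover have m: "map s' (rev [k..r+1]) = map s (rev [k..r+1])" using i_def by (auto simp: s'_def)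
    ultimately have "map s' (rev [i..r+1]) = map s (rev [k..r+1]) @ [t @ [(i, 1)]]"
      unfolding m[symmetric] by (simp add: s'_def)
    then show ?thesis by (simp add: X_def)
  qed
  moreover have "\<forall>j. j \<notin> {i..r+1} \<longrightarrow> s' j = []" using sY(5) step.hyps i_def by (auto simp: s'_def)
  ultimately show ?case using w(1,2) t unfolding i_def[symmetric]
    by (intro exI[of _ s'] exI[of _ "w # ys"]) auto
qed

text \<open>\<open>L\<close> is the path from the mark. Given \<open>T1_map\<close>, the positive
  part followed by the path from the image of \<open>(1, 1)\<close> is the complete path from the
  extra vertex; the segments down to \<open>i\<close> stay at or above \<open>i\<close>, so the
  first visit to \<open>i - 1\<close> comes right behind segment \<open>i\<close>. The second
  statement supplies the positive prefix up to \<open>(1, 1)\<close> for the analysis of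
  \<open>T2\<close>.\<close>

lemma T1_map_iff:
  assumes p: "Fun p" "cyclic_points p = {}" "full_path p ((r + 1, 1) # L)"
  shows "(\<forall>i\<in>{1..r}. first_preceded_by L (i - 1) (i, 1)) \<longleftrightarrow> T1_map p \<and> p (1, 1) \<in> Some ` level V 0" (is "?T \<longleftrightarrow> ?R")
    and "T1_map p \<and> p (1, 1) \<in> Some ` level V 0 \<Longrightarrow> \<exists>X us. (r + 1, 1) # L = X @ us \<and> X \<noteq> [] \<and> last X = (1, 1) \<and> (\<forall>x\<in>set X. 1 \<le> fst x) \<and> us \<noteq> [] \<and> fst (hd us) = 0"
proof -
  have inW: "set ((r + 1, 1) # L) \<subseteq> W" using full_path_in_W[OF p(1,3)] by (simp add: W_def)
  have dec: "\<exists>s us. (r + 1, 1) # L = concat (map s ups) @ us \<and> us \<noteq> [] \<and> fst (hd us) = 0 \<and> (\<forall>i\<in>{1..r+1}. pblock s i) \<and>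
      last (concat (map s ups)) = (1, 1) \<and> (\<forall>x\<in>set (concat (map s ups)). 1 \<le> fst x)" if R: ?R
  proof -
    obtain s where s: "positive_part p s" "\<forall>i\<in>{1..r + 1}. last (s i) = (i, 1)" using R by (auto simp: T1_map_def)
    define X where "X = concat (map s ups)"
    have fpX: "full_path (restr D p) X" "set X \<subseteq> D" using s by (auto simp: positive_part_def X_def)
    have ups: "ups = (r + 1) # rev [1..r]" "ups = rev [2..r + 1] @ [1]" using r by (simp add: upto_rec2, simp add: upto_rec1)
    have "s (r + 1) \<noteq> []" "fst (hd (s (r + 1))) = r + 1" "set (s (r + 1)) \<subseteq> D"
      using positive_partD[OF s(1), of "r + 1"] r by auto
    then have "hd (s (r + 1)) = (r + 1, 1)" using top_W hd_in_set unfolding D_def by blast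
    then have hdX: "hd X = (r + 1, 1)" using \<open>s (r + 1) \<noteq> []\<close> ups(1) by (simp add: X_def)
    have "s 1 \<noteq> []" "last (s 1) = (1, 1)" using positive_partD[OF s(1), of 1] s(2) r by auto
    then have lX: "last X = (1, 1)" "X \<noteq> []" using ups(2) by (simp_all add: X_def)
    obtain u where u: "p (1, 1) = Some u" "u \<in> level V 0" using R by auto
    have fX: "fpath p X" using fpX fpath_restr unfolding full_path_def by blast
    obtain us where us: "full_path p us" "hd us = u"
      using full_path_exists[of W u p] finite_W Fun_in[OF p(1)] Fun_V_W p(2) u(2) by (metis level_0 subsetD)
    have "full_path p (X @ us)" using fX us lX u(1) by (auto simp: full_path_def fpath_append)
    then have "(r + 1, 1) # L = X @ us" using hdX lX(2) by (intro full_path_unique[OF p(3)]) auto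
    moreover have "pblock s i" if "i \<in> {1..r+1}" for i
      using s that by (auto simp: pblock_def positive_part_def)
    moreover have "us \<noteq> []" "fst (hd us) = 0" using us u(2) by (auto simp: full_path_def level_0)
    ultimately show ?thesis using lX(1) fpX(2) unfolding X_def D_def by blast
  qed
  show "\<exists>X us. (r + 1, 1) # L = X @ us \<and> X \<noteq> [] \<and> last X = (1, 1) \<and> (\<forall>x\<in>set X. 1 \<le> fst x) \<and> us \<noteq> [] \<and> fst (hd us) = 0"
    if R: ?R
  proof -
    note R
    then obtain s us where s: "(r + 1, 1) # L = concat (map s ups) @ us" "us \<noteq> []" "fst (hd us) = 0" "\<forall>i\<in>{1..r+1}. pblock s i"
      "last (concat (map s ups)) = (1, 1)" "\<forall>x\<in>set (concat (map s ups)). 1 \<le> fst x" using dec by blast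
    have "concat (map s ups) \<noteq> []" using s(4) r by (auto simp: pblock_def)
    then show ?thesis using s by blast
  qed
  show "?T \<longleftrightarrow> ?R"
  proof
    assume ?T
    then obtain s Y where sY: "(r + 1, 1) # L = concat (map s ups) @ Y" "Y \<noteq> []" "fst (hd Y) = 0"
       "\<forall>i\<in>{1..r+1}. pblock s i" "\<forall>i. i \<notin> {1..r+1} \<longrightarrow> s i = []"
      using blocks_of_first_preceded[OF p(1,3), of 1] r by auto
    define X where "X = concat (map s ups)"
    have "ups = rev [2..r + 1] @ [1]" using r by (simp add: upto_rec1)
    moreover have "s 1 \<noteq> []" "last (s 1) = (1, 1)" using sY(4) r by (auto simp: pblock_def)
    ultimately have lX: "last X = (1, 1)" "X \<noteq> []" by (simp_all add: X_def)
    have XW: "set X \<subseteq> W" using inW unfolding sY(1) X_def by simp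
    have X1: "1 \<le> fst x" if "x \<in> set X" for x using that sY(4) by (force simp: X_def pblock_def)
    then have XD: "set X \<subseteq> D" using XW by (auto simp: D_def)
    have fp: "fpath p X" "p (1, 1) = Some (hd Y)"
      using p(3) lX sY(2) unfolding full_path_def sY(1) X_def[symmetric] by (auto simp: fpath_append)
    have "hd Y \<in> W" using Fun_in[OF p(1) fp(2)] Fun_V_W by blast
    then have "p (1, 1) \<in> Some ` level V 0" using sY(3) fp(2) by (auto simp: level_0)
    moreover have "full_path (restr D p) X"
      using fpath_imp_restr[OF fp(1) XD] lX fp(2) sY(3) by (auto simp: full_path_def restr_def D_def)
    moreover have "cyclic_points (restr D p) = {}" using p(2) fcycle_restr_imp by (fastforce simp: cyclic_points_def)
    ultimately show ?R using sY(4,5) XD unfolding T1_map_def positive_part_def X_def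
      by (intro conjI exI[of _ s]) (auto simp: pblock_def)
  next
    assume ?R
    then obtain s us where s: "(r + 1, 1) # L = concat (map s ups) @ us" "us \<noteq> []" "fst (hd us) = 0" "\<forall>i\<in>{1..r+1}. pblock s i"
      using dec by blast
    show ?T
    proof
      fix i assume i: "i \<in> {1..r}"
      define X where "X = concat (map s (rev [i+1..r+1]))"
      define Y where "Y = concat (map s (rev [1..i-1])) @ us"
      have "[1..r+1] = [1..i-1] @ i # [i+1..r+1]" using i upto_split3[of 1 i "r + 1"] by auto
      then have P: "(r + 1, 1) # L = X @ s i @ Y" using s(1) by (simp add: X_def Y_def)
      have "X \<noteq> []" using s(4) i by (force simp: X_def pblock_def)
      then obtain X' where X': "X = (r + 1, 1) # X'" using P by (cases X) auto
      have si: "s i = butlast (s i) @ [(i, 1)]" using s(4) i append_butlast_last_id[of "s i"] by (auto simp: pblock_def)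
      have Y: "Y \<noteq> []" "fst (hd Y) = i - 1"
      proof -
        show "Y \<noteq> []" using s(2) by (simp add: Y_def)
        show "fst (hd Y) = i - 1"
        proof (cases "i = 1")
          case False
          then have "[1..i-1] = [1..i-1-1] @ [i-1]" using i by (intro upto_rec2) auto
          moreover have "pblock s (i - 1)" using False i s(4) by auto
          ultimately show ?thesis by (simp add: Y_def pblock_def)
        qed (use s(3) in \<open>simp add: Y_def\<close>)
      qed
      have "L = (X' @ butlast (s i)) @ (i, 1) # hd Y # tl Y" using P X' si Y(1)
        by (metis append.assoc append_Cons append_Nil hd_Cons_tl list.inject)
      moreover have "i \<le> fst u" if "u \<in> set (X @ s i)" for u
        using that s(4) i by (force simp: X_def pblock_def)
      then have "\<forall>u\<in>set ((X' @ butlast (s i)) @ [(i, 1)]). fst u \<noteq> i - 1"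
        using X' si by (fastforce dest: in_set_butlastD)
      ultimately show "first_preceded_by L (i - 1) (i, 1)" using Y(2) unfolding first_preceded_by_def by blast
    qed
  qed
qed

section \<open>Acyclic functions on \<open>W\<close> as marked trees, and the conditions
  \<open>T1\<close> and \<open>T2\<close> in terms of them\<close>

definition trees :: "(vertex \<rightharpoonup> vertex) set" where
  "trees = {p. Fun p \<and> cyclic_points p = {}}"

definition root_of :: "(vertex \<rightharpoonup> vertex) \<Rightarrow> vertex" where
  "root_of p = (THE x. x \<in> W \<and> p x = None)"

definition tree_of :: "(vertex \<rightharpoonup> vertex) \<Rightarrow> vertex rooted \<times> vertex" where
  "tree_of p = (map_tree V (root_of p) (p |` V), the (p (r + 1, 1)))"

lemma root_eqI: "Fun p \<Longrightarrow> x \<in> W \<Longrightarrow> p x = None \<Longrightarrow> root_of p = x"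
  unfolding root_of_def using Fun_None_unique by blast

lemma Fun_top:
  assumes "Fun p" obtains m where "p (r + 1, 1) = Some m" "m \<in> level V r"
proof -
  have "(r + 1, 1) \<in> W" by (simp add: W_def)
  then obtain m where m: "p (r + 1, 1) = Some m" using Fun_None[OF assms] r by fastforce
  then have "m \<in> V" "fst m = r" using Fun_in[OF assms m] Fun_step[OF assms m] fst_V by fastforce+
  then show thesis using that m by (simp add: level_def)
qed

lemma Fun_dom:
  assumes "Fun p" shows "root_of p \<in> level V 0" "dom p = W - {root_of p}"
proof -
  obtain \<rho> where \<rho>: "\<rho> \<in> level V 0" "dom p = W - {\<rho>}" using assms by (auto simp: Fun_def)
  have "\<rho> \<in> W" using \<rho>(1) by (simp add: level_0)
  moreover have "p \<rho> = None" using \<rho>(2) by (auto simp: dom_def)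
  ultimately have "root_of p = \<rho>" using root_eqI assms by blast
  then show "root_of p \<in> level V 0" "dom p = W - {root_of p}" using \<rho> by auto
qed

lemma full_path_V:
  assumes "Fun p" "full_path p xs" "hd xs \<in> V" shows "set xs \<subseteq> V" "last xs = root_of p"
proof -
  show xs: "set xs \<subseteq> V"
    using fpath_closed[of p xs V] assms Fun_in[OF assms(1)] unfolding full_path_def by blast
  have "last xs \<in> set xs" using assms(2) by (simp add: full_path_def)
  then have "last xs \<in> W" using xs Fun_V_W by blast
  then show "last xs = root_of p" using root_eqI[OF assms(1)] assms(2) by (auto simp: full_path_def)
qed

lemma full_path_restrict: "set xs \<subseteq> V \<Longrightarrow> full_path (p |` V) xs = full_path p xs"
proof -
  assume xs: "set xs \<subseteq> V"
  then have "fpath (p |` V) xs = fpath p xs" by (intro fpath_cong) (auto dest!: in_set_butlastD)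
  moreover have "xs \<noteq> [] \<Longrightarrow> last xs \<in> V" using xs last_in_set[of xs] by blast
  ultimately show ?thesis unfolding full_path_def by auto
qed

lemma rooted_map_restrict:
  assumes "p \<in> trees" shows "rooted_map V (root_of p) (p |` V)"
proof -
  have F: "Fun p" "cyclic_points p = {}" using assms by (auto simp: trees_def)
  have "fcycle p c" if "fcycle (p |` V) c" for c
  proof -
    have "(p |` V) x = p x" if "x \<in> set c" for x
      using fcycle_defined[OF \<open>fcycle (p |` V) c\<close> that] by (auto simp: restrict_map_def split: if_splits)
    then show ?thesis using fcycle_cong[of c "p |` V" p] that by blast
  qed
  then have "cyclic_points (p |` V) = {}" using F(2) by (fastforce simp: cyclic_points_def)
  moreover have "dom (p |` V) = V - {root_of p}" using Fun_dom[OF F(1)] Fun_V_W by auto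
  moreover have "ran (p |` V) \<subseteq> V" using Fun_in[OF F(1)] by (auto simp: ran_def restrict_map_def split: if_splits)
  ultimately show ?thesis using Fun_dom(1)[OF F(1)] finite_V by (simp add: rooted_map_def level_def)
qed

lemma tree_of_path:
  assumes "p \<in> trees" "full_path p xs" "hd xs \<in> V"
  shows "root_path (fst (tree_of p)) (hd xs) = xs"
proof -
  have F: "Fun p" using assms by (simp add: trees_def)
  show ?thesis
    using root_path_map_tree[of "p |` V" xs V "root_of p"] full_path_restrict full_path_V[OF F assms(2,3)] assms(2)
    by (simp add: tree_of_def)
qed

lemma full_path_from:
  assumes "p \<in> trees" "x \<in> V"
  obtains xs where "full_path p xs" "hd xs = x" "set xs \<subseteq> V" "last xs = root_of p"
proof -
  have F: "Fun p" "cyclic_points p = {}" using assms by (auto simp: trees_def)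
  obtain xs where "full_path p xs" "hd xs = x"
    using full_path_exists[of W x p] finite_W Fun_in[OF F(1)] Fun_V_W F(2) assms(2) by (metis subsetD)
  then show thesis using that full_path_V[OF F(1)] assms(2) by blast
qed

text \<open>Normal form of the data in \<open>T1\<close> and \<open>T2\<close>: the paths
  \<open>A @ z # B\<close> from \<open>(l, 1)\<close> and \<open>C @ z # B\<close> from the mark,
  joining at their meet \<open>z\<close>.\<close>

lemma tree_of_paths:
  assumes p: "p \<in> trees"
  obtains A z B C where "full_path p (A @ z # B)" "full_path p ((r + 1, 1) # C @ z # B)"
    "hd (A @ z # B) = (l, 1)" "set (A @ z # B) \<subseteq> V" "set (C @ z # B) \<subseteq> V" "set A \<inter> set (C @ z # B) = {}"
    "root_path (fst (tree_of p)) (l, 1) = A @ z # B"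
    "root_path (fst (tree_of p)) (snd (tree_of p)) = C @ z # B"
    "meet (fst (tree_of p)) (l, 1) (snd (tree_of p)) = z"
    "tree_path (fst (fst (tree_of p))) (l, 1) z = A @ [z]"
    "last (z # B) = root_of p"
proof -
  have F: "Fun p" using p by (simp add: trees_def)
  obtain m where m: "p (r + 1, 1) = Some m" "m \<in> level V r" using Fun_top[OF F] .
  have mV: "m \<in> V" using m(2) by (simp add: level_def)
  have lV: "(l, 1) \<in> V" using base_in_V l r by simp
  obtain xs where xs: "full_path p xs" "hd xs = (l, 1)" "set xs \<subseteq> V" "last xs = root_of p"
    using full_path_from[OF p lV] by metis
  obtain ys where ys: "full_path p ys" "hd ys = m" "set ys \<subseteq> V" "last ys = root_of p"
    using full_path_from[OF p mV] by metis
  obtain A z B C where A: "xs = A @ z # B" "ys = C @ z # B" "set A \<inter> set (C @ z # B) = {}"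
    using full_paths_meet[OF xs(1) ys(1)] xs(4) ys(4) by metis
  have rp: "root_path (fst (tree_of p)) (l, 1) = A @ z # B" "root_path (fst (tree_of p)) m = C @ z # B"
    using tree_of_path[OF p xs(1)] tree_of_path[OF p ys(1)] xs ys lV mV A by auto
  have sn: "snd (tree_of p) = m" using m by (simp add: tree_of_def)
  have fpr: "full_path (p |` V) (A @ z # B)" "full_path (p |` V) (C @ z # B)"
    using full_path_restrict xs ys A by auto
  have "meet (map_tree V (root_of p) (p |` V)) (hd (A @ [z])) (hd (C @ [z])) = z"
    using A xs ys by (intro meet_map_tree[OF rooted_map_restrict[OF p] fpr]) auto
  moreover have h: "hd (A @ [z]) = (l, 1)" "hd (C @ [z]) = m" using xs(2) ys(2) A by (cases A; cases C; simp)+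
  ultimately have "meet (fst (tree_of p)) (l, 1) m = z" by (simp add: tree_of_def)
  moreover have "tree_path (fst (map_tree V (root_of p) (p |` V))) (hd (A @ [z])) (last (A @ [z])) = A @ [z]"
    using fpr(1) xs A by (intro tree_path_map_tree[of "p |` V" "A @ [z]" B]) auto
  then have "tree_path (fst (fst (tree_of p))) (l, 1) z = A @ [z]" using h by (simp add: tree_of_def)
  moreover have "full_path p ((r + 1, 1) # C @ z # B)"
    using m(1) ys(1,2) A(2) by (auto simp: full_path_def fpath_Cons)
  moreover have "last (z # B) = root_of p" using xs(4) A(1) by simp
  ultimately show thesis using that[of A z B C] rp sn A xs ys by simp
qed

lemma T1_tree_of:
  assumes "p \<in> trees"
  shows "T1 r (tree_of p) \<longleftrightarrow> T1_map p \<and> p (1, 1) \<in> Some ` level V 0"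
proof -
  obtain A z B C where *: "full_path p ((r + 1, 1) # C @ z # B)"
    "root_path (fst (tree_of p)) (snd (tree_of p)) = C @ z # B"
    using tree_of_paths[OF assms] by metis
  have "T1 r (tree_of p) \<longleftrightarrow> (\<forall>i\<in>{1..r}. first_preceded_by (C @ z # B) (i - 1) (i, 1))"
    using *(2) by (simp add: T1_def split_beta)
  then show ?thesis using T1_map_iff(1)[OF _ _ *(1)] assms by (simp add: trees_def)
qed

text \<open>For \<open>r > 0\<close>, \<open>T1\<close> puts \<open>(1, 1)\<close> on the path from
  the mark, so it comes strictly before the meet iff it is not on the path from
  \<open>(l, 1)\<close>. The conditions on last visits are the decomposition of the latter path into
  segments.\<close>

lemma T2'_tree_of:
  assumes p: "p \<in> trees" and T1: "T1_map p" "p (1, 1) \<in> Some ` level V 0"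
  shows "T2' l r (tree_of p) \<longleftrightarrow> p \<in> fst ` FinI"
proof -
  obtain A z B C where *: "full_path p (A @ z # B)" "full_path p ((r + 1, 1) # C @ z # B)"
    "hd (A @ z # B) = (l, 1)" "set (A @ z # B) \<subseteq> V" "set (C @ z # B) \<subseteq> V" "set A \<inter> set (C @ z # B) = {}"
    "root_path (fst (tree_of p)) (l, 1) = A @ z # B"
    "root_path (fst (tree_of p)) (snd (tree_of p)) = C @ z # B"
    "meet (fst (tree_of p)) (l, 1) (snd (tree_of p)) = z" "last (z # B) = root_of p"
    using tree_of_paths[OF p] by metis
  have F: "Fun p" "cyclic_points p = {}" using p by (auto simp: trees_def)
  have T2: "T2' l r (tree_of p) \<longleftrightarrow> (r \<ge> 1 \<longrightarrow> strictly_before (C @ z # B) (1, 1) z) \<and>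
     (\<forall>i\<in>{l+1..0}. last_followed_by (A @ z # B) (i - 1) (i, 1))"
    using *(7-9) by (simp add: T2'_def split_beta)
  have ds: "distinct (A @ z # B)" "distinct ((r + 1, 1) # C @ z # B)" using full_path_distinct * by blast+
  obtain X us where X: "(r + 1, 1) # C @ z # B = X @ us" "last X = (1, 1)" "X \<noteq> []"
    using T1_map_iff(2)[OF F *(2)] T1 by blast
  have before: "(r \<ge> 1 \<longrightarrow> strictly_before (C @ z # B) (1, 1) z) \<longleftrightarrow> (1, 1) \<notin> set (A @ z # B)"
  proof (cases "r \<ge> 1")
    case False
    \<comment> \<open>For \<open>r = 0\<close> both sides hold, because \<open>(1, 1)\<close> is the
      extra vertex.\<close>
    then have "(1, 1) \<notin> V" using fst_V[of "(1, 1)"] by auto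
    then show ?thesis using False *(4) by auto
  next
    case True
    have "(1, 1) \<in> set (X @ us)" using X(2,3) last_in_set[of X] by simp
    then have inr: "(1, 1) \<in> set (C @ z # B)" using True unfolding X(1)[symmetric] by auto
    show ?thesis
    proof
      assume "r \<ge> 1 \<longrightarrow> strictly_before (C @ z # B) (1, 1) z"
      then obtain xs ys zs where e: "C @ z # B = xs @ (1, 1) # ys @ z # zs" using True by (auto simp: strictly_before_def)
      have "C = xs @ (1, 1) # ys"
      proof -
        have "(C @ [z]) @ B = ((xs @ (1, 1) # ys) @ [z]) @ zs" using e by simp
        moreover have "distinct ((C @ [z]) @ B)" using ds(2) by simp
        ultimately have "C @ [z] = (xs @ (1, 1) # ys) @ [z]"
          using append_last_unique[of "C @ [z]" B "(xs @ (1, 1) # ys) @ [z]" zs] by simp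
        then show ?thesis by simp
      qed
      then have "(1, 1) \<in> set C" by simp
      then show "(1, 1) \<notin> set (A @ z # B)" using ds(2) *(6) by auto
    next
      assume "(1, 1) \<notin> set (A @ z # B)"
      then have "(1, 1) \<in> set C" using inr by auto
      then obtain xs ys where "C = xs @ (1, 1) # ys" by (meson split_list)
      then show "r \<ge> 1 \<longrightarrow> strictly_before (C @ z # B) (1, 1) z" unfolding strictly_before_def by auto
    qed
  qed
  show ?thesis
  proof
    assume L: "T2' l r (tree_of p)"
    have lev: "\<forall>x\<in>set (A @ z # B). l \<le> fst x" using *(4) fst_V by blast
    have fpA: "fpath p (A @ z # B)" "A @ z # B \<noteq> []" using *(1) by (auto simp: full_path_def)
    have lf: "\<forall>i\<in>{l+1..0}. last_followed_by (A @ z # B) (i - 1) (i, 1)" using L T2 by blast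
    have "l \<le> 0" using l by simp
    from blocks_of_last_followed[OF F(1) fpA(1) ds(1) fpA(2) *(3) lev this lf]
    obtain s Y where sY: "A @ z # B = concat (map s [l..0-1]) @ Y" "Y \<noteq> []" "hd Y = (0, 1)" "\<forall>x\<in>set Y. 0 \<le> fst x"
      "\<forall>i\<in>{l..0-1}. block s i" "\<forall>i. i \<notin> {l..0-1} \<longrightarrow> s i = []" by (elim exE conjE)
    \<comment> \<open>All that remains behind the negative segments is segment 0; it ends at the
      root, hence at abscissa 0.\<close>
    define s' where "s' = s(0 := Y)"
    have "last Y = root_of p" using sY(1,2) *(10) by (metis last_appendR list.distinct(1))
    then have lY: "fst (last Y) = 0" using Fun_dom(1)[OF F(1)] by (simp add: level_0)
    have c: "concat (map s' downs) = A @ z # B"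
    proof -
      have "map s' [l..-1] = map s [l..-1]" by (auto simp: s'_def)
      then show ?thesis unfolding downs_snoc sY(1) by (simp add: s'_def)
    qed
    have "block s' i" if "i \<in> {l..0}" for i
      using that sY lY by (cases "i = 0") (auto simp: s'_def block_def)
    moreover have "(1, 1) \<notin> set (concat (map s' downs))" using L before unfolding T2 c by blast
    moreover have "\<forall>i. i \<notin> {l..0} \<longrightarrow> s' i = []" using sY(6) l by (auto simp: s'_def)
    moreover have "set (concat (map s' downs)) \<subseteq> W" unfolding c using *(4) Fun_V_W by blast
    moreover have "full_path p (concat (map s' downs))" unfolding c by (rule *(1))
    ultimately have "(p, s') \<in> FinI" unfolding FinI_def mem_Collect_eq split_conv using F T1 unfolding block_def by blast
    then show "p \<in> fst ` FinI" by force
  next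
    assume "p \<in> fst ` FinI"
    then obtain s where s: "(p, s) \<in> FinI" by auto
    then have fp: "full_path p (concat (map s downs))" and b: "\<forall>i\<in>{l..0}. block s i"
      and n: "(1, 1) \<notin> set (concat (map s downs))"
      unfolding FinI_def block_def by blast+
    have "s l \<noteq> []" "hd (s l) = (l, 1)" using b l by (auto simp: block_def)
    then have "hd (concat (map s downs)) = (l, 1)" unfolding downs_Cons by simp
    then have e: "A @ z # B = concat (map s downs)" using full_path_unique[OF *(1) fp] *(3) by simp
    have "last_followed_by (A @ z # B) (i - 1) (i, 1)" if "i \<in> {l+1..0}" for i
      using last_followed_by_blocks[OF that b, of "[]"] unfolding e by simp
    then show "T2' l r (tree_of p)" unfolding T2 using before n unfolding e by blast
  qed
qed

lemma top_not_low: "fst (r + 1, 1) \<noteq> (-1 :: int)" using r by simp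

lemma FinII_image: "p \<in> fst ` FinII \<Longrightarrow> p \<in> trees \<and> T1_map p \<and> p (1, 1) \<in> Some ` level V 0"
proof -
  assume "p \<in> fst ` FinII"
  then obtain s q where pre: "pre_II p s q" by (auto simp: FinII_def)
  have "full_path p (concat (map s [l..-1]) @ q (-1) @ s 0 @ q 0)" "links q" "Fun p" "T1_map p" "cyclic_points p = {}"
    using pre pre_II_spine[OF pre] by (auto simp: pre_II_def)
  moreover have "s 0 \<noteq> []" "fst (hd (s 0)) = 0" using pre l by (auto simp: pre_II_def)
  ultimately have "p (1, 1) = Some (hd (s 0))" by (auto simp: full_path_def fpath_append links_def)
  moreover have "hd (s 0) \<in> level V 0"
    using Fun_in[OF \<open>Fun p\<close>] calculation \<open>fst (hd (s 0)) = 0\<close> by (auto simp: level_def)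
  ultimately show ?thesis using \<open>Fun p\<close> \<open>T1_map p\<close> \<open>cyclic_points p = {}\<close> by (auto simp: trees_def)
qed

text \<open>By \<open>T1\<close>, the path from the mark is positive up to \<open>(1, 1)\<close>. If
  the meet comes no later than \<open>(1, 1)\<close>, then the path from \<open>(l, 1)\<close>
  consists of the negative segments, a nonnegative link through the meet to \<open>(1, 1)\<close>,
  segment 0 and a rest starting at abscissa -1, if any.\<close>

lemma T2''_tree_of:
  assumes p: "p \<in> trees" and T1: "T1_map p" "p (1, 1) \<in> Some ` level V 0"
  shows "T2'' l (tree_of p) \<longleftrightarrow> p \<in> fst ` FinII"
proof -
  obtain A z B C where *: "full_path p (A @ z # B)" "full_path p ((r + 1, 1) # C @ z # B)"
    "hd (A @ z # B) = (l, 1)" "set (A @ z # B) \<subseteq> V" "set (C @ z # B) \<subseteq> V" "set A \<inter> set (C @ z # B) = {}"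
    "root_path (fst (tree_of p)) (l, 1) = A @ z # B"
    "root_path (fst (tree_of p)) (snd (tree_of p)) = C @ z # B"
    "meet (fst (tree_of p)) (l, 1) (snd (tree_of p)) = z"
    "tree_path (fst (fst (tree_of p))) (l, 1) z = A @ [z]"
    "last (z # B) = root_of p"
    using tree_of_paths[OF p] by metis
  have F: "Fun p" "cyclic_points p = {}" using p by (auto simp: trees_def)
  have "snd (fst (tree_of p)) = root_of p" by (simp add: tree_of_def map_tree_def)
  then have T2: "T2'' l (tree_of p) \<longleftrightarrow> weakly_after (C @ z # B) (1, 1) z \<and> fst z > 0 \<and>
     (\<forall>i\<in>{l+1..-1}. last_followed_by (A @ [z]) (i - 1) (i, 1)) \<and>
     (if \<exists>v\<in>set (C @ z # B). fst v = -1 then first_preceded_by (C @ z # B) (-1) (0, 1)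
      else root_of p = (0, 1))"
    using *(7-10) by (simp add: T2''_def split_beta)
  have ds: "distinct (A @ z # B)" "distinct ((r + 1, 1) # C @ z # B)" using full_path_distinct * by blast+
  obtain X us where X: "(r + 1, 1) # C @ z # B = X @ us" "X \<noteq> []" "last X = (1, 1)" "\<forall>x\<in>set X. 1 \<le> fst x"
    "us \<noteq> []" "fst (hd us) = 0"
    using T1_map_iff(2)[OF F *(2)] T1 by blast
  have dsX: "distinct (X @ us)" using ds(2) unfolding X(1) .
  have fus: "fpath p us" using *(2) unfolding X(1) full_path_def by (simp add: fpath_append)
  \<comment> \<open>\<open>Z\<close> is the stretch from the meet to \<open>(1, 1)\<close>, common
    to both paths.\<close>
  have cut: "\<exists>Z. X = ((r + 1, 1) # C) @ Z \<and> z # B = Z @ us \<and> Z \<noteq> [] \<and> hd Z = z \<and> last Z = (1, 1)"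
    if in1: "(1, 1) \<in> set (z # B)"
  proof -
    have "(1, 1) \<notin> set ((r + 1, 1) # C)" using in1 ds(2) by auto
    moreover have "butlast X @ (1, 1) # us = ((r + 1, 1) # C) @ (z # B)"
      using X(1-3) append_butlast_last_id[OF X(2)] by (metis append.assoc append_Cons append_Nil)
    moreover have "distinct (((r + 1, 1) # C) @ (z # B))" using ds(2) by simp
    ultimately obtain t where t: "butlast X = ((r + 1, 1) # C) @ t" "z # B = t @ (1, 1) # us"
      using distinct_prefix by meson
    then have "X = ((r + 1, 1) # C) @ t @ [(1, 1)]" using X(2,3) by (metis append.assoc append_butlast_last_id)
    moreover have "hd (t @ [(1, 1)]) = z" using t(2) by (cases t) auto
    ultimately show ?thesis using t(2) by (intro exI[of _ "t @ [(1, 1)]"]) auto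
  qed
  show ?thesis
  proof
    assume L: "T2'' l (tree_of p)"
    have in1: "(1, 1) \<in> set (z # B)"
    proof -
      have "(1, 1) = z \<or> strictly_before (C @ z # B) z (1, 1)" using L T2 unfolding weakly_after_def by blast
      then show ?thesis
      proof
        assume "strictly_before (C @ z # B) z (1, 1)"
        then obtain xs ys zs where e: "C @ z # B = xs @ z # ys @ (1, 1) # zs" by (auto simp: strictly_before_def)
        have "(C @ [z]) @ B = (xs @ [z]) @ ys @ (1, 1) # zs" using e by simp
        moreover have "distinct ((C @ [z]) @ B)" using ds(2) by simp
        ultimately have "B = ys @ (1, 1) # zs"
          using append_last_unique[of "C @ [z]" B "xs @ [z]" "ys @ (1, 1) # zs"] by simp
        then show ?thesis by simp
      qed simp
    qed
    obtain Z where Z: "X = ((r + 1, 1) # C) @ Z" "z # B = Z @ us" "Z \<noteq> []" "hd Z = z" "last Z = (1, 1)"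
      using cut[OF in1] by blast
    have Zpos: "\<forall>x\<in>set Z. 1 \<le> fst x" using X(4) Z(1) by simp
    have lz: "A @ z # B = (A @ [z]) @ B" by simp
    have fpA: "fpath p (A @ [z])" using *(1) unfolding full_path_def lz by (simp add: fpath_append)
    have dA: "distinct (A @ [z])" "A @ [z] \<noteq> []" using ds(1) by auto
    have hA: "hd (A @ [z]) = (l, 1)" using *(3) by (cases A) auto
    have lev: "\<forall>x\<in>set (A @ [z]). l \<le> fst x" using *(4) fst_V by auto
    have lf: "\<forall>i\<in>{l+1..-1}. last_followed_by (A @ [z]) (i - 1) (i, 1)" using L T2 by blast
    have "l \<le> -1" using l by simp
    from blocks_of_last_followed[OF F(1) fpA dA hA lev this lf]
    obtain s Y where sY: "A @ [z] = concat (map s [l..-1-1]) @ Y" "Y \<noteq> []" "hd Y = (-1, 1)" "\<forall>x\<in>set Y. -1 \<le> fst x"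
      "\<forall>i\<in>{l..-1-1}. block s i" "\<forall>i. i \<notin> {l..-1-1} \<longrightarrow> s i = []" by (elim exE conjE)
    have "fst (hd Y) < 0" using sY(3) by simp
    then have "\<exists>x\<in>set Y. fst x < 0" using sY(2) hd_in_set by blast
    \<comment> \<open>The last negative vertex \<open>b\<close> before the meet closes segment -1,
      and the link starts behind it.\<close>
    then obtain B0 b q1 where B0: "Y = B0 @ b # q1" "fst b < 0" "\<forall>x\<in>set q1. \<not> fst x < 0"
      using split_list_last_prop[of Y "\<lambda>x. fst x < 0"] by blast
    have lastY: "last Y = z" using sY(1,2) by (metis last_appendR last_snoc)
    have zpos: "fst z > 0" using L T2 by blast
    have q1: "q1 \<noteq> []" using B0 lastY zpos by auto
    have lq1: "last q1 = z" using lastY B0(1) q1 by simp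
    have fb: "fst b = -1" using sY(4) B0(1,2) by auto
    have "fpath p Y" using fpA unfolding sY(1) by (simp add: fpath_append)
    then have pb: "p b = Some (hd q1)" using q1 unfolding B0(1) by (simp add: fpath_append fpath_Cons)
    have "fst (hd q1) \<ge> 0" using B0(3) q1 by (meson hd_in_set not_less)
    then have hq1: "fst (hd q1) = 0" using Fun_step[OF F(1) pb] fb by simp
    \<comment> \<open>The meet is the end of \<open>q1\<close> and the head of \<open>Z\<close>, so
      it is taken only once.\<close>
    define E where "E = q1 @ tl Z"
    have E: "E \<noteq> []" "fst (hd E) = 0" "last E = (1, 1)" "\<forall>x\<in>set E. 0 \<le> fst x"
    proof -
      show "E \<noteq> []" "fst (hd E) = 0" using q1 hq1 by (auto simp: E_def)
      show "last E = (1, 1)" using Z(3-5) lq1 by (cases Z) (auto simp: E_def split: if_splits)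
      have "0 \<le> fst x" if "x \<in> set (tl Z)" for x
        using Zpos that Z(3) list.set_sel(2)[of Z x] by fastforce
      then show "\<forall>x\<in>set E. 0 \<le> fst x" using B0(3) by (auto simp: E_def not_less)
    qed
    \<comment> \<open>Behind \<open>(1, 1)\<close>, segment 0 extends to the vertex before the first
      visit to abscissa -1 or, without such a visit, to the root; either vertex is
      \<open>(0, 1)\<close>.\<close>
    obtain S0 Q0 where S0: "us = S0 @ Q0" "S0 \<noteq> []" "last S0 = (0, 1)" "\<forall>x\<in>set S0. 0 \<le> fst x"
      "Q0 = [] \<or> fst (hd Q0) = -1"
    proof (cases "\<exists>v\<in>set (C @ z # B). fst v = -1")
      case True
      then have "first_preceded_by (C @ z # B) (-1) (0, 1)" using L T2 by simp
      then obtain xs w ys where w: "C @ z # B = xs @ (0, 1) # w # ys" "fst w = -1" "\<forall>u\<in>set (xs @ [(0, 1)]). fst u \<noteq> -1"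
        unfolding first_preceded_by_def by blast
      have "(0, 1) \<notin> set X" using X(4) by fastforce
      moreover have "((r + 1, 1) # xs) @ (0, 1) # w # ys = X @ us" using X(1) w(1) by simp
      ultimately obtain t where t: "(r + 1, 1) # xs = X @ t" "us = t @ (0, 1) # w # ys"
        using distinct_prefix dsX by meson
      have "set t \<subseteq> set ((r + 1, 1) # xs)" unfolding t(1) by simp
      then have av: "\<forall>u\<in>set (t @ [(0, 1)]). fst u \<noteq> 0 - 1" using w(3) top_not_low by auto
      have ft: "fpath p (t @ [(0, 1)])" using fus unfolding t(2) by (auto simp: fpath_append fpath_Cons)
      have hdt: "0 \<le> fst (hd (t @ [(0, 1)]))" using X(6) unfolding t(2) by (cases t) auto
      show thesis
        using that[of "t @ [(0, 1)]" "w # ys"] level_avoid[OF F(1) ft hdt av] t(2) w(2) by simp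
    next
      case False
      then have rt: "root_of p = (0, 1)" using L T2 by simp
      have "set us \<subseteq> set ((r + 1, 1) # C @ z # B)" unfolding X(1) by simp
      then have av: "\<forall>u\<in>set us. fst u \<noteq> 0 - 1" using False top_not_low by auto
      have "last us = (0, 1)" using *(11) rt X(5) unfolding Z(2) by simp
      then show thesis using that[of us "[]"] X(5,6) level_avoid[OF F(1) fus _ av] by simp
    qed
    define s' where "s' = s(-1 := B0 @ [b], 0 := S0)"
    define q where "q = links_of E Q0"
    have q: "links q" unfolding q_def links_links_of using E S0(5) by blast
    have c1: "concat (map s' [l..-1]) = concat (map s [l..-1-1]) @ B0 @ [b]"
    proof -
      have "[l..-1] = [l..-1-1] @ [-1]" using l by (intro upto_rec2) auto
      moreover have "map s' [l..-1-1] = map s [l..-1-1]" by (auto simp: s'_def)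
      ultimately have "map s' [l..-1] = map s [l..-1-1] @ [B0 @ [b]]" by (simp add: s'_def)
      then show ?thesis by simp
    qed
    have "Z = z # tl Z" using Z(3,4) by (cases Z) auto
    then have "A @ z # B = (A @ [z]) @ tl Z @ us" using Z(2) by (metis append.assoc append_Cons append_Nil)
    also have "\<dots> = concat (map s' [l..-1]) @ E @ S0 @ Q0" unfolding sY(1) c1 E_def S0(1) B0(1) by simp
    finally have lp: "A @ z # B = concat (map s' [l..-1]) @ E @ S0 @ Q0" .
    have sp: "spine downs s' q = A @ z # B"
      unfolding lp using spine_downs[of q s'] q by (simp add: links_def q_def links_of_def s'_def)
    have hS0: "fst (hd S0) = 0" using X(6) S0(1,2) by simp
    have bl: "s' i \<noteq> [] \<and> (\<forall>x\<in>set (s' i). i \<le> fst x) \<and> fst (hd (s' i)) = i \<and> fst (last (s' i)) = i" if i: "i \<in> {l..0}" for i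
    proof -
      consider "i = 0" | "i = -1" | "i \<in> {l..-1-1}" using i by fastforce
      then show ?thesis
      proof cases
        case 1
        then show ?thesis using S0(2-4) hS0 by (simp add: s'_def)
      next
        case 2
        have "hd (B0 @ [b]) = (-1, 1)" using sY(3) B0(1) by (cases B0) auto
        then show ?thesis using 2 sY(4) fb B0(1) by (auto simp: s'_def)
      next
        case 3
        then show ?thesis using sY(5) by (auto simp: s'_def block_def)
      qed
    qed
    have "hd (s' i) = (i, 1)" if "i \<in> {l..-1}" for i
    proof (cases "i = -1")
      case True
      have "hd (B0 @ [b]) = (-1, 1)" using sY(3) B0(1) by (cases B0) auto
      then show ?thesis using True by (simp add: s'_def)
    next
      case False
      then show ?thesis using sY(5) that by (auto simp: s'_def block_def)
    qed
    moreover have "\<forall>i. i \<notin> {l..0} \<longrightarrow> s' i = []" using sY(6) l by (auto simp: s'_def)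
    moreover have "set (A @ z # B) \<subseteq> W" using *(4) Fun_V_W by blast
    ultimately have "pre_II p s' q" unfolding pre_II_def sp using F T1(1) q bl *(1) by blast
    moreover have "last (s' 0) = (0, 1)" using S0(3) by (simp add: s'_def)
    ultimately have "(p, s', q) \<in> FinII" by (simp add: FinII_def)
    then show "p \<in> fst ` FinII" by force
  next
    assume "p \<in> fst ` FinII"
    then obtain s q where pre: "pre_II p s q" "last (s 0) = (0, 1)" by (auto simp: FinII_def)
    define Y0 where "Y0 = concat (map s [l..-1])"
    have q: "links q" and fp: "full_path p (spine downs s q)" using pre by (auto simp: pre_II_def)
    have sp: "spine downs s q = Y0 @ q (-1) @ s 0 @ q 0" using pre_II_spine[OF pre(1)] by (simp add: Y0_def)
    have Y0: "Y0 \<noteq> []" "hd Y0 = (l, 1)" "fst (last Y0) = -1" using concat_neg[OF pre(1)] by (auto simp: Y0_def)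
    have qs: "q (-1) \<noteq> []" "last (q (-1)) = (1, 1)" "\<forall>x\<in>set (q (-1)). 0 \<le> fst x" "q 0 = [] \<or> fst (hd (q 0)) = -1"
      using q by (auto simp: links_def)
    have s0: "s 0 \<noteq> []" "\<forall>x\<in>set (s 0). 0 \<le> fst x" using pre l by (auto simp: pre_II_def)
    have lp: "A @ z # B = Y0 @ q (-1) @ s 0 @ q 0"
      using full_path_unique[OF *(1) fp] *(3) Y0 unfolding sp by simp
    have in_l: "(1, 1) \<in> set (A @ z # B)" unfolding lp using qs(1,2) last_in_set[of "q (-1)"] by simp
    have in1: "(1, 1) \<in> set (z # B)"
    proof (rule ccontr)
      assume n: "(1, 1) \<notin> set (z # B)"
      then have "(1, 1) \<in> set A" using in_l by simp
      have "(1, 1) \<in> set (X @ us)" using X(2,3) last_in_set[of X] by simp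
      \<comment> \<open>Lying on a path inside \<open>V\<close>, \<open>(1, 1)\<close> is not the
        extra vertex, so it also occurs on the path that starts at the mark.\<close>
      moreover have "(1, 1) \<in> V" using in_l *(4) by blast
      then have "(1, 1) \<noteq> (r + 1, 1 :: nat)" using fst_V[of "(1, 1)"] by auto
      ultimately have "(1, 1) \<in> set (C @ z # B)" unfolding X(1)[symmetric] by auto
      then show False using \<open>(1, 1) \<in> set A\<close> *(6) by blast
    qed
    obtain Z where Z: "X = ((r + 1, 1) # C) @ Z" "z # B = Z @ us" "Z \<noteq> []" "hd Z = z" "last Z = (1, 1)"
      using cut[OF in1] by blast
    have Zpos: "\<forall>x\<in>set Z. 1 \<le> fst x" and Cpos: "\<forall>x\<in>set C. 1 \<le> fst x" using X(4) Z(1) by auto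
    have "(1, 1) = z \<or> strictly_before (C @ z # B) z (1, 1)"
    proof (cases "(1, 1) = z")
      case False
      then have "(1, 1) \<in> set B" using in1 by simp
      then obtain ys zs where "B = ys @ (1, 1) # zs" by (meson split_list)
      then show ?thesis unfolding strictly_before_def by blast
    qed simp
    then have "weakly_after (C @ z # B) (1, 1) z" using in1 unfolding weakly_after_def by auto
    moreover have "fst z > 0" using Zpos Z(3,4) hd_in_set by fastforce
    moreover have "last_followed_by (A @ [z]) (i - 1) (i, 1)" if i: "i \<in> {l+1..-1}" for i
    proof -
      have "(A @ Z) @ us = (Y0 @ q (-1)) @ s 0 @ q 0" using lp Z(2) by simp
      moreover have "distinct ((A @ Z) @ us)" using ds(1) Z(2) by simp
      ultimately have "A @ Z = Y0 @ q (-1)"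
        using append_last_unique[of "A @ Z" us "Y0 @ q (-1)" "s 0 @ q 0"] Z(3,5) qs(1,2) by simp
      then consider u where "A = Y0 @ u" "u @ Z = q (-1)" | u where "A @ u = Y0" "Z = u @ q (-1)"
        by (auto simp: append_eq_append_conv2)
      then obtain u where u: "A = Y0 @ u" "\<forall>x\<in>set u. 0 \<le> fst x"
      proof cases
        case 1
        then show ?thesis using that[of u] qs(3) by (metis Un_iff set_append)
      next
        case 2
        \<comment> \<open>Otherwise the end of \<open>Y0\<close>, at abscissa -1, would lie on the
          positive stretch \<open>Z\<close>.\<close>
        have "u = []"
        proof (rule ccontr)
          assume "u \<noteq> []"
          then have "last Y0 \<in> set Z" using 2 by (metis Un_iff last_appendR last_in_set set_append)
          then show False using Zpos Y0(3) by fastforce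
        qed
        then show ?thesis using that[of "[]"] 2 by simp
      qed
      have b: "\<forall>i\<in>{l..-1}. block s i" using pre(1) by (auto simp: pre_II_def block_def)
      have "\<forall>x\<in>set (u @ [z]). -1 \<le> fst x" using u(2) \<open>fst z > 0\<close> by auto
      from last_followed_by_blocks[OF i b this] show ?thesis unfolding u(1) Y0_def by simp
    qed
    moreover have us: "us = s 0 @ q 0"
    proof -
      have "(A @ Z) @ us = (Y0 @ q (-1)) @ s 0 @ q 0" using lp Z(2) by simp
      moreover have "distinct ((A @ Z) @ us)" using ds(1) Z(2) by simp
      ultimately show ?thesis
        using append_last_unique[of "A @ Z" us "Y0 @ q (-1)" "s 0 @ q 0"] Z(3,5) qs(1,2) by simp
    qed
    have rp: "C @ z # B = C @ Z @ s 0 @ q 0" using Z(2) us by simp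
    have low: "\<forall>x\<in>set (C @ Z @ s 0). fst x \<noteq> -1" using Cpos Zpos s0(2) by fastforce
    have "if \<exists>v\<in>set (C @ z # B). fst v = -1 then first_preceded_by (C @ z # B) (-1) (0, 1) else root_of p = (0, 1)"
    proof (cases "q 0 = []")
      case True
      then have "\<not> (\<exists>v\<in>set (C @ z # B). fst v = -1)" unfolding rp using low by auto
      moreover have "root_of p = last (Z @ us)" using *(11) Z(2) by simp
      then have "root_of p = (0, 1)" using us True s0(1) pre(2) by simp
      ultimately show ?thesis by simp
    next
      case False
      then have h: "fst (hd (q 0)) = -1" using qs(4) by simp
      have "s 0 = butlast (s 0) @ [(0, 1)]" using s0(1) pre(2) append_butlast_last_id[of "s 0"] by simp
      then have "C @ z # B = (C @ Z @ butlast (s 0)) @ (0, 1) # hd (q 0) # tl (q 0)"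
        unfolding rp using False by (metis append.assoc append_Cons append_Nil hd_Cons_tl)
      moreover have "\<forall>u\<in>set ((C @ Z @ butlast (s 0)) @ [(0, 1)]). fst u \<noteq> -1"
        using low by (auto dest: in_set_butlastD)
      ultimately have "first_preceded_by (C @ z # B) (-1) (0, 1)" unfolding first_preceded_by_def using h by blast
      moreover have "\<exists>v\<in>set (C @ z # B). fst v = -1" unfolding rp using False h hd_in_set by fastforce
      ultimately show ?thesis by simp
    qed
    ultimately show "T2'' l (tree_of p)" unfolding T2 by blast
  qed
qed

lemma FinI_image: "p \<in> fst ` FinI \<Longrightarrow> p \<in> trees \<and> T1_map p \<and> p (1, 1) \<in> Some ` level V 0"
  by (auto simp: FinI_def trees_def)

lemma Fin_iff:
  "p \<in> fst ` FinI \<union> fst ` FinII \<longleftrightarrow> p \<in> trees \<and> T1 r (tree_of p) \<and> T2 l r (tree_of p)"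
proof
  assume p: "p \<in> fst ` FinI \<union> fst ` FinII"
  then have "p \<in> trees \<and> T1_map p \<and> p (1, 1) \<in> Some ` level V 0" using FinI_image FinII_image by blast
  then show "p \<in> trees \<and> T1 r (tree_of p) \<and> T2 l r (tree_of p)"
    using p T1_tree_of T2'_tree_of T2''_tree_of unfolding T2_def by blast
next
  assume p: "p \<in> trees \<and> T1 r (tree_of p) \<and> T2 l r (tree_of p)"
  then show "p \<in> fst ` FinI \<union> fst ` FinII"
    using T1_tree_of T2'_tree_of T2''_tree_of unfolding T2_def by blast
qed

section \<open>Every marked tree arises from exactly one acyclic function on
  \<open>W\<close>\<close>

lemma one_in_S: "1 \<in> S" using Max_in[OF S(1,2)] S(4) by simp

lemma parent_tree_of: "p \<in> trees \<Longrightarrow> parent (fst (tree_of p)) = p |` V"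
  using parent_map_tree[OF rooted_map_restrict] by (simp add: tree_of_def)

lemma inj_on_tree_of: "inj_on tree_of trees"
proof (rule inj_onI)
  fix p p' assume pp: "p \<in> trees" "p' \<in> trees" "tree_of p = tree_of p'"
  have F: "Fun p" "Fun p'" using pp by (auto simp: trees_def)
  have "parent (fst (tree_of p)) = p |` V" "parent (fst (tree_of p')) = p' |` V"
    using parent_tree_of pp(1,2) by blast+
  then have r: "p |` V = p' |` V" using pp(3) by simp
  have "p (r + 1, 1) = p' (r + 1, 1)"
    using pp(3) Fun_top[OF F(1)] Fun_top[OF F(2)] by (metis option.sel snd_conv tree_of_def)
  show "p = p'"
  proof
    fix x
    consider "x \<in> V" | "x = (r + 1, 1)" | "x \<notin> W" by (auto simp: W_def)
    then show "p x = p' x"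
    proof cases
      case 1
      then show ?thesis using r by (metis restrict_in)
    next
      case 3
      then have "p x = None" "p' x = None" using Fun_in[OF F(1)] Fun_in[OF F(2)] by (metis not_Some_eq)+
      then show ?thesis by simp
    qed (use \<open>p (r + 1, 1) = p' (r + 1, 1)\<close> in simp)
  qed
qed

lemma marked_tree_of:
  assumes "p \<in> trees" shows "marked_S_tree S V r (tree_of p)"
proof -
  have F: "Fun p" using assms by (simp add: trees_def)
  have rm: "rooted_map V (root_of p) (p |` V)" by (rule rooted_map_restrict[OF assms])
  obtain m where m: "p (r + 1, 1) = Some m" "m \<in> level V r" using Fun_top[OF F] .
  have "the (parent (map_tree V (root_of p) (p |` V)) v) \<in> (\<Union>s\<in>S. level V (fst v - s))" if v: "v \<in> V - {root_of p}" for v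
  proof -
    have "v \<in> dom p" using v Fun_dom(2)[OF F] Fun_V_W by auto
    then obtain w where w: "p v = Some w" by auto
    then have "w \<in> V" "fst v - fst w \<in> S" using Fun_in[OF F w] F w by (auto simp: Fun_def)
    moreover have "fst w = fst v - (fst v - fst w)" by simp
    ultimately have "w \<in> (\<Union>s\<in>S. level V (fst v - s))" unfolding level_def by blast
    then show ?thesis using parent_map_tree[OF rm] v w by simp
  qed
  then have "S_tree S V (map_tree V (root_of p) (p |` V))"
    using rooted_tree_map_tree[OF rm] by (simp add: S_tree_def map_tree_def)
  moreover have "snd (map_tree V (root_of p) (p |` V)) = root_of p" by (simp add: map_tree_def)
  ultimately show ?thesis using Fun_dom(1)[OF F] m by (simp add: marked_S_tree_def tree_of_def)
qed

lemma marked_obtain_tree_of: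
  assumes "marked_S_tree S V r M" obtains p where "p \<in> trees" "M = tree_of p"
proof -
  obtain T m where M: "M = (T, m)" by (metis prod.exhaust)
  have T: "rooted_tree V T" "\<forall>v\<in>V - {snd T}. the (parent T v) \<in> (\<Union>s\<in>S. level V (fst v - s))"
    "snd T \<in> level V 0" "m \<in> level V r"
    using assms by (auto simp: M marked_S_tree_def S_tree_def)
  obtain p0 where p0: "rooted_map V (snd T) p0" "T = map_tree V (snd T) p0" using rooted_tree_obtain_map[OF T(1)] .
  have par: "parent T = p0" using parent_map_tree[OF p0(1)] p0(2) by simp
  have dom0: "dom p0 = V - {snd T}" "ran p0 \<subseteq> V" "cyclic_points p0 = {}" using p0(1) by (auto simp: rooted_map_def)
  have top: "(r + 1, 1) \<notin> V" using in_V_iff by simp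
  define p where "p = p0((r + 1, 1) \<mapsto> m)"
  have mV: "m \<in> V" "fst m = r" using T(4) by (auto simp: level_def)
  have st: "fst x - fst y \<in> S" if xy: "p x = Some y" for x y
  proof (cases "x = (r + 1, 1)")
    case True
    \<comment> \<open>The added edge leads from abscissa \<open>r + 1\<close> to the mark at
      \<open>r\<close>, a step of size 1.\<close>
    then show ?thesis using xy mV one_in_S by (auto simp: p_def)
  next
    case False
    then have "p0 x = Some y" using xy by (simp add: p_def)
    then have "x \<in> V - {snd T}" using dom0(1) by auto
    then have "y \<in> (\<Union>s\<in>S. level V (fst x - s))" using T(2) \<open>p0 x = Some y\<close> par by (metis option.sel)
    then show ?thesis by (auto simp: level_def)
  qed
  have ne: "snd T \<noteq> (r + 1, 1)" using T(3) top by (auto simp: level_def)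
  have "dom p = W - {snd T}" using dom0(1) ne by (auto simp: p_def W_def)
  moreover have "ran p \<subseteq> V" using dom0(2) mV by (auto simp: p_def ran_def)
  ultimately have F: "Fun p" unfolding Fun_def using T(3) st by blast
  have "fcycle p0 c" if c: "fcycle p c" for c
  proof -
    \<comment> \<open>The extra vertex is not the image of any vertex, so adding it closes no
      cycle.\<close>
    have "(r + 1, 1) \<notin> set c"
    proof
      assume "(r + 1, 1) \<in> set c"
      then obtain d where "fcycle p d" "hd d = (r + 1, 1)" using fcycle_rotate_hd[OF c] by metis
      then have "p (last d) = Some (r + 1, 1)" by (simp add: fcycle_def)
      then show False using Fun_in[OF F] top by blast
    qed
    then have "p x = p0 x" if "x \<in> set c" for x using that by (auto simp: p_def)
    then show ?thesis using fcycle_cong[of c p p0] c by blast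
  qed
  then have "cyclic_points p = {}" using dom0(3) by (fastforce simp: cyclic_points_def)
  then have "p \<in> trees" using F by (simp add: trees_def)
  moreover have "root_of p = snd T"
    using root_eqI[OF F, of "snd T"] T(3) \<open>dom p = W - {snd T}\<close> by (auto simp: level_0 dom_def)
  moreover have "p |` V = p0"
  proof
    fix x show "(p |` V) x = p0 x"
    proof (cases "x \<in> V")
      case True
      then show ?thesis using top by (auto simp: p_def)
    next
      case False
      then have "p0 x = None" using dom0(1) by auto
      then show ?thesis using False by simp
    qed
  qed
  ultimately have "M = tree_of p" using p0(2) M by (simp add: tree_of_def p_def)
  then show thesis using that \<open>p \<in> trees\<close> by blast
qed

lemma bij_tree_of:
  "bij_betw tree_of (fst ` FinI \<union> fst ` FinII) {M. marked_S_tree S V r M \<and> T1 r M \<and> T2 l r M}"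
  unfolding bij_betw_def
proof
  show "inj_on tree_of (fst ` FinI \<union> fst ` FinII)"
    using inj_on_tree_of Fin_iff by (meson inj_on_subset subsetI)
  show "tree_of ` (fst ` FinI \<union> fst ` FinII) = {M. marked_S_tree S V r M \<and> T1 r M \<and> T2 l r M}" (is "?L = ?R")
  proof
    show "?L \<subseteq> ?R"
    proof
      fix M assume "M \<in> ?L"
      then obtain p where "M = tree_of p" "p \<in> fst ` FinI \<union> fst ` FinII" by blast
      then show "M \<in> ?R" using Fin_iff[of p] marked_tree_of[of p] by simp
    qed
    show "?R \<subseteq> ?L"
    proof
      fix M assume M: "M \<in> ?R"
      then obtain p where "p \<in> trees" "M = tree_of p" using marked_obtain_tree_of by blast
      then show "M \<in> ?L" using Fin_iff[of p] M by blast
    qed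
  qed
qed

section \<open>Passing between functions on \<open>V\<close> and on \<open>W\<close>\<close>

definition extend :: "(vertex \<rightharpoonup> vertex) \<Rightarrow> vertex \<rightharpoonup> vertex" where
  "extend f = f((r + 1, 1) \<mapsto> (r, 1))"

lemma fpath_N: "fpath f N \<longleftrightarrow> (\<forall>i\<in>{l..-2}. f (i, 1) = Some (i + 1, 1))"
proof -
  have "{l..<-1} = {l..-2 :: int}" by auto
  then show ?thesis unfolding fpath_def successively_map_upto by simp
qed

lemma extend_restrict:
  assumes "dom f = V - {(0, 1)}" shows "extend f |` V = f"
proof
  fix x
  have "(r + 1, 1) \<notin> V" using in_V_iff by simp
  moreover have "x \<notin> V \<Longrightarrow> f x = None" using assms by (auto simp: dom_def)
  ultimately show "(extend f |` V) x = f x" by (auto simp: extend_def restrict_map_def)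
qed

text \<open>Sending \<open>(r + 1, 1)\<close> to \<open>(r, 1)\<close> continues the chain
  prescribed by \<open>condition_F\<close> by one step, so the extra edge is the same for all given
  functions and carries no information.\<close>

lemma bij_extend:
  "bij_betw extend {f. dom f = V - {(0, 1)} \<and> S_function S V f \<and> condition_F l r V f} A0"
proof (rule bij_betw_byWitness[where f' = "\<lambda>p. p |` V"])
  have top: "(r + 1, 1) \<notin> V" using in_V_iff by simp
  let ?A = "{f. dom f = V - {(0, 1)} \<and> S_function S V f \<and> condition_F l r V f}"
  show "\<forall>f\<in>?A. extend f |` V = f" using extend_restrict by simp
  show "\<forall>p\<in>A0. extend (p |` V) = p"
  proof
    fix p assume p: "p \<in> A0"
    then have F: "Fun p" by (simp add: A0_def)
    show "extend (p |` V) = p"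
    proof
      fix x
      consider "x \<in> V" | "x = (r + 1, 1)" | "x \<notin> W" by (auto simp: W_def)
      then show "extend (p |` V) x = p x"
      proof cases
        case 1
        then show ?thesis using top by (auto simp: extend_def)
      next
        case 2
        then show ?thesis using p r by (auto simp: extend_def A0_def)
      next
        case 3
        then have "p x = None" using Fun_in[OF F] by (metis not_Some_eq)
        then show ?thesis using 3 by (auto simp: extend_def W_def)
      qed
    qed
  qed
  show "extend ` ?A \<subseteq> A0"
  proof
    fix p assume "p \<in> extend ` ?A"
    then obtain f where p: "p = extend f" and f: "dom f = V - {(0, 1)}" "S_function S V f" "condition_F l r V f" by blast
    have low: "p x = f x" if "fst x \<le> r" for x using that by (auto simp: p extend_def)
    have f0: "f (0, 1) = None" using f(1) by (auto simp: dom_def)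
    have b0: "(0, 1) \<in> level V 0" using base_in_V[of 0] l r by (simp add: level_def)
    have rV: "(r, 1) \<in> V" using base_in_V[of r] l r by simp
    have val: "y \<in> V \<and> fst x - fst y \<in> S" if "f x = Some y" for x y
    proof -
      have "y \<in> (\<Union>s\<in>S. level V (fst x - s))" using f(2) that unfolding S_function_def by blast
      then show ?thesis by (auto simp: level_def)
    qed
    have "dom p = W - {(0, 1)}" using f(1) r by (auto simp: p extend_def W_def)
    moreover have "ran p \<subseteq> V" using val rV by (auto simp: p extend_def ran_def)
    moreover have "fst x - fst y \<in> S" if "p x = Some y" for x y
      using that val[of x y] one_in_S by (cases "x = (r + 1, 1)") (auto simp: p extend_def)
    ultimately have "Fun p" unfolding Fun_def using b0 by blast
    moreover have "negative_part p"
    proof -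
      have "fpath p N" unfolding fpath_N using f(3) low r by (simp add: condition_F_def)
      moreover have "p (-1, 1) \<in> Some ` level V 0" using f(3) low[of "(-1, 1)"] r by (auto simp: condition_F_def)
      ultimately show ?thesis using f0 low[of "(0, 1)"] r by (simp add: negative_part_def)
    qed
    moreover have "p (i, 1) = Some (i - 1, 1)" if "i \<in> {1..r + 1}" for i
      using that f(3) low[of "(i, 1)"] by (cases "i = r + 1") (auto simp: p extend_def condition_F_def)
    ultimately show "p \<in> A0" by (simp add: A0_def)
  qed
  show "(\<lambda>p. p |` V) ` A0 \<subseteq> ?A"
  proof
    fix f assume "f \<in> (\<lambda>p. p |` V) ` A0"
    then obtain p where f: "f = p |` V" and p: "Fun p" "negative_part p" "\<forall>i\<in>{1..r + 1}. p (i, 1) = Some (i - 1, 1)"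
      by (auto simp: A0_def)
    have "p (0, 1) = None" using p by (simp add: negative_part_def)
    then have "root_of p = (0, 1)" using root_eqI[OF p(1), of "(0, 1)"] base_in_W[of 0] l r by simp
    then have "dom f = V - {(0, 1)}" using Fun_dom(2)[OF p(1)] Fun_V_W by (auto simp: f)
    moreover have "S_function S V f"
      unfolding S_function_def
    proof (intro conjI allI impI)
      show "dom f \<subseteq> V" using calculation by auto
      fix v w assume "f v = Some w"
      then have "p v = Some w" by (auto simp: f restrict_map_def split: if_splits)
      then have "w \<in> V" "fst v - fst w \<in> S" using Fun_in[OF p(1)] p(1) by (auto simp: Fun_def)
      moreover have "fst w = fst v - (fst v - fst w)" by simp
      ultimately show "w \<in> (\<Union>s\<in>S. level V (fst v - s))" unfolding level_def by blast
    qed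
    moreover have "condition_F l r V f"
    proof -
      have in_V: "f (i, 1) = p (i, 1)" if "l \<le> i" "i \<le> r" for i using base_in_V[OF that] by (simp add: f)
      have "\<forall>i\<in>{l..-2}. p (i, 1) = Some (i + 1, 1)" using p(2) unfolding negative_part_def fpath_N by blast
      then have "\<forall>i\<in>{l..-2}. f (i, 1) = Some (i + 1, 1)" using in_V r by auto
      moreover have "\<exists>w\<in>level V 0. f (-1, 1) = Some w" using p(2) in_V[of "-1"] l r by (auto simp: negative_part_def)
      moreover have "\<forall>i\<in>{1..r}. f (i, 1) = Some (i - 1, 1)" using p(3) in_V l by auto
      ultimately show ?thesis by (simp add: condition_F_def)
    qed
    ultimately show "f \<in> ?A" by simp
  qed
qed

text \<open>The extra vertex is the only one of its abscissa, so a level-preserving permutation of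
  \<open>W\<close> fixes it and permutes \<open>V\<close>. Dropping its edge therefore leaves a
  rearrangement on \<open>V\<close>, where the types are counted.\<close>

lemma similar_restrict:
  assumes "similar W f p" shows "similar V (f |` V) (p |` V)"
proof -
  obtain \<sigma> \<pi> where *: "level_perm W \<sigma>" "level_perm W \<pi>" and p: "p = (\<lambda>x. map_option \<sigma> (f (\<pi> x)))"
    using assms unfolding similar_def by blast
  have lp: "level_perm V \<rho>" if \<rho>: "level_perm W \<rho>" for \<rho>
  proof -
    have "\<rho> x = x" if "x \<notin> V" for x
    proof (cases "x \<in> W")
      case True
      then have "x = (r + 1, 1)" using that by (simp add: W_def)
      moreover have "\<rho> x \<in> W" "fst (\<rho> x) = fst x" using \<rho> True level_perm_in[OF \<rho>] by (auto simp: level_perm_def)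
      ultimately show ?thesis using top_W[of "\<rho> x"] by simp
    next
      case False
      then show ?thesis using \<rho> by (simp add: level_perm_def)
    qed
    then show ?thesis using \<rho> by (simp add: level_perm_def)
  qed
  have "(p |` V) = (\<lambda>x. map_option \<sigma> ((f |` V) (\<pi> x)))"
    using level_perm_V[OF *(2)] by (auto simp: p restrict_map_def fun_eq_iff)
  then show ?thesis using similarI[OF lp[OF *(1)] lp[OF *(2)]] by metis
qed

lemma main:
  "\<exists>\<Phi> :: (vertex \<rightharpoonup> vertex) \<Rightarrow> vertex rooted \<times> vertex.
    bij_betw \<Phi>
      {f. dom f = V - {(0, 1)} \<and> S_function S V f \<and> condition_F l r V f}
      {M. marked_S_tree S V r M \<and> T1 r M \<and> T2 l r M} \<and>
    (\<forall>f. dom f = V - {(0, 1)} \<and> S_function S V f \<and> condition_F l r V f \<longrightarrow>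
      (\<forall>j s. card {v \<in> V. out_type (parent (fst (\<Phi> f))) v = Some (j, s)} =
             card {v \<in> V. out_type f v = Some (j, s)}) \<and>
      (\<forall>i c. card {v \<in> V. in_type (parent (fst (\<Phi> f))) v = (i, c)} =
             card {v \<in> V. in_type f v = (i, c)}))"
proof -
  let ?A = "{f. dom f = V - {(0, 1)} \<and> S_function S V f \<and> condition_F l r V f}"
  obtain \<Psi> where \<Psi>: "bij_betw \<Psi> A0 (fst ` FinI \<union> fst ` FinII)" "\<forall>x\<in>A0. similar W x (\<Psi> x)"
    using A0_Fin unfolding matched_def by auto
  define \<Phi> where "\<Phi> = tree_of \<circ> (\<Psi> \<circ> extend)"
  have "bij_betw \<Phi> ?A {M. marked_S_tree S V r M \<and> T1 r M \<and> T2 l r M}"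
    unfolding \<Phi>_def using bij_betw_trans[OF bij_betw_trans[OF bij_extend \<Psi>(1)] bij_tree_of] .
  moreover have sim: "similar V f (parent (fst (\<Phi> f)))" if f: "f \<in> ?A" for f
  proof -
    have e: "extend f \<in> A0" using bij_betwE[OF bij_extend] f by blast
    then have "\<Psi> (extend f) \<in> trees" using bij_betwE[OF \<Psi>(1)] Fin_iff by blast
    then have "parent (fst (\<Phi> f)) = \<Psi> (extend f) |` V"
      using parent_tree_of by (simp add: \<Phi>_def)
    moreover have "extend f |` V = f" using extend_restrict f by simp
    ultimately show ?thesis using similar_restrict[of "extend f" "\<Psi> (extend f)"] \<Psi>(2) e by simp
  qed
  ultimately show ?thesis
    using similar_out_type[OF sim] similar_in_type[OF sim]
    by (intro exI[of _ \<Phi>] conjI allI impI) simp_all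
qed

end

theorem theorem5p3:
  fixes l r :: int and n :: "int \<Rightarrow> nat" and S :: "int set" and V :: "vertex set"
  assumes "l < 0" and "0 \<le> r"
    and "\<forall>i\<in>{l..r}. n i > 0"
    and "V = vertex_set l r n"
    and "finite S" and "S \<noteq> {}" and "Min S = -1" and "Max S = 1"
  shows "\<exists>\<Phi> :: (vertex \<rightharpoonup> vertex) \<Rightarrow> vertex rooted \<times> vertex.
    bij_betw \<Phi>
      {f. dom f = V - {(0, 1)} \<and> S_function S V f \<and> condition_F l r V f}
      {M. marked_S_tree S V r M \<and> T1 r M \<and> T2 l r M} \<and>
    (\<forall>f. dom f = V - {(0, 1)} \<and> S_function S V f \<and> condition_F l r V f \<longrightarrow>
      (\<forall>j s. card {v \<in> V. out_type (parent (fst (\<Phi> f))) v = Some (j, s)} =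
             card {v \<in> V. out_type f v = Some (j, s)}) \<and>
      (\<forall>i c. card {v \<in> V. in_type (parent (fst (\<Phi> f))) v = (i, c)} =
             card {v \<in> V. in_type f v = (i, c)}))"
proof -
  interpret profile l r n S V by unfold_locales (use assms in auto)
  show ?thesis by (rule main)
qed

end
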